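(* For minimal LSSs, the singular values of grammians do not depend on the choice of state-space representation, in the following sense (both in continuous and in discrete time). Let $\Sigma_1$ be a minimal LSS and let $\sigma_1,\ldots,\sigma_n$ be the singular values of a pair $(\mathcal{P}_1,\mathcal{R}_1)$ consisting of a controllability grammian $\mathcal{P}_1$ and an observability grammian $\mathcal{R}_1$ of $\Sigma_1$. Then for any minimal LSS $\Sigma_2$ which is equivalent to $\Sigma_1$ there exists a pair $(\mathcal{P}_2,\mathcal{R}_2)$ of a controllability and an observability grammian of $\Sigma_2$ such that the singular values of $(\mathcal{P}_2,\mathcal{R}_2)$ are also $\sigma_1,\ldots,\sigma_n$.
   Context: Let $Q=\{1,\ldots,D\}$, $D\ge1$. A linear switched system (LSS) is a tuple $\Sigma=(n,Q,\{(A_q,B_q,C_q)\mid q\in Q\})$ with $A_q\in\mathbb{R}^{n\times n}$, $B_q\in\mathbb{R}^{n\times m}$, $C_q\in\mathbb{R}^{p\times n}$; $n=\dim\Sigma$. In continuous time, with $T=[0,\infty)$, inputs are $u\in\mathcal{U}=L_2(T,\mathbb{R}^m)$, switching signals are $q\in\mathcal{Q}=PC(T,Q)$ (piecewise continuous: finitely many discontinuities on each compact interval, with one-sided limits), states are absolutely continuous functions. In discrete time, $\mathcal{U}=l_2(\mathbb{N},\mathbb{R}^m)$ and $\mathcal{Q}$ is the set of infinite sequences in $Q$. The input-output map $Y^\Sigma$ sends $(u,q)\in\mathcal{U}\times\mathcal{Q}$ to $y$, where $\delta x(t)=A_{q(t)}x(t)+B_{q(t)}u(t)$ (a.e. in continuous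 time), $x(0)=0$, $y(t)=C_{q(t)}x(t)$, with $\delta x=\dot x$ in continuous time and $\delta x(t)=x(t+1)$ in discrete time. Two LSSs (with the same $Q,m,p$) are equivalent if they have the same input-output map. $\Sigma$ is minimal if $\dim\Sigma\le\dim\Sigma'$ for every LSS $\Sigma'$ equivalent to $\Sigma$. An observability grammian of $\Sigma$ is a positive definite $\mathcal{R}$ such that for all $q\in Q$: $A_q^T\mathcal{R}+\mathcal{R}A_q+C_q^TC_q\le0$ (continuous time), resp. $A_q^T\mathcal{R}A_q+C_q^TC_q-\mathcal{R}\le0$ (discrete time). A controllability grammian is a positive definite $\mathcal{P}$ such that for all $q\in Q$: $A_q\mathcal{P}+\mathcal{P}A_q^T+B_qB_q^T\le0$ (continuous time), resp. $A_q\mathcal{P}A_q^T+B_qB_q^T-\mathcal{P}\le0$ (discrete time). The singular values of $(\mathcal{P},\mathcal{R})$ are the eigenvalues of $\mathcal{P}\mathcal{R}$, counted with multiplicity. *)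

theory Defs
  imports
    "HOL-Analysis.Analysis"
    "Jordan_Normal_Form.Char_Poly"
    "HOL-Computational_Algebra.Fundamental_Theorem_Algebra"
begin

unbundle no vec_syntax and no inner_syntax

section \<open>Linear switched systems\<close>

text \<open>
  The state dimension has to vary inside the notion of minimality, hence matrices with
  explicit carriers. Dimension 0 is included: it is the minimal dimension of the zero
  input-output map. The modes are \<open>1, \<dots>, D\<close>, \<open>m\<close> is the number of inputs and \<open>p\<close> the
  number of outputs.
\<close>

record lss =
  sdim :: nat
  Amat :: "nat \<Rightarrow> real mat"
  Bmat :: "nat \<Rightarrow> real mat"
  Cmat :: "nat \<Rightarrow> real mat"

definition is_lss :: "nat \<Rightarrow> nat \<Rightarrow> nat \<Rightarrow> lss \<Rightarrow> bool" where
  "is_lss D m p S \<longleftrightarrow>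
     (\<forall>q\<in>{1..D}. Amat S q \<in> carrier_mat (sdim S) (sdim S)
                \<and> Bmat S q \<in> carrier_mat (sdim S) m
                \<and> Cmat S q \<in> carrier_mat p (sdim S))"


section \<open>Continuous time\<close>

text \<open>\<open>L\<^sub>2([0,\<infinity>), \<real>\<^sup>m)\<close>, by representatives; values at negative times are irrelevant.\<close>

definition ct_inputs :: "nat \<Rightarrow> (real \<Rightarrow> real vec) set" where
  "ct_inputs m = {u. (\<forall>t\<ge>0. u t \<in> carrier_vec m) \<and>
     (\<forall>i<m. (\<lambda>t. u t $ i) \<in> borel_measurable (lebesgue_on {0..})
           \<and> integrable (lebesgue_on {0..}) (\<lambda>t. (u t $ i)\<^sup>2))}"

text \<open>
  Piecewise continuous switching signals. The topology on \<^typ>\<open>nat\<close> is discrete, so the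
  one-sided limits are again modes.
\<close>

definition ct_switchings :: "nat \<Rightarrow> (real \<Rightarrow> nat) set" where
  "ct_switchings D = {q. (\<forall>t\<ge>0. q t \<in> {1..D}) \<and>
     (\<forall>b\<ge>0. finite {t\<in>{0..b}. \<not> continuous (at t within {0..}) q}) \<and>
     (\<forall>t\<ge>0. \<exists>l. (q \<longlongrightarrow> l) (at_right t)) \<and>
     (\<forall>t>0. \<exists>l. (q \<longlongrightarrow> l) (at_left t))}"

definition abs_continuous_on :: "real set \<Rightarrow> (real \<Rightarrow> real) \<Rightarrow> bool" where
  "abs_continuous_on S f \<longleftrightarrow>
     (\<forall>\<epsilon>>0. \<exists>\<delta>>0. \<forall>I. finite I \<longrightarrow> (\<forall>(a,b)\<in>I. a < b \<and> {a..b} \<subseteq> S) \<longrightarrow>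
        pairwise (\<lambda>(a,b) (c,d). disjnt {a<..<b} {c<..<d}) I \<longrightarrow>
        (\<Sum>(a,b)\<in>I. b - a) < \<delta> \<longrightarrow> (\<Sum>(a,b)\<in>I. \<bar>f b - f a\<bar>) < \<epsilon>)"

text \<open>
  On the unbounded time axis, absolute continuity of the state means absolute continuity on
  every compact interval: \<open>t \<mapsto> e\<^sup>t\<close> is an admissible state trajectory.
\<close>

definition ct_solution :: "lss \<Rightarrow> (real \<Rightarrow> real vec) \<Rightarrow> (real \<Rightarrow> nat) \<Rightarrow> (real \<Rightarrow> real vec) \<Rightarrow> bool" where
  "ct_solution S u q x \<longleftrightarrow>
     (\<forall>t\<ge>0. x t \<in> carrier_vec (sdim S)) \<and>
     (\<forall>i<sdim S. \<forall>b\<ge>0. abs_continuous_on {0..b} (\<lambda>t. x t $ i)) \<and>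
     x 0 = 0\<^sub>v (sdim S) \<and>
     (AE t in lebesgue_on {0..}. \<forall>i<sdim S.
        ((\<lambda>s. x s $ i) has_real_derivative
           (Amat S (q t) *\<^sub>v x t + Bmat S (q t) *\<^sub>v u t) $ i) (at t within {0..}))"

text \<open>
  For \<open>u\<close> in \<^const>\<open>ct_inputs\<close> and \<open>q\<close> in \<^const>\<open>ct_switchings\<close> the solution exists and is
  unique on \<open>[0,\<infinity>)\<close> (Caratheodory), so the choice below does not matter for \<open>t \<ge> 0\<close>.
\<close>

definition ct_io_map :: "lss \<Rightarrow> (real \<Rightarrow> real vec) \<Rightarrow> (real \<Rightarrow> nat) \<Rightarrow> real \<Rightarrow> real vec" where
  "ct_io_map S u q t = Cmat S (q t) *\<^sub>v (SOME x. ct_solution S u q x) t"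

definition ct_equivalent :: "nat \<Rightarrow> nat \<Rightarrow> lss \<Rightarrow> lss \<Rightarrow> bool" where
  "ct_equivalent D m S S' \<longleftrightarrow>
     (\<forall>u\<in>ct_inputs m. \<forall>q\<in>ct_switchings D. \<forall>t\<ge>0. ct_io_map S u q t = ct_io_map S' u q t)"

definition ct_minimal :: "nat \<Rightarrow> nat \<Rightarrow> nat \<Rightarrow> lss \<Rightarrow> bool" where
  "ct_minimal D m p S \<longleftrightarrow> is_lss D m p S \<and>
     (\<forall>S'. is_lss D m p S' \<and> ct_equivalent D m S' S \<longrightarrow> sdim S \<le> sdim S')"


section \<open>Discrete time\<close>

definition dt_inputs :: "nat \<Rightarrow> (nat \<Rightarrow> real vec) set" where
  "dt_inputs m = {u. (\<forall>t. u t \<in> carrier_vec m) \<and> (\<forall>i<m. summable (\<lambda>t. (u t $ i)\<^sup>2))}"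

definition dt_switchings :: "nat \<Rightarrow> (nat \<Rightarrow> nat) set" where
  "dt_switchings D = {q. \<forall>t. q t \<in> {1..D}}"

primrec dt_state :: "lss \<Rightarrow> (nat \<Rightarrow> real vec) \<Rightarrow> (nat \<Rightarrow> nat) \<Rightarrow> nat \<Rightarrow> real vec" where
  "dt_state S u q 0 = 0\<^sub>v (sdim S)"
| "dt_state S u q (Suc t) = Amat S (q t) *\<^sub>v dt_state S u q t + Bmat S (q t) *\<^sub>v u t"

definition dt_io_map :: "lss \<Rightarrow> (nat \<Rightarrow> real vec) \<Rightarrow> (nat \<Rightarrow> nat) \<Rightarrow> nat \<Rightarrow> real vec" where
  "dt_io_map S u q t = Cmat S (q t) *\<^sub>v dt_state S u q t"

definition dt_equivalent :: "nat \<Rightarrow> nat \<Rightarrow> lss \<Rightarrow> lss \<Rightarrow> bool" where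
  "dt_equivalent D m S S' \<longleftrightarrow>
     (\<forall>u\<in>dt_inputs m. \<forall>q\<in>dt_switchings D. \<forall>t. dt_io_map S u q t = dt_io_map S' u q t)"

definition dt_minimal :: "nat \<Rightarrow> nat \<Rightarrow> nat \<Rightarrow> lss \<Rightarrow> bool" where
  "dt_minimal D m p S \<longleftrightarrow> is_lss D m p S \<and>
     (\<forall>S'. is_lss D m p S' \<and> dt_equivalent D m S' S \<longrightarrow> sdim S \<le> sdim S')"


section \<open>Grammians and singular values\<close>

text \<open>
  Definiteness refers to symmetric matrices. The order on \<^typ>\<open>real mat\<close> is entrywise and
  therefore not the one of the matrix inequalities below.
\<close>

definition pos_definite :: "nat \<Rightarrow> real mat \<Rightarrow> bool" where
  "pos_definite n M \<longleftrightarrow> M \<in> carrier_mat n n \<and> M\<^sup>T = M \<and>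
     (\<forall>v\<in>carrier_vec n. v \<noteq> 0\<^sub>v n \<longrightarrow> v \<bullet> (M *\<^sub>v v) > 0)"

definition neg_semidefinite :: "nat \<Rightarrow> real mat \<Rightarrow> bool" where
  "neg_semidefinite n M \<longleftrightarrow> M \<in> carrier_mat n n \<and> M\<^sup>T = M \<and>
     (\<forall>v\<in>carrier_vec n. v \<bullet> (M *\<^sub>v v) \<le> 0)"

definition ct_obs_grammian :: "nat \<Rightarrow> lss \<Rightarrow> real mat \<Rightarrow> bool" where
  "ct_obs_grammian D S R \<longleftrightarrow> pos_definite (sdim S) R \<and>
     (\<forall>q\<in>{1..D}. neg_semidefinite (sdim S)
        ((Amat S q)\<^sup>T * R + R * Amat S q + (Cmat S q)\<^sup>T * Cmat S q))"

definition ct_ctrl_grammian :: "nat \<Rightarrow> lss \<Rightarrow> real mat \<Rightarrow> bool" where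
  "ct_ctrl_grammian D S P \<longleftrightarrow> pos_definite (sdim S) P \<and>
     (\<forall>q\<in>{1..D}. neg_semidefinite (sdim S)
        (Amat S q * P + P * (Amat S q)\<^sup>T + Bmat S q * (Bmat S q)\<^sup>T))"

definition dt_obs_grammian :: "nat \<Rightarrow> lss \<Rightarrow> real mat \<Rightarrow> bool" where
  "dt_obs_grammian D S R \<longleftrightarrow> pos_definite (sdim S) R \<and>
     (\<forall>q\<in>{1..D}. neg_semidefinite (sdim S)
        ((Amat S q)\<^sup>T * R * Amat S q + (Cmat S q)\<^sup>T * Cmat S q - R))"

definition dt_ctrl_grammian :: "nat \<Rightarrow> lss \<Rightarrow> real mat \<Rightarrow> bool" where
  "dt_ctrl_grammian D S P \<longleftrightarrow> pos_definite (sdim S) P \<and>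
     (\<forall>q\<in>{1..D}. neg_semidefinite (sdim S)
        (Amat S q * P * (Amat S q)\<^sup>T + Bmat S q * (Bmat S q)\<^sup>T - P))"

text \<open>
  The eigenvalues of \<open>P R\<close> as a multiset (algebraic multiplicities), taken over \<open>\<complex>\<close> so that
  there are always exactly \<open>n\<close> of them.
\<close>

definition singular_values :: "real mat \<Rightarrow> real mat \<Rightarrow> complex multiset" where
  "singular_values P R = proots (char_poly (map_mat complex_of_real (P * R)))"

end

theory Submission
  imports Defs "Jordan_Normal_Form.VS_Connect"
begin

text \<open>
  Both halves rest on the fact that two equivalent minimal systems are isomorphic: there is an
  invertible matrix \<open>K\<close> with \<open>K A\<^sub>1 = A\<^sub>2 K\<close>, \<open>K B\<^sub>1 = B\<^sub>2\<close> and \<open>C\<^sub>1 = C\<^sub>2 K\<close> for every mode. With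
  \<open>L = K\<^sup>-\<^sup>1\<close>, the congruences \<open>P\<^sub>2 = K P\<^sub>1 K\<^sup>T\<close> and \<open>R\<^sub>2 = L\<^sup>T R\<^sub>1 L\<close> turn the grammian inequalities of
  the first system into those of the second, and \<open>P\<^sub>2 R\<^sub>2 = K (P\<^sub>1 R\<^sub>1) L\<close> is similar to \<open>P\<^sub>1 R\<^sub>1\<close>
  (\<open>isomorphic_grammians\<close>).

  To construct \<open>K\<close>, consider the pairs of states that the two systems reach simultaneously, under
  the same input and switching signal, and the set \<open>N\<close> of pairs \<open>(l, l')\<close> of functionals that agree
  on all of them, \<open>l \<bullet> x = l' \<bullet> x'\<close>. Continuing an experiment by one more mode and a constant input
  shows that \<open>N\<close> is a linear relation between the two dual spaces which is compatible with the
  transposed system matrices: a \<open>dual_bisimulation\<close>. In discrete time one further step gives this;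
  in continuous time it is the right derivative of \<open>l \<bullet> x(t) - l' \<bullet> x'(t) = 0\<close> at the moment of
  switching. Working with annihilators rather than with the reached states themselves makes
  \<open>N\<close> a closed linear subspace for free, so that neither Markov parameters nor matrix exponentials
  have to be extracted from the input-output map.

  Minimality makes \<open>N\<close> the graph of an isomorphism (\<open>irreducible_isomorphic\<close>). The functionals
  related to \<open>0\<close> form a subspace that is invariant under all \<open>A\<^sup>T\<close> and killed by all \<open>B\<^sup>T\<close>; were it
  nonzero, the system could be restricted to the annihilator of that subspace. The domain of \<open>N\<close> is
  invariant under all \<open>A\<^sup>T\<close> and contains the ranges of all \<open>C\<^sup>T\<close>; were it proper, an unobservable part
  could be divided out. Either reduction is a smaller system connected to the old one by an
  intertwining matrix, and intertwined systems have the same input-output map.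

  The last claim is immediate in discrete time. In continuous time the input-output map is given by
  a choice among solutions, so it needs existence and uniqueness of Caratheodory solutions:
  existence by Picard iteration together with the one-dimensional Lebesgue differentiation theorem
  (\<open>indefinite_integral_has_real_derivative_ae\<close>), uniqueness by a mean value inequality for
  absolutely continuous functions (\<open>abs_continuous_on_growth_bound\<close>) and a Gronwall argument.
\<close>

section \<open>Absolutely continuous functions\<close>

abbreviation nonoverlapping :: "(real \<times> real) set \<Rightarrow> bool" where
  "nonoverlapping \<equiv> pairwise (\<lambda>(a,b) (c,d). disjnt {a<..<b} {c<..<d})"

lemma abs_continuous_onE:
  assumes "abs_continuous_on S f" "e > 0"
  obtains d where "d > 0"
    "\<And>I. finite I \<Longrightarrow> (\<And>u v. (u,v) \<in> I \<Longrightarrow> u < v \<and> {u..v} \<subseteq> S) \<Longrightarrow> nonoverlapping I \<Longrightarrow>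
       (\<Sum>(u,v)\<in>I. v - u) < d \<Longrightarrow> (\<Sum>(u,v)\<in>I. \<bar>f v - f u\<bar>) < e"
proof -
  obtain d where d: "d > 0" "\<forall>I. finite I \<longrightarrow> (\<forall>(u,v)\<in>I. u < v \<and> {u..v} \<subseteq> S) \<longrightarrow> nonoverlapping I \<longrightarrow>
       (\<Sum>(u,v)\<in>I. v - u) < d \<longrightarrow> (\<Sum>(u,v)\<in>I. \<bar>f v - f u\<bar>) < e"
    using spec[OF assms(1)[unfolded abs_continuous_on_def], of e] assms(2) by blast
  show thesis
  proof (rule that[OF d(1)])
    fix I assume "finite I" "\<And>u v. (u,v) \<in> I \<Longrightarrow> u < v \<and> {u..v} \<subseteq> S" "nonoverlapping I"
      "(\<Sum>(u,v)\<in>I. v - u) < d"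
    then show "(\<Sum>(u,v)\<in>I. \<bar>f v - f u\<bar>) < e" using spec[OF d(2), of I] by auto
  qed
qed

lemma abs_continuous_onI:
  assumes "\<And>e. e > 0 \<Longrightarrow> \<exists>d>0. \<forall>I. finite I \<longrightarrow> (\<forall>(u,v)\<in>I. u < v \<and> {u..v} \<subseteq> S) \<longrightarrow> nonoverlapping I \<longrightarrow>
       (\<Sum>(u,v)\<in>I. v - u) < d \<longrightarrow> (\<Sum>(u,v)\<in>I. \<bar>f v - f u\<bar>) < e"
  shows "abs_continuous_on S f"
  using assms unfolding abs_continuous_on_def by (intro allI impI)

lemma abs_continuous_on_subset:
  assumes "abs_continuous_on S f" "T \<subseteq> S"
  shows "abs_continuous_on T f"
proof (rule abs_continuous_onI)
  fix e :: real assume e: "e > 0"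
  from abs_continuous_onE[OF assms(1) e] obtain d where d: "d > 0"
    "\<And>I. finite I \<Longrightarrow> (\<And>u v. (u,v) \<in> I \<Longrightarrow> u < v \<and> {u..v} \<subseteq> S) \<Longrightarrow> nonoverlapping I \<Longrightarrow>
       (\<Sum>(u,v)\<in>I. v - u) < d \<Longrightarrow> (\<Sum>(u,v)\<in>I. \<bar>f v - f u\<bar>) < e" by blast
  show "\<exists>d>0. \<forall>I. finite I \<longrightarrow> (\<forall>(u,v)\<in>I. u < v \<and> {u..v} \<subseteq> T) \<longrightarrow> nonoverlapping I \<longrightarrow>
       (\<Sum>(u,v)\<in>I. v - u) < d \<longrightarrow> (\<Sum>(u,v)\<in>I. \<bar>f v - f u\<bar>) < e"
  proof (intro exI[of _ d] conjI allI impI d)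
    fix I u v assume "\<forall>(u,v)\<in>I. u < v \<and> {u..v} \<subseteq> T" "(u,v) \<in> I"
    then have "u < v" "{u..v} \<subseteq> T" by fast+
    then show "u < v" "{u..v} \<subseteq> S" using assms(2) by blast+
  qed
qed

lemma abs_continuous_on_cong:
  assumes "\<And>t. t \<in> S \<Longrightarrow> f t = g t"
  shows "abs_continuous_on S f \<longleftrightarrow> abs_continuous_on S g"
proof -
  have *: "abs_continuous_on S g" if ac: "abs_continuous_on S f" and fg: "\<And>t. t \<in> S \<Longrightarrow> f t = g t" for f g
  proof (rule abs_continuous_onI)
    fix e :: real assume e: "e > 0"
    from abs_continuous_onE[OF ac e] obtain d where d: "d > 0"
      "\<And>I. finite I \<Longrightarrow> (\<And>u v. (u,v) \<in> I \<Longrightarrow> u < v \<and> {u..v} \<subseteq> S) \<Longrightarrow> nonoverlapping I \<Longrightarrow>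
        (\<Sum>(u,v)\<in>I. v - u) < d \<Longrightarrow> (\<Sum>(u,v)\<in>I. \<bar>f v - f u\<bar>) < e" by blast
    show "\<exists>d>0. \<forall>I. finite I \<longrightarrow> (\<forall>(u,v)\<in>I. u < v \<and> {u..v} \<subseteq> S) \<longrightarrow> nonoverlapping I \<longrightarrow>
       (\<Sum>(u,v)\<in>I. v - u) < d \<longrightarrow> (\<Sum>(u,v)\<in>I. \<bar>g v - g u\<bar>) < e"
    proof (intro exI[of _ d] conjI allI impI d(1))
      fix I assume I: "finite I" "\<forall>(u,v)\<in>I. u < v \<and> {u..v} \<subseteq> S" "nonoverlapping I" "(\<Sum>(u,v)\<in>I. v - u) < d"
      have uv: "u < v \<and> {u..v} \<subseteq> S" if "(u,v) \<in> I" for u v using I(2) that by blast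
      have "(\<Sum>(u,v)\<in>I. \<bar>g v - g u\<bar>) = (\<Sum>(u,v)\<in>I. \<bar>f v - f u\<bar>)"
      proof (rule sum.cong, simp, clarify)
        fix u v assume "(u,v) \<in> I"
        then have "u \<in> S" "v \<in> S" using uv[of u v] by auto
        then show "\<bar>g v - g u\<bar> = \<bar>f v - f u\<bar>" using fg by simp
      qed
      then show "(\<Sum>(u,v)\<in>I. \<bar>g v - g u\<bar>) < e" using d(2)[OF I(1) uv I(3,4)] by simp
    qed
  qed
  show ?thesis using *[of f g] *[of g f] assms by auto
qed

lemma abs_continuous_on_imp_continuous_on:
  assumes "abs_continuous_on {a..b} f"
  shows "continuous_on {a..b} f"
  unfolding continuous_on_iff dist_real_def
proof (intro ballI allI impI)
  fix x e :: real assume x: "x \<in> {a..b}" and e: "0 < e"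
  from abs_continuous_onE[OF assms e] obtain d where d: "d > 0"
    and dI: "\<And>I. finite I \<Longrightarrow> (\<And>u v. (u,v) \<in> I \<Longrightarrow> u < v \<and> {u..v} \<subseteq> {a..b}) \<Longrightarrow> nonoverlapping I \<Longrightarrow>
        (\<Sum>(u,v)\<in>I. v - u) < d \<Longrightarrow> (\<Sum>(u,v)\<in>I. \<bar>f v - f u\<bar>) < e" by blast
  have main: "\<bar>f v - f u\<bar> < e" if "u \<in> {a..b}" "v \<in> {a..b}" "u < v" "v - u < d" for u v
    using dI[of "{(u,v)}"] that by (auto simp: subset_iff)
  show "\<exists>d>0. \<forall>x'\<in>{a..b}. \<bar>x' - x\<bar> < d \<longrightarrow> \<bar>f x' - f x\<bar> < e"
  proof (intro exI[of _ d] conjI ballI impI d)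
    fix y assume "y \<in> {a..b}" "\<bar>y - x\<bar> < d"
    then show "\<bar>f y - f x\<bar> < e"
      using main[of x y] main[of y x] x e by (cases x y rule: linorder_cases) auto
  qed
qed

lemma abs_continuous_on_add:
  assumes "abs_continuous_on S f" "abs_continuous_on S g"
  shows "abs_continuous_on S (\<lambda>t. f t + g t)"
  unfolding abs_continuous_on_def
proof (intro allI impI)
  fix e :: real assume "e > 0"
  then have e: "e/2 > 0" by simp
  obtain d1 where d1: "d1 > 0" "\<And>I. finite I \<Longrightarrow> (\<forall>(u,v)\<in>I. u < v \<and> {u..v} \<subseteq> S) \<Longrightarrow>
        nonoverlapping I \<Longrightarrow>
        (\<Sum>(u,v)\<in>I. v - u) < d1 \<Longrightarrow> (\<Sum>(u,v)\<in>I. \<bar>f v - f u\<bar>) < e/2"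
    using assms(1) e unfolding abs_continuous_on_def by meson
  obtain d2 where d2: "d2 > 0" "\<And>I. finite I \<Longrightarrow> (\<forall>(u,v)\<in>I. u < v \<and> {u..v} \<subseteq> S) \<Longrightarrow>
        nonoverlapping I \<Longrightarrow>
        (\<Sum>(u,v)\<in>I. v - u) < d2 \<Longrightarrow> (\<Sum>(u,v)\<in>I. \<bar>g v - g u\<bar>) < e/2"
    using assms(2) e unfolding abs_continuous_on_def by meson
  show "\<exists>\<delta>>0. \<forall>I. finite I \<longrightarrow> (\<forall>(a, b)\<in>I. a < b \<and> {a..b} \<subseteq> S) \<longrightarrow>
      nonoverlapping I \<longrightarrow>
      (\<Sum>(a, b)\<in>I. b - a) < \<delta> \<longrightarrow> (\<Sum>(a, b)\<in>I. \<bar>f b + g b - (f a + g a)\<bar>) < e"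
  proof (intro exI[of _ "min d1 d2"] conjI allI impI)
    fix I :: "(real \<times> real) set"
    assume I: "finite I" "\<forall>(a, b)\<in>I. a < b \<and> {a..b} \<subseteq> S"
      "nonoverlapping I" "(\<Sum>(a, b)\<in>I. b - a) < min d1 d2"
    have "(\<Sum>(a, b)\<in>I. \<bar>f b + g b - (f a + g a)\<bar>)
        \<le> (\<Sum>(a, b)\<in>I. \<bar>f b - f a\<bar>) + (\<Sum>(a, b)\<in>I. \<bar>g b - g a\<bar>)"
      unfolding sum.distrib[symmetric] by (rule sum_mono) auto
    also have "\<dots> < e" using d1(2)[OF I(1-3)] d2(2)[OF I(1-3)] I(4) by auto
    finally show "(\<Sum>(a, b)\<in>I. \<bar>f b + g b - (f a + g a)\<bar>) < e" .
  qed (use d1 d2 in auto)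
qed

lemma lipschitz_imp_abs_continuous_on:
  assumes L: "\<And>u v. u \<in> S \<Longrightarrow> v \<in> S \<Longrightarrow> u < v \<Longrightarrow> \<bar>f v - f u\<bar> \<le> L * (v - u)"
  shows "abs_continuous_on S f"
  unfolding abs_continuous_on_def
proof (intro allI impI)
  fix e :: real assume e: "e > 0"
  show "\<exists>\<delta>>0. \<forall>I. finite I \<longrightarrow> (\<forall>(a, b)\<in>I. a < b \<and> {a..b} \<subseteq> S) \<longrightarrow>
      nonoverlapping I \<longrightarrow>
      (\<Sum>(a, b)\<in>I. b - a) < \<delta> \<longrightarrow> (\<Sum>(a, b)\<in>I. \<bar>f b - f a\<bar>) < e"
  proof (intro exI[of _ "e / (\<bar>L\<bar> + 1)"] conjI allI impI)
    fix I :: "(real \<times> real) set"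
    assume I: "finite I" "\<forall>(a, b)\<in>I. a < b \<and> {a..b} \<subseteq> S"
      "(\<Sum>(a, b)\<in>I. b - a) < e / (\<bar>L\<bar> + 1)"
    have "(\<Sum>(a, b)\<in>I. \<bar>f b - f a\<bar>) \<le> (\<Sum>(a, b)\<in>I. (\<bar>L\<bar> + 1) * (b - a))"
    proof (rule sum_mono, clarify)
      fix a b assume "(a,b) \<in> I"
      then have "a < b" "a \<in> S" "b \<in> S" using I(2) by (auto simp: subset_iff)
      then have "\<bar>f b - f a\<bar> \<le> L * (b - a)" using L by blast
      also have "\<dots> \<le> (\<bar>L\<bar> + 1) * (b - a)" using \<open>a < b\<close> by (intro mult_right_mono) auto
      finally show "\<bar>f b - f a\<bar> \<le> (\<bar>L\<bar> + 1) * (b - a)" .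
    qed
    also have "\<dots> = (\<bar>L\<bar> + 1) * (\<Sum>(a, b)\<in>I. b - a)" by (simp add: sum_distrib_left case_prod_unfold)
    also have "\<dots> < e" using I(3) by (simp add: field_simps)
    finally show "(\<Sum>(a, b)\<in>I. \<bar>f b - f a\<bar>) < e" .
  qed (use e in auto)
qed

lemma abs_continuous_on_cmult:
  assumes "abs_continuous_on S f"
  shows "abs_continuous_on S (\<lambda>t. c * f t)"
  unfolding abs_continuous_on_def
proof (intro allI impI)
  fix e :: real assume "e > 0"
  then have e: "e / (\<bar>c\<bar> + 1) > 0" by simp
  obtain d where d: "d > 0" "\<And>I. finite I \<Longrightarrow> (\<forall>(u,v)\<in>I. u < v \<and> {u..v} \<subseteq> S) \<Longrightarrow>
        nonoverlapping I \<Longrightarrow>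
        (\<Sum>(u,v)\<in>I. v - u) < d \<Longrightarrow> (\<Sum>(u,v)\<in>I. \<bar>f v - f u\<bar>) < e / (\<bar>c\<bar> + 1)"
    using assms e unfolding abs_continuous_on_def by meson
  show "\<exists>\<delta>>0. \<forall>I. finite I \<longrightarrow> (\<forall>(a, b)\<in>I. a < b \<and> {a..b} \<subseteq> S) \<longrightarrow>
      nonoverlapping I \<longrightarrow>
      (\<Sum>(a, b)\<in>I. b - a) < \<delta> \<longrightarrow> (\<Sum>(a, b)\<in>I. \<bar>c * f b - c * f a\<bar>) < e"
  proof (intro exI[of _ d] conjI allI impI)
    fix I :: "(real \<times> real) set"
    assume I: "finite I" "\<forall>(a, b)\<in>I. a < b \<and> {a..b} \<subseteq> S"
      "nonoverlapping I" "(\<Sum>(a, b)\<in>I. b - a) < d"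
    have "(\<Sum>(a, b)\<in>I. \<bar>c * f b - c * f a\<bar>) = \<bar>c\<bar> * (\<Sum>(a, b)\<in>I. \<bar>f b - f a\<bar>)"
      by (auto simp: sum_distrib_left case_prod_unfold abs_mult right_diff_distrib[symmetric] intro!: sum.cong)
    also have "\<dots> \<le> (\<bar>c\<bar> + 1) * (\<Sum>(a, b)\<in>I. \<bar>f b - f a\<bar>)"
      by (intro mult_right_mono sum_nonneg) auto
    also have "\<dots> < e" using d(2)[OF I] by (simp add: field_simps)
    finally show "(\<Sum>(a, b)\<in>I. \<bar>c * f b - c * f a\<bar>) < e" .
  qed (use d in auto)
qed

lemma abs_continuous_on_sum:
  assumes "finite J" "\<And>j. j \<in> J \<Longrightarrow> abs_continuous_on S (f j)"
  shows "abs_continuous_on S (\<lambda>t. \<Sum>j\<in>J. f j t)"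
  using assms
proof (induction J rule: finite_induct)
  case empty
  show ?case by (rule lipschitz_imp_abs_continuous_on[where L=0]) auto
qed (auto intro: abs_continuous_on_add)

text \<open>
  The mean value inequality survives a null set of exceptional points because absolute continuity
  makes the total increment over short intervals small. By Cousin's lemma there is a tagged division
  whose intervals either are tagged outside \<open>N\<close>, where the derivative controls the increment, or are
  tagged in \<open>N\<close> and lie in an open superset of \<open>N\<close> of tiny measure.
\<close>

lemma abs_continuous_on_growth_bound:
  fixes f :: "real \<Rightarrow> real"
  assumes ab: "a \<le> b" and ac: "abs_continuous_on {a..b} f" and N: "negligible N" and L: "L \<ge> 0"
    and der: "\<And>t. t \<in> {a..b} - N \<Longrightarrow> \<exists>d. (f has_real_derivative d) (at t within {a..b}) \<and> \<bar>d\<bar> \<le> L"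
  shows "\<bar>f b - f a\<bar> \<le> L * (b - a)"
proof (rule field_le_epsilon)
  fix e' :: real assume e': "e' > 0"
  define e where "e = e' / (b - a + 1)"
  have e: "e > 0" unfolding e_def using e' ab by simp
  obtain \<delta> where \<delta>: "\<delta> > 0" "\<And>I. finite I \<Longrightarrow> (\<forall>(u,v)\<in>I. u < v \<and> {u..v} \<subseteq> {a..b}) \<Longrightarrow>
        nonoverlapping I \<Longrightarrow>
        (\<Sum>(u,v)\<in>I. v - u) < \<delta> \<Longrightarrow> (\<Sum>(u,v)\<in>I. \<bar>f v - f u\<bar>) < e"
    using ac e unfolding abs_continuous_on_def by meson
  obtain U where U: "open U" "N \<subseteq> U" "U - N \<in> lmeasurable" "emeasure lebesgue (U - N) < ennreal \<delta>"
    using sets_lebesgue_outer_open[of N \<delta>] N \<delta>(1) negligible_imp_sets by metis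
  have Um: "U \<in> lmeasurable" 
  proof -
    have "U = (U - N) \<union> N" using U by auto
    then show ?thesis using U(3) N by (metis fmeasurable.Un negligible_imp_measurable)
  qed
  have Ud: "measure lebesgue U < \<delta>"
  proof -
    have "measure lebesgue U = measure lebesgue (U - N)"
      using measure_Diff_null_set[of U lebesgue N] N Um negligible_iff_null_sets by (metis fmeasurableD)
    also have "\<dots> < \<delta>" using U(3,4) \<delta>(1) by (simp add: emeasure_eq_measure2 ennreal_less_iff)
    finally show ?thesis .
  qed
  have "\<exists>r>0. \<forall>y\<in>{a..b}. \<bar>y - t\<bar> < r \<longrightarrow> \<bar>f y - f t\<bar> \<le> (L + e) * \<bar>y - t\<bar>" if t: "t \<in> {a..b} - N" for t
  proof -
    obtain d where d: "(f has_real_derivative d) (at t within {a..b})" "\<bar>d\<bar> \<le> L" using der[OF t] by blast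
    then obtain r where r: "r > 0" "\<And>y. y \<in> {a..b} \<Longrightarrow> \<bar>y - t\<bar> < r \<Longrightarrow> \<bar>f y - f t - d * (y - t)\<bar> \<le> e * \<bar>y - t\<bar>"
      using e unfolding has_field_derivative_def has_derivative_within_alt real_norm_def by meson
    have "\<bar>f y - f t\<bar> \<le> (L + e) * \<bar>y - t\<bar>" if y: "y \<in> {a..b}" "\<bar>y - t\<bar> < r" for y
    proof -
      have "\<bar>f y - f t\<bar> \<le> \<bar>d * (y - t)\<bar> + e * \<bar>y - t\<bar>" using r(2)[OF y] by linarith
      also have "\<bar>d * (y - t)\<bar> \<le> L * \<bar>y - t\<bar>" using d(2) by (simp add: abs_mult mult_right_mono)
      finally show ?thesis by (simp add: algebra_simps)
    qed
    with r(1) show ?thesis by blast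
  qed
  then obtain r where r: "\<And>t. t \<in> {a..b} - N \<Longrightarrow> r t > 0"
    "\<And>t y. t \<in> {a..b} - N \<Longrightarrow> y \<in> {a..b} \<Longrightarrow> \<bar>y - t\<bar> < r t \<Longrightarrow> \<bar>f y - f t\<bar> \<le> (L + e) * \<bar>y - t\<bar>"
    by metis
  \<comment> \<open>The gauge confines intervals tagged in \<open>N\<close> to \<open>U\<close>; its value outside \<open>[a, b]\<close> is arbitrary.\<close>
  define \<gamma> where "\<gamma> = (\<lambda>t. if t \<in> N then U else if t \<in> {a..b} then ball t (r t) else ball t 1)"
  have "gauge \<gamma>" unfolding gauge_def \<gamma>_def using U r(1) by auto
  then obtain p where p: "p tagged_division_of {a..b}" "\<gamma> fine p"
    using fine_division_exists_real by blast
  have pd: "\<And>x K. (x,K) \<in> p \<Longrightarrow> x \<in> K \<and> K \<subseteq> {a..b} \<and> K \<subseteq> \<gamma> x \<and> (\<exists>u v. u \<le> v \<and> K = {u..v})"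
  proof -
    fix x K assume xK: "(x,K) \<in> p"
    obtain u v where uv: "K = cbox u v" using tagged_division_ofD(4)[OF p(1) xK] by blast
    moreover have "x \<in> K" "K \<subseteq> {a..b}" using tagged_division_ofD(2,3)[OF p(1) xK] by auto
    ultimately show "x \<in> K \<and> K \<subseteq> {a..b} \<and> K \<subseteq> \<gamma> x \<and> (\<exists>u v. u \<le> v \<and> K = {u..v})"
      using fineD[OF p(2) xK] by auto
  qed
  have fin: "finite p" using tagged_division_of_finite[OF p(1)] .
  let ?h = "\<lambda>K. \<bar>f (Sup K) - f (Inf K)\<bar>"
  have "\<bar>f b - f a\<bar> = \<bar>\<Sum>(x,K)\<in>p. f (Sup K) - f (Inf K)\<bar>"
    using additive_tagged_division_1[OF ab p(1), of f] by simp
  also have "\<dots> \<le> (\<Sum>(x,K)\<in>p. ?h K)" unfolding case_prod_unfold by (rule sum_abs)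
  also have "\<dots> = (\<Sum>(x,K)\<in>{xK\<in>p. fst xK \<in> N}. ?h K) + (\<Sum>(x,K)\<in>{xK\<in>p. fst xK \<notin> N}. ?h K)"
  proof -
    have "p = {xK\<in>p. fst xK \<in> N} \<union> {xK\<in>p. fst xK \<notin> N}" by auto
    then show ?thesis
      using sum.union_disjoint[of "{xK\<in>p. fst xK \<in> N}" "{xK\<in>p. fst xK \<notin> N}" "\<lambda>(x,K). ?h K"] fin
      by (simp add: disjoint_iff)
  qed
  also have "(\<Sum>(x,K)\<in>{xK\<in>p. fst xK \<notin> N}. ?h K) \<le> (L + e) * (b - a)"
  proof -
    have "(\<Sum>(x,K)\<in>{xK\<in>p. fst xK \<notin> N}. ?h K) \<le> (\<Sum>(x,K)\<in>{xK\<in>p. fst xK \<notin> N}. (L + e) * measure lborel K)"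
    proof (rule sum_mono, clarify, unfold fst_conv)
      fix x K assume xK: "(x,K) \<in> p" "x \<notin> N"
      from pd[OF xK(1)] obtain u v where uv: "u \<le> v" "K = {u..v}" "x \<in> K" "K \<subseteq> {a..b}" "K \<subseteq> \<gamma> x" by blast
      have x: "x \<in> {a..b} - N" using uv xK by auto
      have "\<gamma> x = ball x (r x)" using x unfolding \<gamma>_def by auto
      then have "{u..v} \<subseteq> ball x (r x)" using uv by simp
      then have "u \<in> ball x (r x)" "v \<in> ball x (r x)" using uv(1) by (auto simp del: mem_ball)
      then have "\<bar>f u - f x\<bar> \<le> (L + e) * \<bar>u - x\<bar>" "\<bar>f v - f x\<bar> \<le> (L + e) * \<bar>v - x\<bar>"
        using r(2)[OF x, of u] r(2)[OF x, of v] uv by (auto simp: dist_real_def abs_minus_commute)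
      then have "\<bar>f v - f u\<bar> \<le> (L + e) * \<bar>u - x\<bar> + (L + e) * \<bar>v - x\<bar>" by linarith
      also have "\<dots> = (L + e) * (v - u)" 
      proof -
        have "\<bar>u - x\<bar> = x - u" "\<bar>v - x\<bar> = v - x" using uv by auto
        then show ?thesis by (simp add: algebra_simps)
      qed
      finally show "?h K \<le> (L + e) * measure lborel K" using uv by simp
    qed
    also have "\<dots> \<le> (\<Sum>(x,K)\<in>p. (L + e) * measure lborel K)"
      using fin L e by (intro sum_mono2) auto
    also have "\<dots> = (L + e) * (b - a)"
      using additive_content_tagged_division[of p a b] p(1) ab
      by (simp add: sum_distrib_left[symmetric] case_prod_unfold)
    finally show ?thesis .
  qed
  also have "(\<Sum>(x,K)\<in>{xK\<in>p. fst xK \<in> N}. ?h K) \<le> e"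
  proof -
    define p1 where "p1 = {xK\<in>p. fst xK \<in> N}"
    have p1: "p1 tagged_partial_division_of {a..b}"
      using p(1) unfolding p1_def tagged_division_of_def
      by (auto intro: tagged_partial_division_subset)
    have fin1: "finite p1" using fin unfolding p1_def by simp
    let ?Q = "snd ` p1"
    have Qdiv: "?Q division_of \<Union>?Q" using partial_division_of_tagged_division[OF p1] .
    have Qsub: "K \<subseteq> {a..b} \<and> K \<subseteq> U \<and> (\<exists>u v. u \<le> v \<and> K = {u..v})" if K: "K \<in> ?Q" for K
    proof -
      obtain x where x: "(x,K) \<in> p" "x \<in> N" using K unfolding p1_def by auto
      then show ?thesis using pd[OF x(1)] unfolding \<gamma>_def by simp
    qed
    have Qint: "K = {Inf K..Sup K}" "Inf K \<le> Sup K" "measure lebesgue K = Sup K - Inf K" if K: "K \<in> ?Q" for K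
    proof -
      obtain u v where "u \<le> v" "K = {u..v}" using Qsub[OF K] by blast
      then show "K = {Inf K..Sup K}" "Inf K \<le> Sup K" "measure lebesgue K = Sup K - Inf K" by auto
    qed
    \<comment> \<open>Absolute continuity speaks about nondegenerate intervals, given by their end points.\<close>
    let ?Q' = "{K\<in>?Q. Inf K < Sup K}"
    let ?I = "(\<lambda>K. (Inf K, Sup K)) ` ?Q'"
    have inj: "inj_on (\<lambda>K. (Inf K, Sup K)) ?Q'"
    proof (rule inj_onI)
      fix K K' assume "K \<in> ?Q'" "K' \<in> ?Q'" "(Inf K, Sup K) = (Inf K', Sup K')"
      then show "K = K'" using Qint(1)[of K] Qint(1)[of K'] by simp
    qed
    have "(\<Sum>(x,K)\<in>p1. ?h K) = (\<Sum>K\<in>?Q. ?h K)"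
    proof -
      let ?d = "\<lambda>K. if K = {} then 0 else ?h K"
      have "p1 tagged_division_of \<Union>?Q" using p1 tagged_partial_division_of_Union_self by blast
      from sum.over_tagged_division_lemma[OF this, of ?d]
      have "(\<Sum>(x,K)\<in>p1. ?d K) = (\<Sum>K\<in>?Q. ?d K)" by fastforce
      moreover have ne: "K \<noteq> {}" if "(x,K) \<in> p1" for x K
        using pd[of x K] that unfolding p1_def by auto
      then have "(\<Sum>(x,K)\<in>p1. ?d K) = (\<Sum>(x,K)\<in>p1. ?h K)"
        by (intro sum.cong) (auto split: prod.split)
      moreover have "(\<Sum>K\<in>?Q. ?d K) = (\<Sum>K\<in>?Q. ?h K)"
      proof (rule sum.cong)
        fix K assume "K \<in> ?Q"
        then have "K \<noteq> {}" using ne by auto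
        then show "?d K = ?h K" by simp
      qed simp
      ultimately show ?thesis by simp
    qed
    also have "\<dots> = (\<Sum>K\<in>?Q'. ?h K)"
    proof (rule sum.mono_neutral_right)
      show "\<forall>K\<in>?Q - ?Q'. ?h K = 0"
      proof
        fix K assume K: "K \<in> ?Q - ?Q'"
        then have "Inf K = Sup K" using Qint(2)[of K] by auto
        then show "?h K = 0" by simp
      qed
    qed (use fin1 in auto)
    also have "\<dots> = (\<Sum>(u,v)\<in>?I. \<bar>f v - f u\<bar>)"
      by (subst sum.reindex[OF inj]) auto
    also have "\<dots> < e"
    proof (rule \<delta>(2))
      show "finite ?I" using fin1 by auto
      have "{Inf K..Sup K} \<subseteq> {a..b}" if "K \<in> ?Q" for K
        using Qint(1)[OF that] Qsub[OF that] by metis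
      then show "\<forall>(u,v)\<in>?I. u < v \<and> {u..v} \<subseteq> {a..b}" by fast
      have "disjnt {Inf K<..<Sup K} {Inf K'<..<Sup K'}" if Q: "K \<in> ?Q" "K' \<in> ?Q" "K \<noteq> K'" for K K'
      proof -
        have "interior {Inf K..Sup K} \<inter> interior {Inf K'..Sup K'} = {}"
          using division_ofD(5)[OF Qdiv Q] Qint(1)[OF Q(1)] Qint(1)[OF Q(2)] by simp
        then show ?thesis by (simp add: disjnt_def)
      qed
      then show "nonoverlapping ?I" unfolding pairwise_image by (auto simp: pairwise_def)
      have "(\<Sum>(u,v)\<in>?I. v - u) = (\<Sum>K\<in>?Q'. Sup K - Inf K)"
        by (subst sum.reindex[OF inj]) auto
      also have "\<dots> = (\<Sum>K\<in>?Q'. measure lebesgue K)"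
        by (rule sum.cong) (use Qint(3) in auto)
      also have "\<dots> \<le> (\<Sum>K\<in>?Q. measure lebesgue K)"
        by (rule sum_mono2) (use fin1 in auto)
      also have "\<dots> = measure lebesgue (\<Union>?Q)" by (rule content_division[OF Qdiv])
      also have "\<dots> \<le> measure lebesgue U"
        by (rule measure_mono_fmeasurable) (use Qsub Um lmeasurable_division[OF Qdiv] in \<open>auto dest: fmeasurableD\<close>)
      also have "\<dots> < \<delta>" by (rule Ud)
      finally show "(\<Sum>(u,v)\<in>?I. v - u) < \<delta>" .
    qed
    finally show ?thesis unfolding p1_def by simp
  qed
  finally have "\<bar>f b - f a\<bar> \<le> L * (b - a) + e * (b - a + 1)" by (simp add: algebra_simps)
  also have "e * (b - a + 1) = e'" unfolding e_def using ab by simp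
  finally show "\<bar>f b - f a\<bar> \<le> L * (b - a) + e'" by simp
qed

text \<open>
  At the left end point an almost everywhere derivative with a continuous representative is a genuine
  one-sided derivative: apply the growth bound to \<open>f t - \<phi> a * t\<close> near \<open>a\<close>, where its derivative is small.
\<close>

lemma abs_continuous_on_right_derivative:
  fixes f \<phi> :: "real \<Rightarrow> real"
  assumes ab: "a < b" and ac: "abs_continuous_on {a..b} f" and N: "negligible N"
    and der: "\<And>t. t \<in> {a..<b} - N \<Longrightarrow> (f has_real_derivative \<phi> t) (at t within {a..b})"
    and cont: "continuous_on {a..<b} \<phi>"
  shows "(f has_real_derivative \<phi> a) (at a within {a..b})"
  unfolding has_field_derivative_def has_derivative_within_alt
proof (intro conjI allI impI bounded_linear_mult_right)
  fix e :: real assume e: "e > 0"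
  obtain d where d: "d > 0" "\<And>t. t \<in> {a..<b} \<Longrightarrow> dist t a < d \<Longrightarrow> dist (\<phi> t) (\<phi> a) < e"
    using cont ab e unfolding continuous_on_iff by (metis atLeastLessThan_iff order_refl)
  show "\<exists>d>0. \<forall>y\<in>{a..b}. norm (y - a) < d \<longrightarrow> norm (f y - f a - \<phi> a * (y - a)) \<le> e * norm (y - a)"
  proof (intro exI[of _ "min d (b - a)"] conjI ballI impI)
    fix y assume y: "y \<in> {a..b}" "norm (y - a) < min d (b - a)"
    let ?g = "\<lambda>t. f t + (- \<phi> a) * t"
    have "\<bar>?g y - ?g a\<bar> \<le> e * (y - a)"
    proof (rule abs_continuous_on_growth_bound[OF _ _ N])
      show "abs_continuous_on {a..y} ?g"
        by (intro abs_continuous_on_add abs_continuous_on_subset[OF ac] lipschitz_imp_abs_continuous_on[where L="\<bar>\<phi> a\<bar>"])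
          (use y in \<open>auto simp: abs_mult right_diff_distrib[symmetric]\<close>)
      fix t assume t: "t \<in> {a..y} - N"
      then have t': "t \<in> {a..<b} - N" using y by auto
      have "(f has_real_derivative \<phi> t) (at t within {a..y})"
        by (rule has_field_derivative_subset[OF der[OF t']]) (use y in auto)
      then have "(?g has_real_derivative \<phi> t + (- \<phi> a) * 1) (at t within {a..y})"
        by (intro DERIV_add DERIV_cmult DERIV_ident)
      moreover have "\<bar>\<phi> t + (- \<phi> a) * 1\<bar> \<le> e"
        using d(2)[of t] t t' y by (auto simp: dist_real_def)
      ultimately show "\<exists>d. (?g has_real_derivative d) (at t within {a..y}) \<and> \<bar>d\<bar> \<le> e" by blast
    qed (use y e in auto)
    then show "norm (f y - f a - \<phi> a * (y - a)) \<le> e * norm (y - a)"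
      using y by (simp add: algebra_simps)
  qed (use d ab in auto)
qed

section \<open>Indefinite Lebesgue integrals\<close>

text \<open>
  Truncation at height \<open>k\<close> splits \<open>\<bar>f\<bar>\<close> into a part of small integral, by dominated convergence, and a
  bounded part, whose integral over intervals of small total length is small.
\<close>

lemma abs_continuous_on_integral:
  fixes f :: "real \<Rightarrow> real"
  assumes f: "f absolutely_integrable_on {a..b}"
  shows "abs_continuous_on {a..b} (\<lambda>t. integral {a..t} f)"
  unfolding abs_continuous_on_def
proof (intro allI impI)
  fix e :: real assume e: "e > 0"
  let ?g = "\<lambda>k t. max (\<bar>f t\<bar> - real k) 0"
  have fi: "f integrable_on {a..b}" "(\<lambda>t. \<bar>f t\<bar>) integrable_on {a..b}"
    using f unfolding absolutely_integrable_on_def by auto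
  have gint: "?g k absolutely_integrable_on {a..b}" for k
  proof (rule measurable_bounded_by_integrable_imp_absolutely_integrable[OF _ _ fi(2)])
    have "f \<in> borel_measurable (lebesgue_on {a..b})"
      by (rule absolutely_integrable_imp_borel_measurable[OF f]) auto
    then show "?g k \<in> borel_measurable (lebesgue_on {a..b})" by measurable
  qed auto
  then have gi: "?g k integrable_on {a..b}" for k unfolding absolutely_integrable_on_def by auto
  have "(\<lambda>k. integral {a..b} (?g k)) \<longlonglongrightarrow> integral {a..b} (\<lambda>t. 0)"
  proof (rule dominated_convergence(2)[OF gi fi(2)])
    fix t
    show "(\<lambda>k. ?g k t) \<longlonglongrightarrow> 0"
    proof (rule tendsto_eventually)
      obtain k0 :: nat where "\<bar>f t\<bar> \<le> real k0" using real_arch_simple by blast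
      then show "\<forall>\<^sub>F k in sequentially. ?g k t = 0"
        by (intro eventually_sequentiallyI[of k0]) auto
    qed
  qed auto
  then have "\<forall>\<^sub>F k in sequentially. integral {a..b} (?g k) < e/2"
    using e by (intro order_tendstoD) auto
  then obtain k where k: "integral {a..b} (?g k) < e/2" unfolding eventually_sequentially by blast
  define \<delta> where "\<delta> = e / (2 * (real k + 1))"
  have \<delta>: "\<delta> > 0" unfolding \<delta>_def using e by simp
  show "\<exists>\<delta>>0. \<forall>I. finite I \<longrightarrow> (\<forall>(u, v)\<in>I. u < v \<and> {u..v} \<subseteq> {a..b}) \<longrightarrow>
      nonoverlapping I \<longrightarrow>
      (\<Sum>(u, v)\<in>I. v - u) < \<delta> \<longrightarrow> (\<Sum>(u, v)\<in>I. \<bar>integral {a..v} f - integral {a..u} f\<bar>) < e"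
  proof (intro exI[of _ \<delta>] conjI allI impI \<delta>)
    fix I :: "(real \<times> real) set"
    assume I: "finite I" "\<forall>(u, v)\<in>I. u < v \<and> {u..v} \<subseteq> {a..b}"
      "nonoverlapping I" "(\<Sum>(u, v)\<in>I. v - u) < \<delta>"
    have Iab: "u < v \<and> a \<le> u \<and> v \<le> b \<and> {u..v} \<subseteq> {a..b}" if "(u,v) \<in> I" for u v using I(2) that by auto
    have "(\<Sum>(u, v)\<in>I. \<bar>integral {a..v} f - integral {a..u} f\<bar>) \<le> (\<Sum>(u, v)\<in>I. integral {u..v} (?g k) + real k * (v - u))"
    proof (rule sum_mono, clarify)
      fix u v assume uv: "(u,v) \<in> I"
      note J = Iab[OF uv]
      have fuv: "f integrable_on {u..v}" "?g k integrable_on {u..v}" "f integrable_on {a..v}"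
        using integrable_on_subinterval[OF fi(1), of u v] integrable_on_subinterval[OF gi, of u v]
          integrable_on_subinterval[OF fi(1), of a v] J by auto
      have "integral {a..v} f - integral {a..u} f = integral {u..v} f"
        using Henstock_Kurzweil_Integration.integral_combine[OF _ _ fuv(3), of u] J by simp
      moreover have "norm (integral {u..v} f) \<le> integral {u..v} (\<lambda>t. ?g k t + real k)"
        by (rule integral_norm_bound_integral) (use fuv in \<open>auto intro!: integrable_add\<close>)
      moreover have "integral {u..v} (\<lambda>t. ?g k t + real k) = integral {u..v} (?g k) + real k * (v - u)"
        using fuv(2) J by (subst Henstock_Kurzweil_Integration.integral_add) auto
      ultimately show "\<bar>integral {a..v} f - integral {a..u} f\<bar> \<le> integral {u..v} (?g k) + real k * (v - u)"
        by simp
    qed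
    also have "\<dots> = (\<Sum>(u, v)\<in>I. integral {u..v} (?g k)) + real k * (\<Sum>(u, v)\<in>I. v - u)"
      by (simp add: case_prod_unfold sum.distrib sum_distrib_left)
    also have "(\<Sum>(u, v)\<in>I. integral {u..v} (?g k)) \<le> integral {a..b} (?g k)"
    proof -
      have "(?g k has_integral (\<Sum>i\<in>I. integral {fst i..snd i} (?g k))) (\<Union>i\<in>I. {fst i<..<snd i})"
      proof (rule has_integral_UN[OF I(1)])
        fix i assume "i \<in> I"
        then have "?g k integrable_on {fst i..snd i}"
          using integrable_on_subinterval[OF gi, of "fst i" "snd i"] Iab[of "fst i" "snd i"] by auto
        then show "(?g k has_integral integral {fst i..snd i} (?g k)) {fst i<..<snd i}"
          by (simp add: has_integral_Icc_iff_Ioo[symmetric] integrable_integral)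
      next
        show "pairwise (\<lambda>i i'. negligible ({fst i<..<snd i} \<inter> {fst i'<..<snd i'})) I"
          using I(3) by (auto simp: pairwise_def disjnt_def case_prod_unfold)
      qed
      from has_integral_subset_le[OF _ this integrable_integral[OF gi]]
      show ?thesis using Iab by (fastforce simp: case_prod_unfold)
    qed
    also have "integral {a..b} (?g k) < e/2" by (rule k)
    also have "real k * (\<Sum>(u, v)\<in>I. v - u) \<le> real k * \<delta>" using I(4) by (intro mult_left_mono) auto
    also have "real k * \<delta> \<le> e/2" unfolding \<delta>_def using e by (simp add: field_simps)
    finally show "(\<Sum>(u, v)\<in>I. \<bar>integral {a..v} f - integral {a..u} f\<bar>) < e" by simp
  qed
qed

text \<open>
  The one-dimensional Lebesgue differentiation theorem. At a point where the difference quotients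
  of the indefinite integral stay \<open>\<epsilon>\<close>-far from \<open>f\<close>, there are arbitrarily short intervals between
  \<open>x\<close> and some \<open>y\<close>, on either side, on which the Riemann term \<open>f x (y - x)\<close> misses the integral by more than \<open>\<epsilon> \<bar>y - x\<bar>\<close>. Vitali's theorem
  extracts disjoint ones that cover the bad set up to a null set; they form a tagged partial division,
  so Henstock's lemma bounds the sum of the errors, and with it the total length, by any \<open>e > 0\<close>.
\<close>

theorem indefinite_integral_has_real_derivative_ae:
  fixes f :: "real \<Rightarrow> real"
  assumes f: "f integrable_on {a..b}"
  shows "negligible {x\<in>{a..b}. \<not> ((\<lambda>t. integral {a..t} f) has_real_derivative f x) (at x within {a..b})}"
proof -
  let ?F = "\<lambda>t. integral {a..t} f"
  define E where "E = (\<lambda>\<epsilon>. {x\<in>{a..b}. \<forall>\<delta>>0. \<exists>y\<in>{a..b}. \<bar>y - x\<bar> < \<delta> \<and> \<bar>?F y - ?F x - f x * (y - x)\<bar> > \<epsilon> * \<bar>y - x\<bar>})"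
  have diff: "?F y - ?F x = integral {x..y} f" if "a \<le> x" "x \<le> y" "y \<le> b" for x y
  proof -
    have "f integrable_on {a..y}" using integrable_on_subinterval[OF f, of a y] that by auto
    then show ?thesis
      using Henstock_Kurzweil_Integration.integral_combine[of a x y f] that by simp
  qed
  have neg: "negligible (E \<epsilon>)" if \<epsilon>: "\<epsilon> > 0" for \<epsilon>
    unfolding negligible_outer_le
  proof (intro allI impI)
    fix e :: real assume e: "e > 0"
    have f': "f integrable_on cbox a b" using f by simp
    obtain \<gamma> where \<gamma>: "gauge \<gamma>"
      and hen: "\<And>p. p tagged_partial_division_of cbox a b \<Longrightarrow> \<gamma> fine p \<Longrightarrow>
        (\<Sum>(x,k)\<in>p. norm (measure lborel k *\<^sub>R f x - integral k f)) < \<epsilon> * e"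
      by (rule Henstock_lemma[OF f' mult_pos_pos[OF \<epsilon> e]]) blast
    \<comment> \<open>The interval between \<open>x\<close> and \<open>y\<close>, written as a ball for the Vitali covering.\<close>
    define c where "c = (\<lambda>i::real\<times>real. (fst i + snd i) / 2)"
    define r where "r = (\<lambda>i::real\<times>real. \<bar>snd i - fst i\<bar> / 2)"
    define K where "K = {i. fst i \<in> E \<epsilon> \<and> snd i \<in> {a..b} \<and> snd i \<noteq> fst i \<and> cball (c i) (r i) \<subseteq> \<gamma> (fst i) \<and>
        \<bar>?F (snd i) - ?F (fst i) - f (fst i) * (snd i - fst i)\<bar> > \<epsilon> * \<bar>snd i - fst i\<bar>}"
    have cb: "cball (c i) (r i) = {min (fst i) (snd i)..max (fst i) (snd i)}" for i
      unfolding cball_eq_atLeastAtMost c_def r_def by (auto simp: field_simps abs_if min_def max_def)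
    have cov: "\<exists>i. i \<in> K \<and> x \<in> cball (c i) (r i) \<and> r i < d" if x: "x \<in> E \<epsilon>" and d: "0 < d" for x d
    proof -
      have "x \<in> \<gamma> x" "open (\<gamma> x)" using \<gamma> unfolding gauge_def by auto
      then obtain \<eta> where \<eta>: "\<eta> > 0" "ball x \<eta> \<subseteq> \<gamma> x" using open_contains_ball by blast
      then have "min \<eta> d > 0" using d by simp
      moreover have "\<forall>\<delta>>0. \<exists>y\<in>{a..b}. \<bar>y - x\<bar> < \<delta> \<and> \<bar>?F y - ?F x - f x * (y - x)\<bar> > \<epsilon> * \<bar>y - x\<bar>"
        using x unfolding E_def by blast
      ultimately obtain y where y: "y \<in> {a..b}" "\<bar>y - x\<bar> < min \<eta> d" "\<bar>?F y - ?F x - f x * (y - x)\<bar> > \<epsilon> * \<bar>y - x\<bar>" by blast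
      have "y \<noteq> x" using y(3) by auto
      moreover have "cball (c (x,y)) (r (x,y)) \<subseteq> ball x \<eta>"
        unfolding cb using y(2) by (auto simp: dist_real_def)
      ultimately have "(x,y) \<in> K" unfolding K_def using x y \<eta> by auto
      moreover have "x \<in> cball (c (x,y)) (r (x,y))" unfolding cb by auto
      moreover have "r (x,y) < d" unfolding r_def using y(2) d by auto
      ultimately show ?thesis by blast
    qed
    have rpos: "0 < r i" if "i \<in> K" for i using that unfolding K_def r_def by auto
    obtain C where C: "countable C" "C \<subseteq> K"
      "pairwise (\<lambda>i j. disjnt (cball (c i) (r i)) (cball (c j) (r j))) C"
      "negligible (E \<epsilon> - (\<Union>i\<in>C. cball (c i) (r i)))"
      by (rule Vitali_covering_theorem_cballs[of K r "E \<epsilon>" c, OF rpos cov]) ((assumption | rule that)+)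
    have bound: "measure lebesgue (\<Union>i\<in>I. cball (c i) (r i)) \<le> e" if I: "I \<subseteq> C" "finite I" for I
    proof -
      let ?g = "\<lambda>i. (fst i, cball (c i) (r i))"
      have iK: "fst i \<in> {a..b}" "snd i \<in> {a..b}" "fst i \<in> cball (c i) (r i)" "cball (c i) (r i) \<subseteq> \<gamma> (fst i)"
        "\<bar>?F (snd i) - ?F (fst i) - f (fst i) * (snd i - fst i)\<bar> > \<epsilon> * \<bar>snd i - fst i\<bar>" if i: "i \<in> I" for i
      proof -
        have "i \<in> K" using i I C(2) by blast
        then show "fst i \<in> {a..b}" "snd i \<in> {a..b}" "cball (c i) (r i) \<subseteq> \<gamma> (fst i)"
          "\<bar>?F (snd i) - ?F (fst i) - f (fst i) * (snd i - fst i)\<bar> > \<epsilon> * \<bar>snd i - fst i\<bar>"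
          unfolding K_def E_def by blast+
        show "fst i \<in> cball (c i) (r i)" unfolding cb by simp
      qed
      have disj: "cball (c i) (r i) \<inter> cball (c j) (r j) = {}" if "i \<in> I" "j \<in> I" "i \<noteq> j" for i j
        using C(3) that I unfolding pairwise_def disjnt_def by blast
      have inj: "inj_on ?g I"
      proof (rule inj_onI)
        fix i j assume ij: "i \<in> I" "j \<in> I" "?g i = ?g j"
        then have "fst i \<in> cball (c i) (r i) \<inter> cball (c j) (r j)" using iK(3)[OF ij(1)] iK(3)[OF ij(2)] by simp
        then show "i = j" using disj[OF ij(1,2)] by blast
      qed
      have part: "?g ` I tagged_partial_division_of cbox a b"
        unfolding tagged_partial_division_of_def
      proof (intro conjI allI impI)
        fix x k assume "(x,k) \<in> ?g ` I"
        then obtain i where i: "i \<in> I" "x = fst i" "k = cball (c i) (r i)" by auto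
        show "x \<in> k" "k \<subseteq> cbox a b" using iK(1-3)[OF i(1)] i cb by auto
        show "\<exists>a b. k = cbox a b" unfolding i cb by (metis interval_cbox)
      next
        fix x k x' k' assume ne: "(x,k) \<in> ?g ` I \<and> (x',k') \<in> ?g ` I \<and> (x,k) \<noteq> (x',k')"
        then obtain i j where ij: "i \<in> I" "k = cball (c i) (r i)" "j \<in> I" "k' = cball (c j) (r j)" "i \<noteq> j"
          by auto
        from disj[OF ij(1,3,5)] show "interior k \<inter> interior k' = {}"
          unfolding ij using interior_subset by blast
      qed (use I in auto)
      have fine: "\<gamma> fine ?g ` I" using iK(4) unfolding fine_def by auto
      have "measure lebesgue (\<Union>i\<in>I. cball (c i) (r i)) \<le> (\<Sum>i\<in>I. measure lebesgue (cball (c i) (r i)))"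
        by (rule measure_UNION_le) (use I in auto)
      also have "\<dots> = (\<Sum>i\<in>I. \<bar>snd i - fst i\<bar>)"
        unfolding cb by (rule sum.cong) auto
      finally have le: "measure lebesgue (\<Union>i\<in>I. cball (c i) (r i)) \<le> (\<Sum>i\<in>I. \<bar>snd i - fst i\<bar>)" .
      have "\<epsilon> * (\<Sum>i\<in>I. \<bar>snd i - fst i\<bar>) \<le> (\<Sum>i\<in>I. norm (measure lborel (cball (c i) (r i)) *\<^sub>R f (fst i) - integral (cball (c i) (r i)) f))"
        unfolding sum_distrib_left
      proof (rule sum_mono)
        fix i assume i: "i \<in> I"
        note k = iK[OF i]
        have "\<bar>?F (snd i) - ?F (fst i) - f (fst i) * (snd i - fst i)\<bar>
            = norm (measure lborel (cball (c i) (r i)) *\<^sub>R f (fst i) - integral (cball (c i) (r i)) f)"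
        proof (cases "fst i \<le> snd i")
          case True
          then show ?thesis unfolding cb using diff[of "fst i" "snd i"] k(1,2) by (simp add: algebra_simps abs_minus_commute)
        next
          case False
          have "cball (c i) (r i) = {snd i..fst i}" unfolding cb using False by auto
          moreover have "?F (snd i) - ?F (fst i) - f (fst i) * (snd i - fst i) = (fst i - snd i) * f (fst i) - (?F (fst i) - ?F (snd i))"
            by (simp add: algebra_simps)
          ultimately show ?thesis using diff[of "snd i" "fst i"] k(1,2) False by simp
        qed
        with k(5) show "\<epsilon> * \<bar>snd i - fst i\<bar> \<le> norm (measure lborel (cball (c i) (r i)) *\<^sub>R f (fst i) - integral (cball (c i) (r i)) f)"
          by linarith
      qed
      also have "\<dots> = (\<Sum>(x,k)\<in>?g ` I. norm (measure lborel k *\<^sub>R f x - integral k f))"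
        by (subst sum.reindex[OF inj]) simp
      also have "\<dots> < \<epsilon> * e" by (rule hen[OF part fine])
      finally have "(\<Sum>i\<in>I. \<bar>snd i - fst i\<bar>) < e" using \<epsilon> by simp
      with le show ?thesis by simp
    qed
    let ?T = "(E \<epsilon> - (\<Union>i\<in>C. cball (c i) (r i))) \<union> (\<Union>i\<in>C. cball (c i) (r i))"
    have fm: "(\<Union>i\<in>C. cball (c i) (r i)) \<in> lmeasurable"
      by (rule fmeasurable_UN_bound[OF C(1) _ bound]) auto
    have "measure lebesgue (\<Union>i\<in>C. cball (c i) (r i)) \<le> e"
      by (rule measure_UN_bound[OF C(1) _ bound]) auto
    moreover have "measure lebesgue ?T \<le> measure lebesgue (E \<epsilon> - (\<Union>i\<in>C. cball (c i) (r i))) + measure lebesgue (\<Union>i\<in>C. cball (c i) (r i))"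
      by (rule measure_Un_le) (use C(4) fm negligible_imp_sets in auto)
    ultimately have "measure lebesgue ?T \<le> e" using negligible_imp_measure0[OF C(4)] by simp
    moreover have "?T \<in> lmeasurable" using fm C(4) negligible_imp_measurable by blast
    moreover have "E \<epsilon> \<subseteq> ?T" by auto
    ultimately show "\<exists>T. E \<epsilon> \<subseteq> T \<and> T \<in> lmeasurable \<and> measure lebesgue T \<le> e" by blast
  qed
  have "negligible (\<Union>k. E (1 / real (Suc k)))"
    by (rule negligible_countable_Union) (auto intro: neg)
  moreover have "{x\<in>{a..b}. \<not> (?F has_real_derivative f x) (at x within {a..b})} \<subseteq> (\<Union>k. E (1 / real (Suc k)))"
  proof clarify
    fix x assume x: "x \<in> {a..b}" and nd: "\<not> (?F has_real_derivative f x) (at x within {a..b})"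
    show "x \<in> (\<Union>k. E (1 / real (Suc k)))"
    proof (rule ccontr)
      assume nE: "x \<notin> (\<Union>k. E (1 / real (Suc k)))"
      have "(?F has_real_derivative f x) (at x within {a..b})"
        unfolding has_field_derivative_def has_derivative_within_alt
      proof (intro conjI allI impI bounded_linear_mult_right)
        fix e :: real assume "e > 0"
        then obtain k where k: "1 / real (Suc k) < e" using nat_approx_posE by blast
        have "x \<notin> E (1 / real (Suc k))" using nE by blast
        then have "\<not> (\<forall>\<delta>>0. \<exists>y\<in>{a..b}. \<bar>y - x\<bar> < \<delta> \<and>
            \<bar>?F y - ?F x - f x * (y - x)\<bar> > 1 / real (Suc k) * \<bar>y - x\<bar>)"
          using x unfolding E_def by blast
        then obtain \<delta> where \<delta>0: "\<delta> > 0" "\<not> (\<exists>y\<in>{a..b}. \<bar>y - x\<bar> < \<delta> \<and>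
            \<bar>?F y - ?F x - f x * (y - x)\<bar> > 1 / real (Suc k) * \<bar>y - x\<bar>)" by blast
        have \<delta>: "\<bar>?F y - ?F x - f x * (y - x)\<bar> \<le> 1 / real (Suc k) * \<bar>y - x\<bar>"
          if "y \<in> {a..b}" "\<bar>y - x\<bar> < \<delta>" for y
          using \<delta>0(2) that not_less by blast
        show "\<exists>d>0. \<forall>y\<in>{a..b}. norm (y - x) < d \<longrightarrow> norm (?F y - ?F x - f x * (y - x)) \<le> e * norm (y - x)"
        proof (intro exI[of _ \<delta>] conjI ballI impI \<delta>0(1))
          fix y assume y: "y \<in> {a..b}" "norm (y - x) < \<delta>"
          have "\<bar>?F y - ?F x - f x * (y - x)\<bar> \<le> 1 / real (Suc k) * \<bar>y - x\<bar>" using \<delta> y by simp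
          also have "\<dots> \<le> e * \<bar>y - x\<bar>" using k by (intro mult_right_mono) auto
          finally show "norm (?F y - ?F x - f x * (y - x)) \<le> e * norm (y - x)" by simp
        qed
      qed
      with nd show False by blast
    qed
  qed
  ultimately show ?thesis using negligible_subset by blast
qed

section \<open>Linear integral equations\<close>

text \<open>
  Instead of an exponential weight, the time axis is cut into steps of a length \<open>h\<close> on which the growth
  bound contracts the maximum of \<open>\<Sum>j<n. \<bar>f j t\<bar>\<close> by a factor \<open>1/2\<close>; a function starting at zero on such
  a step stays zero.
\<close>

lemma gronwall_zero:
  fixes f :: "nat \<Rightarrow> real \<Rightarrow> real"
  assumes ac: "\<And>i. i < n \<Longrightarrow> abs_continuous_on {0..b} (f i)" and f0: "\<And>i. i < n \<Longrightarrow> f i 0 = 0"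
    and N: "negligible N" and K: "K \<ge> 0"
    and der: "\<And>t i. t \<in> {0..b} - N \<Longrightarrow> i < n \<Longrightarrow>
        \<exists>d. (f i has_real_derivative d) (at t within {0..b}) \<and> \<bar>d\<bar> \<le> K * (\<Sum>j<n. \<bar>f j t\<bar>)"
    and t: "t \<in> {0..b}" and i: "i < n"
  shows "f i t = 0"
proof -
  \<comment> \<open>The added \<open>1\<close> keeps the step length \<open>h\<close> finite when \<open>n\<close> or \<open>K\<close> is zero.\<close>
  define c where "c = real n * K + 1"
  have c: "c > 0" "real n * K \<le> c" unfolding c_def using K by (auto simp: add_nonneg_pos)
  define h where "h = 1 / (2 * c)"
  define \<phi> where "\<phi> = (\<lambda>t. \<Sum>j<n. \<bar>f j t\<bar>)"
  have h: "h > 0" unfolding h_def using c by simp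
  have nKh: "real n * K * h \<le> 1/2" unfolding h_def using c by (simp add: field_simps)
  have cont: "continuous_on {0..b} (f j)" if "j < n" for j
    using ac[OF that] abs_continuous_on_imp_continuous_on by blast
  have c\<phi>: "continuous_on {0..b} \<phi>" unfolding \<phi>_def by (intro continuous_intros cont) auto
  have fz: "f j s = 0" if "\<phi> s = 0" "j < n" for s j
    using that unfolding \<phi>_def by (subst (asm) sum_nonneg_eq_0_iff) auto
  have "\<forall>s\<in>{0..b}. s \<le> real k * h \<longrightarrow> \<phi> s = 0" for k
  proof (induction k)
    case 0
    show ?case using f0 unfolding \<phi>_def by auto
  next
    case (Suc k)
    show ?case
    proof (intro ballI impI)
      fix s assume s: "s \<in> {0..b}" "s \<le> real (Suc k) * h"
      let ?c = "real k * h"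
      have c0: "?c \<ge> 0" using h by simp
      show "\<phi> s = 0"
      proof (cases "s \<le> ?c")
        case True then show ?thesis using Suc s by blast
      next
        case False
        have sub: "{?c..s} \<subseteq> {0..b}" using c0 s by auto
        have "compact {?c..s}" "{?c..s} \<noteq> {}" using False by auto
        then obtain t' where t': "t' \<in> {?c..s}" "\<And>t. t \<in> {?c..s} \<Longrightarrow> \<phi> t \<le> \<phi> t'"
          using continuous_attains_sup[OF _ _ continuous_on_subset[OF c\<phi> sub]] by metis
        have \<phi>0: "\<phi> t' \<ge> 0" unfolding \<phi>_def by (simp add: sum_nonneg)
        have "\<bar>f j t'\<bar> \<le> K * \<phi> t' * h" if j: "j < n" for j
        proof -
          have "\<bar>f j t' - f j ?c\<bar> \<le> (K * \<phi> t') * (t' - ?c)"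
          proof (rule abs_continuous_on_growth_bound[OF _ _ N])
            show "?c \<le> t'" using t' by auto
            show "abs_continuous_on {?c..t'} (f j)"
              by (rule abs_continuous_on_subset[OF ac[OF j]]) (use t' sub in auto)
            show "0 \<le> K * \<phi> t'" using K \<phi>0 by simp
            fix \<tau> assume \<tau>: "\<tau> \<in> {?c..t'} - N"
            then have "\<tau> \<in> {0..b} - N" using t' sub by auto
            from der[OF this j] obtain d where
              d: "(f j has_real_derivative d) (at \<tau> within {0..b})" "\<bar>d\<bar> \<le> K * \<phi> \<tau>" unfolding \<phi>_def by blast
            have "K * \<phi> \<tau> \<le> K * \<phi> t'" using t' \<tau> K by (intro mult_left_mono) auto
            moreover have "(f j has_real_derivative d) (at \<tau> within {?c..t'})"
              by (rule has_field_derivative_subset[OF d(1)]) (use t' sub in auto)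
            ultimately show "\<exists>d. (f j has_real_derivative d) (at \<tau> within {?c..t'}) \<and> \<bar>d\<bar> \<le> K * \<phi> t'"
              using d(2) by (intro exI[of _ d]) auto
          qed
          moreover have "f j ?c = 0" using Suc fz[OF _ j] sub False by auto
          moreover have "(K * \<phi> t') * (t' - ?c) \<le> K * \<phi> t' * h"
            using K \<phi>0 t' s by (intro mult_left_mono) (auto simp: algebra_simps)
          ultimately show ?thesis by auto
        qed
        then have "\<phi> t' \<le> (\<Sum>j<n. K * \<phi> t' * h)" unfolding \<phi>_def by (intro sum_mono) auto
        also have "\<dots> = (real n * K * h) * \<phi> t'" by simp
        also have "\<dots> \<le> 1/2 * \<phi> t'" using nKh \<phi>0 by (intro mult_right_mono) auto
        finally have "\<phi> t' = 0" using \<phi>0 by auto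
        moreover have "\<phi> s \<ge> 0" unfolding \<phi>_def by (simp add: sum_nonneg)
        ultimately show ?thesis using t'(2)[of s] False by auto
      qed
    qed
  qed
  moreover obtain k :: nat where "t \<le> real k * h"
    using reals_Archimedean3[OF h] by (metis less_imp_le)
  ultimately show ?thesis using t fz i by blast
qed

lemma continuous_on_half_line:
  fixes F :: "real \<Rightarrow> real"
  assumes "\<And>b. b \<ge> 0 \<Longrightarrow> continuous_on {0..b} F"
  shows "continuous_on {0..} F"
  unfolding continuous_on_iff
proof (intro ballI allI impI)
  fix x e :: real assume x: "x \<in> {0..}" and e: "0 < e"
  have "continuous_on {0..x+1} F" using assms x by simp
  then obtain d where d: "d > 0" "\<And>y. y \<in> {0..x+1} \<Longrightarrow> dist y x < d \<Longrightarrow> dist (F y) (F x) < e"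
    using x e unfolding continuous_on_iff by (metis add_increasing2 atLeastAtMost_iff atLeast_iff le_add_same_cancel1 zero_le_one)
  show "\<exists>d>0. \<forall>x'\<in>{0..}. dist x' x < d \<longrightarrow> dist (F x') (F x) < e"
  proof (intro exI[of _ "min d 1"] conjI ballI impI)
    fix y assume "y \<in> {0..}" "dist y x < min d 1"
    then show "dist (F y) (F x) < e" using d(2)[of y] by (auto simp: dist_real_def abs_if split: if_splits)
  qed (use d in auto)
qed

lemma absolutely_integrable_on_matrix_mult:
  fixes G :: "nat \<Rightarrow> nat \<Rightarrow> real \<Rightarrow> real"
  assumes G: "\<And>j. j < n \<Longrightarrow> G i j \<in> borel_measurable borel"
    and GK: "\<And>j s. j < n \<Longrightarrow> s \<ge> 0 \<Longrightarrow> \<bar>G i j s\<bar> \<le> K"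
    and w: "\<And>j. j < n \<Longrightarrow> continuous_on {0..} (w j)"
  shows "(\<lambda>s. \<Sum>j<n. G i j s * w j s) absolutely_integrable_on {0..b}"
proof (rule absolutely_integrable_sum)
  fix j assume "j \<in> {..<n}"
  then have j: "j < n" by simp
  have wc: "continuous_on {0..b} (w j)" by (rule continuous_on_subset[OF w[OF j]]) auto
  show "(\<lambda>s. G i j s * w j s) absolutely_integrable_on {0..b}"
  proof (rule measurable_bounded_by_integrable_imp_absolutely_integrable)
    have "G i j \<in> borel_measurable (lebesgue_on {0..b})"
      using G[OF j] by (metis borel_measurable_if_I measurable_completion measurable_lborel2 measurable_restrict_space1)
    moreover have "w j \<in> borel_measurable (lebesgue_on {0..b})"
      by (rule continuous_imp_measurable_on_sets_lebesgue[OF wc]) auto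
    ultimately show "(\<lambda>s. G i j s * w j s) \<in> borel_measurable (lebesgue_on {0..b})" by measurable
    show "(\<lambda>s. K * \<bar>w j s\<bar>) integrable_on {0..b}"
      by (intro integrable_continuous_real continuous_intros wc)
    fix s assume "s \<in> {0..b}"
    then have "\<bar>G i j s\<bar> \<le> K" using GK[OF j] by simp
    then show "norm (G i j s * w j s) \<le> K * \<bar>w j s\<bar>" by (simp add: abs_mult mult_right_mono)
  qed auto
qed auto

text \<open>
  Picard iteration, written as a Neumann series: \<open>x\<close> is the sum of \<open>z k\<close>, where \<open>z 0 = V\<close> and
  \<open>z (k + 1)\<close> is the integral operator applied to \<open>z k\<close>. On \<open>[0, b]\<close> the series is dominated by an
  exponential series, which gives uniform convergence and lets the integral be taken termwise.
  The coefficients are only measurable in time, as needed for switching signals.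
\<close>

theorem linear_integral_equation_solvable:
  fixes G :: "nat \<Rightarrow> nat \<Rightarrow> real \<Rightarrow> real" and V :: "nat \<Rightarrow> real \<Rightarrow> real"
  assumes V: "\<And>i. i < n \<Longrightarrow> continuous_on {0..} (V i)"
    and G: "\<And>i j. i < n \<Longrightarrow> j < n \<Longrightarrow> G i j \<in> borel_measurable borel"
    and GK: "\<And>i j s. i < n \<Longrightarrow> j < n \<Longrightarrow> s \<ge> 0 \<Longrightarrow> \<bar>G i j s\<bar> \<le> K" and K: "K \<ge> 0"
  obtains x where "\<And>i. i < n \<Longrightarrow> continuous_on {0..} (x i)"
    "\<And>i t. i < n \<Longrightarrow> t \<ge> 0 \<Longrightarrow> x i t = V i t + integral {0..t} (\<lambda>s. \<Sum>j<n. G i j s * x j s)"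
proof -
  define z where "z = rec_nat V (\<lambda>k w i t. integral {0..t} (\<lambda>s. \<Sum>j<n. G i j s * w j s))"
  have z0: "z 0 = V" and zS: "z (Suc k) i t = integral {0..t} (\<lambda>s. \<Sum>j<n. G i j s * z k j s)" for k i t
    unfolding z_def by simp_all
  have ai: "(\<lambda>s. \<Sum>j<n. G i j s * w j s) absolutely_integrable_on {0..b}"
    if "i < n" "\<And>j. j < n \<Longrightarrow> continuous_on {0..} (w j)" for i w b
    using that G GK by (intro absolutely_integrable_on_matrix_mult) auto
  then have int: "(\<lambda>s. \<Sum>j<n. G i j s * w j s) integrable_on {0..b}"
    if "i < n" "\<And>j. j < n \<Longrightarrow> continuous_on {0..} (w j)" for i w b
    using that unfolding absolutely_integrable_on_def by blast
  have zc: "i < n \<Longrightarrow> continuous_on {0..} (z k i)" for k i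
  proof (induction k arbitrary: i)
    case 0 then show ?case using V z0 by simp
  next
    case (Suc k)
    have "continuous_on {0..} (\<lambda>t. integral {0..t} (\<lambda>s. \<Sum>j<n. G i j s * z k j s))"
      by (rule continuous_on_half_line, rule indefinite_integral_continuous_1, rule int) (use Suc in auto)
    then show ?case by (simp add: zS[abs_def])
  qed
  define c where "c = real n * K"
  have c: "c \<ge> 0" unfolding c_def using K by simp
  have "\<exists>M\<ge>0. \<forall>t\<in>{0..b}. \<forall>i<n. \<bar>V i t\<bar> \<le> M" for b
  proof -
    have "continuous_on {0..b} (\<lambda>t. \<Sum>i<n. \<bar>V i t\<bar>)"
      by (intro continuous_intros continuous_on_subset[OF V]) auto
    then have "bounded ((\<lambda>t. \<Sum>i<n. \<bar>V i t\<bar>) ` {0..b})"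
      using compact_continuous_image compact_imp_bounded compact_Icc by blast
    then obtain M where M: "M > 0" "\<And>t. t \<in> {0..b} \<Longrightarrow> (\<Sum>i<n. \<bar>V i t\<bar>) \<le> M"
      unfolding bounded_pos by auto
    have "\<bar>V i t\<bar> \<le> M" if "t \<in> {0..b}" "i < n" for t i
      using member_le_sum[of i "{..<n}" "\<lambda>i. \<bar>V i t\<bar>"] M(2)[OF that(1)] that(2) by auto
    then show ?thesis using M(1) by (intro exI[of _ M]) auto
  qed
  then obtain M where M: "\<And>b. M b \<ge> 0" "\<And>b t i. t \<in> {0..b} \<Longrightarrow> i < n \<Longrightarrow> \<bar>V i t\<bar> \<le> M b" by metis
  have zb: "i < n \<Longrightarrow> t \<in> {0..b} \<Longrightarrow> \<bar>z k i t\<bar> \<le> M b * ((c * t) ^ k / fact k)" for k i t b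
  proof (induction k arbitrary: i t)
    case 0 then show ?case using M z0 by simp
  next
    case (Suc k)
    let ?g = "\<lambda>s. c * (M b * ((c * s) ^ k / fact k))"
    have der: "((\<lambda>s. M b * ((c * s) ^ Suc k / fact (Suc k))) has_vector_derivative ?g s) (at s within {0..t})" for s
    proof -
      have "((\<lambda>s. (c * s) ^ Suc k) has_real_derivative real (Suc k) * (c * (c * s) ^ k)) (at s within {0..t})"
        using DERIV_power[OF DERIV_cmult_Id[of c], where n="Suc k"] by simp
      then have "((\<lambda>s. M b * ((c * s) ^ Suc k / fact (Suc k))) has_real_derivative
          M b * (real (Suc k) * (c * (c * s) ^ k) / fact (Suc k))) (at s within {0..t})"
        by (intro DERIV_cmult DERIV_cdivide)
      also have "M b * (real (Suc k) * (c * (c * s) ^ k) / fact (Suc k)) = ?g s"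
        by (simp add: divide_simps del: of_nat_Suc)
      finally show ?thesis by (simp add: has_real_derivative_iff_has_vector_derivative)
    qed
    have gi: "(?g has_integral M b * ((c * t) ^ Suc k / fact (Suc k))) {0..t}"
      using fundamental_theorem_of_calculus[of 0 t "\<lambda>s. M b * ((c * s) ^ Suc k / fact (Suc k))" ?g] der Suc.prems by simp
    have "norm (integral {0..t} (\<lambda>s. \<Sum>j<n. G i j s * z k j s)) \<le> integral {0..t} ?g"
    proof (rule integral_norm_bound_integral)
      show "(\<lambda>s. \<Sum>j<n. G i j s * z k j s) integrable_on {0..t}" using int Suc.prems zc by blast
      show "?g integrable_on {0..t}" using gi by blast
      fix s assume s: "s \<in> {0..t}"
      have "\<bar>\<Sum>j<n. G i j s * z k j s\<bar> \<le> (\<Sum>j<n. K * (M b * ((c * s) ^ k / fact k)))"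
      proof (rule order_trans[OF sum_abs sum_mono])
        fix j assume "j \<in> {..<n}"
        then show "\<bar>G i j s * z k j s\<bar> \<le> K * (M b * ((c * s) ^ k / fact k))"
          unfolding abs_mult using GK[of i j s] Suc.IH[of j s] Suc.prems s K by (intro mult_mono) auto
      qed
      also have "\<dots> = ?g s" by (simp add: c_def)
      finally show "norm (\<Sum>j<n. G i j s * z k j s) \<le> ?g s" by simp
    qed
    then show ?case using integral_unique[OF gi] zS by simp
  qed
  define x where "x = (\<lambda>i t. \<Sum>k. z k i t)"
  have sm: "summable (\<lambda>k. M b * ((c * b) ^ k / fact k))" for b
    by (intro summable_mult) (use summable_exp[of "c * b"] in \<open>simp add: field_simps\<close>)
  have zb': "norm (z k i t) \<le> M b * ((c * b) ^ k / fact k)" if "i < n" "t \<in> {0..b}" for k i t b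
  proof -
    have "(c * t) ^ k \<le> (c * b) ^ k" using that c by (intro power_mono mult_left_mono) auto
    then have "M b * ((c * t) ^ k / fact k) \<le> M b * ((c * b) ^ k / fact k)"
      using M(1) by (intro mult_left_mono divide_right_mono) auto
    then show ?thesis using zb[OF that, of k] by simp
  qed
  have ul: "uniform_limit {0..b} (\<lambda>N t. \<Sum>k<N. z k i t) (x i) sequentially" if "i < n" for i b
    unfolding x_def by (rule Weierstrass_m_test[OF zb' sm]) (use that in auto)
  have xc: "continuous_on {0..} (x i)" if i: "i < n" for i
  proof (rule continuous_on_half_line)
    fix b :: real
    show "continuous_on {0..b} (x i)"
    proof (rule uniform_limit_theorem[OF _ ul[OF i]])
      show "\<forall>\<^sub>F N in sequentially. continuous_on {0..b} (\<lambda>t. \<Sum>k<N. z k i t)"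
        by (intro always_eventually allI continuous_intros continuous_on_subset[OF zc[OF i]]) auto
    qed simp
  qed
  have "x i t = V i t + integral {0..t} (\<lambda>s. \<Sum>j<n. G i j s * x j s)" if i: "i < n" and t: "t \<ge> 0" for i t
  proof -
    have conv: "(\<lambda>N. \<Sum>k<N. z k j s) \<longlonglongrightarrow> x j s" if "j < n" "s \<in> {0..t}" for j s
      using tendsto_uniform_limitI[OF ul[OF that(1)] that(2)] .
    let ?h = "\<lambda>N s. \<Sum>j<n. G i j s * (\<Sum>k<N. z k j s)"
    let ?B = "\<Sum>k. M t * ((c * t) ^ k / fact k)"
    have hi: "?h N integrable_on {0..t}" for N
      by (rule int[OF i]) (intro continuous_intros zc, auto)
    have hb: "norm (?h N s) \<le> (\<Sum>j<n. K * ?B)" if s: "s \<in> {0..t}" for N s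
      unfolding real_norm_def
    proof (rule order_trans[OF sum_abs sum_mono])
      fix j assume "j \<in> {..<n}"
      then have j: "j < n" by simp
      have "\<bar>\<Sum>k<N. z k j s\<bar> \<le> (\<Sum>k<N. M t * ((c * t) ^ k / fact k))"
        using zb'[OF j s] by (intro order_trans[OF sum_abs sum_mono]) auto
      also have "\<dots> \<le> ?B" by (rule sum_le_suminf[OF sm]) (use M c t in auto)
      finally show "\<bar>G i j s * (\<Sum>k<N. z k j s)\<bar> \<le> K * ?B"
        unfolding abs_mult using GK[OF i j, of s] s K by (intro mult_mono) auto
    qed
    have "(\<lambda>N. integral {0..t} (?h N)) \<longlonglongrightarrow> integral {0..t} (\<lambda>s. \<Sum>j<n. G i j s * x j s)"
      by (rule dominated_convergence(2)[OF hi _ hb])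
        (auto intro!: tendsto_intros conv)
    moreover have "integral {0..t} (?h N) = (\<Sum>k<N. z (Suc k) i t)" for N
    proof -
      have "?h N = (\<lambda>s. \<Sum>k<N. \<Sum>j<n. G i j s * z k j s)"
        by (rule ext) (simp add: sum_distrib_left, rule sum.swap)
      then show ?thesis using zS by (simp add: Henstock_Kurzweil_Integration.integral_sum int i zc)
    qed
    ultimately have "(\<lambda>N. V i t + (\<Sum>k<N. z (Suc k) i t)) \<longlonglongrightarrow> V i t + integral {0..t} (\<lambda>s. \<Sum>j<n. G i j s * x j s)"
      by (intro tendsto_intros) simp
    moreover have "(\<lambda>N. V i t + (\<Sum>k<N. z (Suc k) i t)) = (\<lambda>N. \<Sum>k<Suc N. z k i t)"
      by (rule ext) (simp add: sum.lessThan_Suc_shift z0 del: sum.lessThan_Suc)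
    moreover have "(\<lambda>N. \<Sum>k<Suc N. z k i t) \<longlonglongrightarrow> x i t"
      by (rule LIMSEQ_Suc[OF conv]) (use i t in auto)
    ultimately show ?thesis by (simp only: LIMSEQ_unique)
  qed
  with xc show thesis using that by blast
qed

section \<open>Matrices and subspaces\<close>

lemma mat_mult_unit_vec:
  assumes "A \<in> carrier_mat r c" "j < c"
  shows "A *\<^sub>v unit_vec c j = col (A :: real mat) j"
  by (rule eq_vecI) (use assms in \<open>auto simp: scalar_prod_right_unit\<close>)

lemma mat_eqI_vec:
  assumes "A \<in> carrier_mat r c" "B \<in> carrier_mat r c"
    and "\<And>v. v \<in> carrier_vec c \<Longrightarrow> A *\<^sub>v v = B *\<^sub>v (v :: real vec)"
  shows "A = B"
proof (rule mat_col_eqI)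
  fix j assume "j < dim_col B"
  with assms show "col A j = col B j"
    using assms(3)[of "unit_vec c j"] mat_mult_unit_vec[OF assms(1), of j] mat_mult_unit_vec[OF assms(2), of j] by auto
qed (use assms in auto)

lemma mat_mult_vec_sum:
  assumes "A \<in> carrier_mat r c" "v \<in> carrier_vec c" "i < r"
  shows "(A *\<^sub>v v) $ i = (\<Sum>j<c. A $$ (i,j) * v $ j)"
  using assms by (auto simp: scalar_prod_def atLeast0LessThan intro!: sum.cong)

lemma scalar_prod_mat_transpose:
  fixes A :: "real mat"
  assumes "A \<in> carrier_mat n k" "v \<in> carrier_vec k" "l \<in> carrier_vec n"
  shows "l \<bullet> (A *\<^sub>v v) = (A\<^sup>T *\<^sub>v l) \<bullet> v"
  using transpose_vec_mult_scalar[OF assms] assms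
  by (metis comm_scalar_prod mult_mat_vec_carrier transpose_carrier_mat)

definition vec_subspace :: "nat \<Rightarrow> real vec set \<Rightarrow> bool" where
  "vec_subspace n W \<longleftrightarrow> W \<subseteq> carrier_vec n \<and> 0\<^sub>v n \<in> W \<and>
     (\<forall>x\<in>W. \<forall>y\<in>W. x + y \<in> W) \<and> (\<forall>c. \<forall>x\<in>W. c \<cdot>\<^sub>v x \<in> W)"

text \<open>
  A maximal independent subset of \<open>W\<close> spans it; its vectors are the columns of \<open>M\<close>. The point is the
  strict inequality \<open>r < n\<close> for proper subspaces, which makes state space reductions decrease the dimension.
\<close>

lemma vec_subspace_range:
  assumes W: "vec_subspace n W"
  obtains r M where "M \<in> carrier_mat n r" "W = (\<lambda>x. M *\<^sub>v x) ` carrier_vec r"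
    "W \<noteq> carrier_vec n \<Longrightarrow> r < n"
proof -
  interpret vec_space "TYPE(real)" n .
  have sub: "submodule class_ring W V"
    using W unfolding vec_subspace_def submodule_def
    using vec_module by (auto simp: module_vec_simps class_ring_simps)
  let ?P = "\<lambda>k. \<exists>S. S \<subseteq> W \<and> lin_indpt S \<and> finite S \<and> card S = k"
  have "?P 0" using finite_lin_indpt2[of "{}"] by (intro exI[of _ "{}"]) auto
  have bound: "k \<le> n" if "?P k" for k
    using that li_le_dim(2)[OF fin_dim] dim_is_n W unfolding vec_subspace_def by (metis carrier_vec_def order_trans cV)
  define r where "r = (GREATEST k. ?P k)"
  have "?P r" unfolding r_def by (rule GreatestI_nat[where b=n]) (use \<open>?P 0\<close> bound in auto)
  then obtain S where S: "S \<subseteq> W" "lin_indpt S" "finite S" "card S = r" by blast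
  have Sc: "S \<subseteq> carrier_vec n" using S W unfolding vec_subspace_def by auto
  have "W \<subseteq> span S"
  proof
    fix w assume w: "w \<in> W"
    show "w \<in> span S"
    proof (rule ccontr)
      assume nw: "w \<notin> span S"
      have wc: "w \<in> carrier_vec n" using w W unfolding vec_subspace_def by auto
      have "w \<notin> S" using nw in_own_span[OF Sc] by auto
      moreover have "lin_indpt (S \<union> {w})"
        using lin_dep_iff_in_span[OF Sc S(2) wc \<open>w \<notin> S\<close>] nw by auto
      ultimately have "?P (Suc r)" using S w by (intro exI[of _ "S \<union> {w}"]) auto
      then have "Suc r \<le> r" unfolding r_def by (rule Greatest_le_nat[where b=n]) (use bound in auto)
      then show False by simp
    qed
  qed
  moreover have "span S \<subseteq> W" using span_is_subset[OF S(1) sub] .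
  ultimately have span: "W = span S" by auto
  obtain xs where xs: "set xs = S" "length xs = r"
    using S by (metis distinct_card finite_distinct_list)
  define M where "M = mat_of_cols n xs"
  have M: "M \<in> carrier_mat n r" unfolding M_def using xs by auto
  have "cols M = xs" unfolding M_def using xs Sc by auto
  then have "W = (\<lambda>x. M *\<^sub>v x) ` carrier_vec r"
    using col_space_eq[of M] M unfolding col_space_def span xs by (auto simp: xs)
  moreover have "r < n" if "W \<noteq> carrier_vec n"
  proof (rule ccontr)
    assume "\<not> r < n"
    then have "r = n" using bound[OF \<open>?P r\<close>] by simp
    then have "basis S" using dim_li_is_basis[OF fin_dim S(3) Sc S(2)] S(4) dim_is_n by simp
    then show False using that span unfolding basis_def by auto
  qed
  ultimately show thesis using that M by blast
qed

lemma factor_through_range: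
  fixes M Y :: "real mat"
  assumes M: "M \<in> carrier_mat n r" and Y: "Y \<in> carrier_mat n k"
    and sub: "\<And>v. v \<in> carrier_vec k \<Longrightarrow> Y *\<^sub>v v \<in> (\<lambda>x. M *\<^sub>v x) ` carrier_vec r"
  obtains Z where "Z \<in> carrier_mat r k" "M * Z = Y"
proof -
  have "\<exists>z\<in>carrier_vec r. M *\<^sub>v z = col Y j" if "j < k" for j
    using sub[of "unit_vec k j"] Y that mat_mult_unit_vec[OF Y that] by auto
  then obtain z where z: "\<And>j. j < k \<Longrightarrow> z j \<in> carrier_vec r \<and> M *\<^sub>v z j = col Y j"
    by metis
  define Z where "Z = mat r k (\<lambda>(i,j). z j $ i)"
  have Z: "Z \<in> carrier_mat r k" unfolding Z_def by simp
  have cz: "col Z j = z j" if "j < k" for j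
    using z[OF that] that unfolding Z_def by (intro eq_vecI) auto
  have "M * Z = Y"
  proof (rule mat_col_eqI)
    fix j assume "j < dim_col Y"
    then have j: "j < k" using Y by simp
    show "col (M * Z) j = col Y j"
      by (simp only: col_mult2[OF M Z j] cz[OF j] z[OF j])
  qed (use M Z Y in auto)
  with Z show thesis using that by blast
qed

lemma matrix_family_entry_bound:
  fixes M :: "nat \<Rightarrow> real mat"
  obtains K where "K \<ge> 0" "\<And>c i j. c \<in> {1..D} \<Longrightarrow> i < n \<Longrightarrow> j < k \<Longrightarrow> \<bar>M c $$ (i,j)\<bar> \<le> K"
proof -
  let ?F = "insert 0 ((\<lambda>(c,i,j). \<bar>M c $$ (i,j)\<bar>) ` ({1..D} \<times> {..<n} \<times> {..<k}))"
  have fin: "finite ?F" by simp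
  show thesis
  proof (rule that[of "Max ?F"])
    show "0 \<le> Max ?F" using fin by (intro Max_ge) auto
    fix c i j assume "c \<in> {1..D}" "i < n" "j < k"
    then show "\<bar>M c $$ (i,j)\<bar> \<le> Max ?F" using fin by (intro Max_ge) force+
  qed
qed

section \<open>Irreducible systems\<close>

lemma is_lssD:
  assumes "is_lss D m p S" "q \<in> {1..D}"
  shows "Amat S q \<in> carrier_mat (sdim S) (sdim S)" "Bmat S q \<in> carrier_mat (sdim S) m" "Cmat S q \<in> carrier_mat p (sdim S)"
  using assms unfolding is_lss_def by auto

text \<open>
  Morphisms of systems: \<open>K\<close> maps state trajectories of \<open>S\<close> to state trajectories of \<open>S'\<close> with the same
  output. Inclusions of reachable parts and projections along unobservable parts are both of this kind.
\<close>

definition intertwines :: "nat \<Rightarrow> lss \<Rightarrow> lss \<Rightarrow> real mat \<Rightarrow> bool" where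
  "intertwines D S S' K \<longleftrightarrow> K \<in> carrier_mat (sdim S') (sdim S) \<and>
     (\<forall>q\<in>{1..D}. K * Amat S q = Amat S' q * K \<and> K * Bmat S q = Bmat S' q
               \<and> Cmat S q = Cmat S' q * K)"

text \<open>
  The consequence of minimality that the structure theory uses. It does not mention trajectories and
  is therefore common to both time axes.
\<close>

definition irreducible_lss :: "nat \<Rightarrow> nat \<Rightarrow> nat \<Rightarrow> lss \<Rightarrow> bool" where
  "irreducible_lss D m p S \<longleftrightarrow> is_lss D m p S \<and>
     (\<forall>S' K. is_lss D m p S' \<longrightarrow> intertwines D S S' K \<or> intertwines D S' S K \<longrightarrow> sdim S \<le> sdim S')"

text \<open>
  Reachability, stated dually. The annihilator \<open>W\<close> of \<open>U\<close> is invariant under all \<open>A\<close> and contains the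
  ranges of all \<open>B\<close>. If \<open>U\<close> contains a nonzero vector, \<open>W\<close> is proper, and restricting the system to \<open>W\<close>
  (in the coordinates given by a matrix \<open>M\<close> with range \<open>W\<close>) gives a smaller intertwined system.
\<close>

lemma irreducible_reachable:
  assumes irr: "irreducible_lss D m p S"
    and U: "U \<subseteq> carrier_vec (sdim S)"
    and UA: "\<And>q l. q \<in> {1..D} \<Longrightarrow> l \<in> U \<Longrightarrow> (Amat S q)\<^sup>T *\<^sub>v l \<in> U"
    and UB: "\<And>q l. q \<in> {1..D} \<Longrightarrow> l \<in> U \<Longrightarrow> (Bmat S q)\<^sup>T *\<^sub>v l = 0\<^sub>v m"
  shows "U \<subseteq> {0\<^sub>v (sdim S)}"
proof (rule ccontr)
  let ?n = "sdim S"
  assume "\<not> ?thesis"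
  then obtain l where l: "l \<in> U" "l \<noteq> 0\<^sub>v ?n" by blast
  define W where "W = {x \<in> carrier_vec ?n. \<forall>l\<in>U. l \<bullet> x = 0}"
  have sys: "Amat S q \<in> carrier_mat ?n ?n" "Bmat S q \<in> carrier_mat ?n m" "Cmat S q \<in> carrier_mat p ?n"
    if "q \<in> {1..D}" for q
    using irr that unfolding irreducible_lss_def is_lss_def by auto
  have "vec_subspace ?n W"
    unfolding vec_subspace_def W_def using U
    by (auto simp: scalar_prod_add_distrib[where n="?n"] subset_iff)
  moreover have "l \<bullet> l \<noteq> 0"
    using l U conjugate_square_eq_0_vec[of l ?n] by (auto simp: conjugate_vec_def)
  then have "W \<noteq> carrier_vec ?n" using l U unfolding W_def by auto
  ultimately obtain r M where M: "M \<in> carrier_mat ?n r" "W = (\<lambda>x. M *\<^sub>v x) ` carrier_vec r" "r < ?n"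
    using vec_subspace_range by metis
  have Mv: "M *\<^sub>v v \<in> W" if "v \<in> carrier_vec r" for v using M that by auto
  have AW: "Amat S q *\<^sub>v x \<in> W" if "q \<in> {1..D}" "x \<in> W" for q x
    using that sys[OF that(1)] U UA[OF that(1)] unfolding W_def
    by (auto simp: scalar_prod_mat_transpose subset_iff)
  have BW: "Bmat S q *\<^sub>v x \<in> W" if "q \<in> {1..D}" "x \<in> carrier_vec m" for q x
    using that sys[OF that(1)] U UB[OF that(1)] unfolding W_def
    by (auto simp: scalar_prod_mat_transpose subset_iff)
  have "\<exists>Z. Z \<in> carrier_mat r r \<and> M * Z = Amat S q * M" if q: "q \<in> {1..D}" for q
    by (rule factor_through_range[OF M(1), of "Amat S q * M" r])
      (use sys[OF q] M AW[OF q] Mv in auto)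
  then obtain A' where A': "\<And>q. q \<in> {1..D} \<Longrightarrow> A' q \<in> carrier_mat r r \<and> M * A' q = Amat S q * M"
    by metis
  have "\<exists>Z. Z \<in> carrier_mat r m \<and> M * Z = Bmat S q" if q: "q \<in> {1..D}" for q
    by (rule factor_through_range[OF M(1), of "Bmat S q" m])
      (use sys[OF q] M BW[OF q] in auto)
  then obtain B' where B': "\<And>q. q \<in> {1..D} \<Longrightarrow> B' q \<in> carrier_mat r m \<and> M * B' q = Bmat S q"
    by metis
  define S' where "S' = \<lparr>sdim = r, Amat = A', Bmat = B', Cmat = (\<lambda>q. Cmat S q * M)\<rparr>"
  have "is_lss D m p S'" unfolding is_lss_def S'_def using A' B' mult_carrier_mat[OF sys(3) M(1)] by auto
  moreover have "intertwines D S' S M" unfolding intertwines_def S'_def using A' B' M by auto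
  ultimately have "?n \<le> r" using irr unfolding irreducible_lss_def S'_def by fastforce
  with M(3) show False by simp
qed

text \<open>
  Observability, stated dually. If \<open>W\<close> is proper, its annihilator is a nonzero space of unobservable
  states, which can be divided out; with \<open>W\<close> the range of \<open>M\<close>, the quotient map is \<open>M\<^sup>T\<close>.
\<close>

lemma irreducible_observable:
  assumes irr: "irreducible_lss D m p S"
    and W: "vec_subspace (sdim S) W"
    and AW: "\<And>q l. q \<in> {1..D} \<Longrightarrow> l \<in> W \<Longrightarrow> (Amat S q)\<^sup>T *\<^sub>v l \<in> W"
    and CW: "\<And>q c. q \<in> {1..D} \<Longrightarrow> c \<in> carrier_vec p \<Longrightarrow> (Cmat S q)\<^sup>T *\<^sub>v c \<in> W"
  shows "W = carrier_vec (sdim S)"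
proof (rule ccontr)
  let ?n = "sdim S"
  assume "\<not> ?thesis"
  then obtain r M where M: "M \<in> carrier_mat ?n r" "W = (\<lambda>x. M *\<^sub>v x) ` carrier_vec r" "r < ?n"
    using vec_subspace_range[OF W] by metis
  have sys: "Amat S q \<in> carrier_mat ?n ?n" "Bmat S q \<in> carrier_mat ?n m" "Cmat S q \<in> carrier_mat p ?n"
    if "q \<in> {1..D}" for q
    using irr that unfolding irreducible_lss_def is_lss_def by auto
  have Mv: "M *\<^sub>v v \<in> W" if "v \<in> carrier_vec r" for v using M that by auto
  have "\<exists>Z. Z \<in> carrier_mat r r \<and> M * Z = (Amat S q)\<^sup>T * M" if q: "q \<in> {1..D}" for q
    by (rule factor_through_range[OF M(1), of "(Amat S q)\<^sup>T * M" r])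
      (use sys[OF q] M AW[OF q] Mv in auto)
  then obtain A' where A': "\<And>q. q \<in> {1..D} \<Longrightarrow> A' q \<in> carrier_mat r r \<and> M * A' q = (Amat S q)\<^sup>T * M"
    by metis
  have "\<exists>Z. Z \<in> carrier_mat r p \<and> M * Z = (Cmat S q)\<^sup>T" if q: "q \<in> {1..D}" for q
    by (rule factor_through_range[OF M(1), of "(Cmat S q)\<^sup>T" p])
      (use sys[OF q] M CW[OF q] in auto)
  then obtain C' where C': "\<And>q. q \<in> {1..D} \<Longrightarrow> C' q \<in> carrier_mat r p \<and> M * C' q = (Cmat S q)\<^sup>T"
    by metis
  define S' where "S' = \<lparr>sdim = r, Amat = (\<lambda>q. (A' q)\<^sup>T), Bmat = (\<lambda>q. M\<^sup>T * Bmat S q), Cmat = (\<lambda>q. (C' q)\<^sup>T)\<rparr>"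
  have "is_lss D m p S'" unfolding is_lss_def S'_def using A' C' sys M by auto
  moreover have "intertwines D S S' M\<^sup>T" unfolding intertwines_def S'_def
  proof (intro conjI ballI)
    fix q assume q: "q \<in> {1..D}"
    have "M\<^sup>T * Amat S q = ((Amat S q)\<^sup>T * M)\<^sup>T"
      using transpose_mult[of "(Amat S q)\<^sup>T" ?n ?n M r] sys[OF q] M by auto
    also have "\<dots> = (A' q)\<^sup>T * M\<^sup>T" using A'[OF q] M transpose_mult[of M ?n r "A' q" r] by auto
    finally show "M\<^sup>T * Amat S q = Amat \<lparr>sdim = r, Amat = (\<lambda>q. (A' q)\<^sup>T), Bmat = (\<lambda>q. M\<^sup>T * Bmat S q), Cmat = (\<lambda>q. (C' q)\<^sup>T)\<rparr> q * M\<^sup>T" by simp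
    have "Cmat S q = ((Cmat S q)\<^sup>T)\<^sup>T" by simp
    also have "\<dots> = (C' q)\<^sup>T * M\<^sup>T" using C'[OF q] M transpose_mult[of M ?n r "C' q" p] by metis
    finally show "Cmat S q = Cmat \<lparr>sdim = r, Amat = (\<lambda>q. (A' q)\<^sup>T), Bmat = (\<lambda>q. M\<^sup>T * Bmat S q), Cmat = (\<lambda>q. (C' q)\<^sup>T)\<rparr> q * M\<^sup>T" by simp
  qed (use M in auto)
  ultimately have "?n \<le> r" using irr unfolding irreducible_lss_def S'_def by fastforce
  with M(3) show False by simp
qed

section \<open>Dual bisimulations\<close>

text \<open>
  The typical example is the graph of the dual of an isomorphism. A relation, unlike a map, is available
  before totality and functionality are known.
\<close>

definition dual_bisimulation ::
    "nat \<Rightarrow> nat \<Rightarrow> lss \<Rightarrow> lss \<Rightarrow> (real vec \<Rightarrow> real vec \<Rightarrow> bool) \<Rightarrow> bool" where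
  "dual_bisimulation D p S S' N \<longleftrightarrow>
     (\<forall>x y. N x y \<longrightarrow> x \<in> carrier_vec (sdim S) \<and> y \<in> carrier_vec (sdim S')) \<and>
     N (0\<^sub>v (sdim S)) (0\<^sub>v (sdim S')) \<and>
     (\<forall>x y x' y'. N x y \<longrightarrow> N x' y' \<longrightarrow> N (x + x') (y + y')) \<and>
     (\<forall>c x y. N x y \<longrightarrow> N (c \<cdot>\<^sub>v x) (c \<cdot>\<^sub>v y)) \<and>
     (\<forall>q\<in>{1..D}.
        (\<forall>x y. N x y \<longrightarrow> N ((Amat S q)\<^sup>T *\<^sub>v x) ((Amat S' q)\<^sup>T *\<^sub>v y)
                      \<and> (Bmat S q)\<^sup>T *\<^sub>v x = (Bmat S' q)\<^sup>T *\<^sub>v y) \<and>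
        (\<forall>c\<in>carrier_vec p. N ((Cmat S q)\<^sup>T *\<^sub>v c) ((Cmat S' q)\<^sup>T *\<^sub>v c)))"

lemma dual_bisimulationI:
  assumes "\<And>x y. N x y \<Longrightarrow> x \<in> carrier_vec (sdim S) \<and> y \<in> carrier_vec (sdim S')"
    and "N (0\<^sub>v (sdim S)) (0\<^sub>v (sdim S'))"
    and "\<And>x y x' y'. N x y \<Longrightarrow> N x' y' \<Longrightarrow> N (x + x') (y + y')"
    and "\<And>c x y. N x y \<Longrightarrow> N (c \<cdot>\<^sub>v x) (c \<cdot>\<^sub>v y)"
    and "\<And>q x y. q \<in> {1..D} \<Longrightarrow> N x y \<Longrightarrow> N ((Amat S q)\<^sup>T *\<^sub>v x) ((Amat S' q)\<^sup>T *\<^sub>v y)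
        \<and> (Bmat S q)\<^sup>T *\<^sub>v x = (Bmat S' q)\<^sup>T *\<^sub>v y"
    and "\<And>q c. q \<in> {1..D} \<Longrightarrow> c \<in> carrier_vec p \<Longrightarrow> N ((Cmat S q)\<^sup>T *\<^sub>v c) ((Cmat S' q)\<^sup>T *\<^sub>v c)"
  shows "dual_bisimulation D p S S' N"
  using assms unfolding dual_bisimulation_def by simp

lemma dual_bisimulation_converse:
  "dual_bisimulation D p S S' N \<Longrightarrow> dual_bisimulation D p S' S (\<lambda>y x. N x y)"
  unfolding dual_bisimulation_def by auto

text \<open>
  The vectors related to \<open>0\<close> form a set to which reachability of \<open>S'\<close> applies, so only \<open>0\<close> is related
  to \<open>0\<close>; linearity does the rest.
\<close>

lemma dual_bisimulation_functional:
  assumes irr: "irreducible_lss D m p S'" and lss: "is_lss D m p S"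
    and N: "dual_bisimulation D p S S' N" and xy: "N x y" "N x y'"
  shows "y = y'"
proof -
  let ?U = "{y. N (0\<^sub>v (sdim S)) y}"
  have carr: "\<And>x y. N x y \<Longrightarrow> x \<in> carrier_vec (sdim S) \<and> y \<in> carrier_vec (sdim S')"
    and add: "\<And>x y x' y'. N x y \<Longrightarrow> N x' y' \<Longrightarrow> N (x + x') (y + y')"
    and smult: "\<And>c x y. N x y \<Longrightarrow> N (c \<cdot>\<^sub>v x) (c \<cdot>\<^sub>v y)"
    and AB: "\<And>q x y. q \<in> {1..D} \<Longrightarrow> N x y \<Longrightarrow> N ((Amat S q)\<^sup>T *\<^sub>v x) ((Amat S' q)\<^sup>T *\<^sub>v y)
                      \<and> (Bmat S q)\<^sup>T *\<^sub>v x = (Bmat S' q)\<^sup>T *\<^sub>v y"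
    using N unfolding dual_bisimulation_def by auto
  have zero: "(Amat S q)\<^sup>T *\<^sub>v 0\<^sub>v (sdim S) = 0\<^sub>v (sdim S)" "(Bmat S q)\<^sup>T *\<^sub>v 0\<^sub>v (sdim S) = 0\<^sub>v m"
    if "q \<in> {1..D}" for q
    using lss that unfolding is_lss_def by (fastforce intro!: eq_vecI simp: scalar_prod_def)+
  have "?U \<subseteq> {0\<^sub>v (sdim S')}"
    by (rule irreducible_reachable[OF irr]) (use carr AB zero in \<open>auto, metis+\<close>)
  moreover have "N (x + (-1) \<cdot>\<^sub>v x) (y + (-1) \<cdot>\<^sub>v y')" using add smult xy by blast
  moreover have "x + (-1) \<cdot>\<^sub>v x = 0\<^sub>v (sdim S)" using carr[OF xy(1)] by auto
  ultimately have *: "y + (-1) \<cdot>\<^sub>v y' = 0\<^sub>v (sdim S')" by auto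
  show ?thesis
  proof (rule eq_vecI)
    fix i assume i: "i < dim_vec y'"
    have "(y + (-1) \<cdot>\<^sub>v y') $ i = 0" using * i carr[OF xy(2)] by auto
    then show "y $ i = y' $ i" using i carr[OF xy(2)] by auto
  qed (use carr[OF xy(1)] carr[OF xy(2)] in auto)
qed

text \<open>
  The domain of \<open>N\<close> is a subspace to which observability of \<open>S\<close> applies.
\<close>

lemma dual_bisimulation_total:
  assumes irr: "irreducible_lss D m p S" and N: "dual_bisimulation D p S S' N"
    and x: "x \<in> carrier_vec (sdim S)"
  shows "\<exists>y. N x y"
proof -
  have "{x. \<exists>y. N x y} = carrier_vec (sdim S)"
    by (rule irreducible_observable[OF irr])
      (use N in \<open>unfold dual_bisimulation_def vec_subspace_def, blast+\<close>)
  with x show ?thesis by auto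
qed

text \<open>
  A linear selection from \<open>N\<close>, obtained by choosing partners of the unit vectors.
\<close>

lemma dual_bisimulation_matrix:
  assumes irr: "irreducible_lss D m p S" and N: "dual_bisimulation D p S S' N"
  obtains X where "X \<in> carrier_mat (sdim S') (sdim S)"
    "\<And>x. x \<in> carrier_vec (sdim S) \<Longrightarrow> N x (X *\<^sub>v x)"
proof -
  let ?n = "sdim S" and ?n' = "sdim S'"
  have carr: "\<And>x y. N x y \<Longrightarrow> x \<in> carrier_vec (sdim S) \<and> y \<in> carrier_vec (sdim S')"
    and add: "\<And>x y x' y'. N x y \<Longrightarrow> N x' y' \<Longrightarrow> N (x + x') (y + y')"
    and smult: "\<And>c x y. N x y \<Longrightarrow> N (c \<cdot>\<^sub>v x) (c \<cdot>\<^sub>v y)"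
    and zero: "N (0\<^sub>v ?n) (0\<^sub>v ?n')"
    using N unfolding dual_bisimulation_def by auto
  obtain y where y: "\<And>j. j < ?n \<Longrightarrow> N (unit_vec ?n j) (y j)"
    using dual_bisimulation_total[OF irr N unit_vec_carrier] by metis
  define X where "X = mat ?n' ?n (\<lambda>(i,j). y j $ i)"
  have X: "X \<in> carrier_mat ?n' ?n" unfolding X_def by simp
  have colX: "X *\<^sub>v unit_vec ?n j = y j" if "j < ?n" for j
    using mat_mult_unit_vec[OF X that] carr[OF y[OF that]] that unfolding X_def
    by (intro eq_vecI) auto
  have "N x (X *\<^sub>v x)" if x: "x \<in> carrier_vec ?n" for x
  proof -
    \<comment> \<open>Truncations of \<open>x\<close>, to build it up from unit vectors by induction.\<close>
    let ?t = "\<lambda>k. vec ?n (\<lambda>i. if i < k then x $ i else 0)"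
    have "k \<le> ?n \<Longrightarrow> N (?t k) (X *\<^sub>v ?t k)" for k
    proof (induction k)
      case 0
      have "?t 0 = 0\<^sub>v ?n" by auto
      moreover have "X *\<^sub>v 0\<^sub>v ?n = 0\<^sub>v ?n'" using X by (intro eq_vecI) (auto simp: scalar_prod_def)
      ultimately show ?case using zero by simp
    next
      case (Suc k)
      have eq: "?t (Suc k) = ?t k + x $ k \<cdot>\<^sub>v unit_vec ?n k"
        using Suc.prems by (intro eq_vecI) (auto simp: unit_vec_def less_Suc_eq)
      have "X *\<^sub>v ?t (Suc k) = X *\<^sub>v ?t k + x $ k \<cdot>\<^sub>v y k"
        unfolding eq using X Suc.prems colX
        by (subst mult_add_distrib_mat_vec[OF X]) (auto simp: mult_mat_vec[OF X])
      then show ?case using Suc y unfolding eq by (auto intro!: add smult)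
    qed
    moreover have "?t ?n = x" using x by (intro eq_vecI) auto
    ultimately show ?thesis by (metis le_refl)
  qed
  with X show thesis using that by blast
qed

text \<open>
  Between irreducible systems \<open>N\<close> is total and functional in both directions, hence the graph of an
  invertible \<open>X\<close>. Since \<open>N\<close> lives on functionals, the isomorphism of the systems themselves is the
  transpose, and it points the other way.
\<close>

theorem irreducible_isomorphic:
  assumes irr: "irreducible_lss D m p S" "irreducible_lss D m p S'"
    and N: "dual_bisimulation D p S S' N"
  obtains K L where "intertwines D S S' K" "intertwines D S' S L"
    "K * L = 1\<^sub>m (sdim S')" "L * K = 1\<^sub>m (sdim S)" "sdim S' = sdim S"
proof -
  let ?n = "sdim S" and ?n' = "sdim S'"
  have N': "dual_bisimulation D p S' S (\<lambda>y x. N x y)"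
    using dual_bisimulation_converse[OF N] .
  have lss: "is_lss D m p S" "is_lss D m p S'" using irr unfolding irreducible_lss_def by auto
  have iso: "\<exists>X. X \<in> carrier_mat (sdim S2) (sdim S1) \<and> (\<forall>x\<in>carrier_vec (sdim S1). N x (X *\<^sub>v x)) \<and>
      intertwines D S2 S1 X\<^sup>T"
    if irr1: "irreducible_lss D m p S1" and irr2: "irreducible_lss D m p S2"
      and N: "dual_bisimulation D p S1 S2 N" for S1 S2 N
  proof -
    let ?n1 = "sdim S1" and ?n2 = "sdim S2"
    have lss: "is_lss D m p S1" "is_lss D m p S2" using irr1 irr2 unfolding irreducible_lss_def by auto
    obtain X where X: "X \<in> carrier_mat ?n2 ?n1" and NX: "\<And>x. x \<in> carrier_vec ?n1 \<Longrightarrow> N x (X *\<^sub>v x)"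
      using dual_bisimulation_matrix[OF irr1 N] by blast
    have fn: "y = y'" if "N x y" "N x y'" for x y y'
      using dual_bisimulation_functional[OF irr2 lss(1) N that] .
    have "intertwines D S2 S1 X\<^sup>T" unfolding intertwines_def
    proof (intro conjI ballI)
      fix q assume q: "q \<in> {1..D}"
      have sys: "Amat S1 q \<in> carrier_mat ?n1 ?n1" "Bmat S1 q \<in> carrier_mat ?n1 m" "Cmat S1 q \<in> carrier_mat p ?n1"
        "Amat S2 q \<in> carrier_mat ?n2 ?n2" "Bmat S2 q \<in> carrier_mat ?n2 m" "Cmat S2 q \<in> carrier_mat p ?n2"
        using lss q unfolding is_lss_def by auto
      have rel: "N ((Amat S1 q)\<^sup>T *\<^sub>v x) ((Amat S2 q)\<^sup>T *\<^sub>v y)" "(Bmat S1 q)\<^sup>T *\<^sub>v x = (Bmat S2 q)\<^sup>T *\<^sub>v y"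
        if "N x y" for x y using N q that unfolding dual_bisimulation_def by auto
      have relC: "N ((Cmat S1 q)\<^sup>T *\<^sub>v c) ((Cmat S2 q)\<^sup>T *\<^sub>v c)" if "c \<in> carrier_vec p" for c
        using N q that unfolding dual_bisimulation_def by auto
      have A: "(Amat S2 q)\<^sup>T * X = X * (Amat S1 q)\<^sup>T"
      proof (rule mat_eqI_vec[of _ ?n2 ?n1])
        fix v :: "real vec" assume v: "v \<in> carrier_vec ?n1"
        have "(Amat S1 q)\<^sup>T *\<^sub>v v \<in> carrier_vec ?n1" using sys v by auto
        from fn[OF rel(1)[OF NX[OF v]] NX[OF this]]
        show "((Amat S2 q)\<^sup>T * X) *\<^sub>v v = (X * (Amat S1 q)\<^sup>T) *\<^sub>v v"
          using sys X v assoc_mult_mat_vec[of "(Amat S2 q)\<^sup>T" ?n2 ?n2 X ?n1 v]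
            assoc_mult_mat_vec[of X ?n2 ?n1 "(Amat S1 q)\<^sup>T" ?n1 v] by auto
      qed (use sys X in auto)
      have B: "(Bmat S1 q)\<^sup>T = (Bmat S2 q)\<^sup>T * X"
      proof (rule mat_eqI_vec[of _ m ?n1])
        fix v :: "real vec" assume v: "v \<in> carrier_vec ?n1"
        from rel(2)[OF NX[OF v]] show "(Bmat S1 q)\<^sup>T *\<^sub>v v = ((Bmat S2 q)\<^sup>T * X) *\<^sub>v v"
          using sys X v assoc_mult_mat_vec[of "(Bmat S2 q)\<^sup>T" m ?n2 X ?n1 v] by auto
      qed (use sys X in auto)
      have C: "(Cmat S2 q)\<^sup>T = X * (Cmat S1 q)\<^sup>T"
      proof (rule mat_eqI_vec[of _ ?n2 p])
        fix c :: "real vec" assume c: "c \<in> carrier_vec p"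
        have "(Cmat S1 q)\<^sup>T *\<^sub>v c \<in> carrier_vec ?n1" using sys c by auto
        from fn[OF relC[OF c] NX[OF this]] show "(Cmat S2 q)\<^sup>T *\<^sub>v c = (X * (Cmat S1 q)\<^sup>T) *\<^sub>v c"
          using sys X c assoc_mult_mat_vec[of X ?n2 ?n1 "(Cmat S1 q)\<^sup>T" p c] by auto
      qed (use sys X in auto)
      show "X\<^sup>T * Amat S2 q = Amat S1 q * X\<^sup>T"
        using arg_cong[OF A, of transpose_mat] sys X
          transpose_mult[of "(Amat S2 q)\<^sup>T" ?n2 ?n2 X ?n1] transpose_mult[of X ?n2 ?n1 "(Amat S1 q)\<^sup>T" ?n1]
        by auto
      show "X\<^sup>T * Bmat S2 q = Bmat S1 q"
        using arg_cong[OF B, of transpose_mat] sys X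
          transpose_mult[of "(Bmat S2 q)\<^sup>T" m ?n2 X ?n1] by auto
      show "Cmat S2 q = Cmat S1 q * X\<^sup>T"
        using arg_cong[OF C, of transpose_mat] sys X
          transpose_mult[of X ?n2 ?n1 "(Cmat S1 q)\<^sup>T" p] by auto
    qed (use X in auto)
    with X NX show ?thesis by blast
  qed
  obtain X where X: "X \<in> carrier_mat ?n' ?n" "\<And>x. x \<in> carrier_vec ?n \<Longrightarrow> N x (X *\<^sub>v x)" "intertwines D S' S X\<^sup>T"
    using iso[OF irr N] by blast
  obtain Y where Y: "Y \<in> carrier_mat ?n ?n'" "\<And>y. y \<in> carrier_vec ?n' \<Longrightarrow> N (Y *\<^sub>v y) y" "intertwines D S S' Y\<^sup>T"
    using iso[OF irr(2,1) N'] by blast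
  have XY: "X * Y = 1\<^sub>m ?n'"
  proof (rule mat_eqI_vec[of _ ?n' ?n'])
    fix v :: "real vec" assume v: "v \<in> carrier_vec ?n'"
    have "Y *\<^sub>v v \<in> carrier_vec ?n" using v Y by auto
    from dual_bisimulation_functional[OF irr(2) lss(1) N X(2)[OF this] Y(2)[OF v]]
    show "(X * Y) *\<^sub>v v = 1\<^sub>m ?n' *\<^sub>v v" using X Y v by auto
  qed (use X Y in auto)
  have YX: "Y * X = 1\<^sub>m ?n"
  proof (rule mat_eqI_vec[of _ ?n ?n])
    fix v :: "real vec" assume v: "v \<in> carrier_vec ?n"
    have "X *\<^sub>v v \<in> carrier_vec ?n'" using v X by auto
    from dual_bisimulation_functional[OF irr(1) lss(2) N' Y(2)[OF this] X(2)[OF v]]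
    show "(Y * X) *\<^sub>v v = 1\<^sub>m ?n *\<^sub>v v" using X Y v by auto
  qed (use X Y in auto)
  have "Y\<^sup>T * X\<^sup>T = 1\<^sub>m ?n'" using transpose_mult[OF X(1) Y(1)] XY by simp
  moreover have "X\<^sup>T * Y\<^sup>T = 1\<^sub>m ?n" using transpose_mult[OF Y(1) X(1)] YX by simp
  moreover have "?n' = ?n"
    using irr X(3) Y(3) lss unfolding irreducible_lss_def by (metis le_antisym)
  ultimately show thesis using that X Y by blast
qed

text \<open>
  \<open>Z\<close> stands for the pairs of simultaneously reached states. The step hypothesis says that functionals
  agreeing on \<open>Z\<close> still agree on the successor (or, in continuous time, on the velocity) of a pair in
  \<open>Z\<close> for every mode and input value; \<open>v = 0\<close> isolates the \<open>A\<close> part, and the pair \<open>(0, 0)\<close> the \<open>B\<close> part.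
\<close>

lemma annihilator_dual_bisimulation:
  assumes lss: "is_lss D m p S" "is_lss D m p S'"
    and carr: "\<And>x x'. (x,x') \<in> Z \<Longrightarrow> x \<in> carrier_vec (sdim S) \<and> x' \<in> carrier_vec (sdim S')"
    and zero: "(0\<^sub>v (sdim S), 0\<^sub>v (sdim S')) \<in> Z"
    and out: "\<And>x x' q. (x,x') \<in> Z \<Longrightarrow> q \<in> {1..D} \<Longrightarrow> Cmat S q *\<^sub>v x = Cmat S' q *\<^sub>v x'"
    and step: "\<And>l l' x x' q v. l \<in> carrier_vec (sdim S) \<Longrightarrow> l' \<in> carrier_vec (sdim S') \<Longrightarrow>
        (\<And>y y'. (y,y') \<in> Z \<Longrightarrow> l \<bullet> y = l' \<bullet> y') \<Longrightarrow> (x,x') \<in> Z \<Longrightarrow> q \<in> {1..D} \<Longrightarrow> v \<in> carrier_vec m \<Longrightarrow>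
        l \<bullet> (Amat S q *\<^sub>v x + Bmat S q *\<^sub>v v) = l' \<bullet> (Amat S' q *\<^sub>v x' + Bmat S' q *\<^sub>v v)"
  shows "dual_bisimulation D p S S' (\<lambda>l l'. l \<in> carrier_vec (sdim S) \<and> l' \<in> carrier_vec (sdim S') \<and>
      (\<forall>(x,x')\<in>Z. l \<bullet> x = l' \<bullet> x'))"
    (is "dual_bisimulation D p S S' ?N")
proof -
  have N: "?N l l' \<longleftrightarrow> l \<in> carrier_vec (sdim S) \<and> l' \<in> carrier_vec (sdim S') \<and> (\<forall>x x'. (x,x') \<in> Z \<longrightarrow> l \<bullet> x = l' \<bullet> x')" for l l'
    by auto
  have A: "?N ((Amat S q)\<^sup>T *\<^sub>v l) ((Amat S' q)\<^sup>T *\<^sub>v l') \<and> (Bmat S q)\<^sup>T *\<^sub>v l = (Bmat S' q)\<^sup>T *\<^sub>v l'"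
    if q: "q \<in> {1..D}" and ll: "?N l l'" for q l l'
  proof -
    have sys: "Amat S q \<in> carrier_mat (sdim S) (sdim S)" "Bmat S q \<in> carrier_mat (sdim S) m"
      "Amat S' q \<in> carrier_mat (sdim S') (sdim S')" "Bmat S' q \<in> carrier_mat (sdim S') m"
      using lss q unfolding is_lss_def by auto
    have lc: "l \<in> carrier_vec (sdim S)" "l' \<in> carrier_vec (sdim S')"
      and lZ: "\<And>y y'. (y,y') \<in> Z \<Longrightarrow> l \<bullet> y = l' \<bullet> y'" using ll unfolding N by blast+
    have key: "((Amat S q)\<^sup>T *\<^sub>v l) \<bullet> x + ((Bmat S q)\<^sup>T *\<^sub>v l) \<bullet> v = ((Amat S' q)\<^sup>T *\<^sub>v l') \<bullet> x' + ((Bmat S' q)\<^sup>T *\<^sub>v l') \<bullet> v"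
      if x: "(x,x') \<in> Z" and v: "v \<in> carrier_vec m" for x x' v
    proof -
      have c: "x \<in> carrier_vec (sdim S)" "x' \<in> carrier_vec (sdim S')" using carr[OF x] by auto
      have "l \<bullet> (Amat S q *\<^sub>v x + Bmat S q *\<^sub>v v) = ((Amat S q)\<^sup>T *\<^sub>v l) \<bullet> x + ((Bmat S q)\<^sup>T *\<^sub>v l) \<bullet> v"
        using scalar_prod_add_distrib[OF lc(1) mult_mat_vec_carrier[OF sys(1) c(1)] mult_mat_vec_carrier[OF sys(2) v]]
          scalar_prod_mat_transpose[OF sys(1) c(1) lc(1)] scalar_prod_mat_transpose[OF sys(2) v lc(1)] by simp
      moreover have "l' \<bullet> (Amat S' q *\<^sub>v x' + Bmat S' q *\<^sub>v v) = ((Amat S' q)\<^sup>T *\<^sub>v l') \<bullet> x' + ((Bmat S' q)\<^sup>T *\<^sub>v l') \<bullet> v"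
        using scalar_prod_add_distrib[OF lc(2) mult_mat_vec_carrier[OF sys(3) c(2)] mult_mat_vec_carrier[OF sys(4) v]]
          scalar_prod_mat_transpose[OF sys(3) c(2) lc(2)] scalar_prod_mat_transpose[OF sys(4) v lc(2)] by simp
      ultimately show ?thesis using step[OF lc lZ x q v] by simp
    qed
    have Bc: "(Bmat S q)\<^sup>T *\<^sub>v l \<in> carrier_vec m" "(Bmat S' q)\<^sup>T *\<^sub>v l' \<in> carrier_vec m"
      and Ac: "(Amat S q)\<^sup>T *\<^sub>v l \<in> carrier_vec (sdim S)" "(Amat S' q)\<^sup>T *\<^sub>v l' \<in> carrier_vec (sdim S')"
      using sys lc by auto
    have "((Amat S q)\<^sup>T *\<^sub>v l) \<bullet> x = ((Amat S' q)\<^sup>T *\<^sub>v l') \<bullet> x'" if x: "(x,x') \<in> Z" for x x'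
      using key[OF x zero_carrier_vec] Bc by simp
    moreover have "(Bmat S q)\<^sup>T *\<^sub>v l = (Bmat S' q)\<^sup>T *\<^sub>v l'"
    proof (rule eq_vecI)
      fix i assume "i < dim_vec ((Bmat S' q)\<^sup>T *\<^sub>v l')"
      then have i: "i < m" using Bc(2) by (simp only: carrier_vecD)
      show "((Bmat S q)\<^sup>T *\<^sub>v l) $ i = ((Bmat S' q)\<^sup>T *\<^sub>v l') $ i"
        using key[OF zero unit_vec_carrier, of i] Ac Bc i
        by (simp add: scalar_prod_right_unit[OF i])
    qed (simp only: carrier_vecD[OF Bc(1)] carrier_vecD[OF Bc(2)])
    ultimately show ?thesis unfolding N using Ac by blast
  qed
  have C: "?N ((Cmat S q)\<^sup>T *\<^sub>v c) ((Cmat S' q)\<^sup>T *\<^sub>v c)" if q: "q \<in> {1..D}" and c: "c \<in> carrier_vec p" for q c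
  proof -
    have sys: "Cmat S q \<in> carrier_mat p (sdim S)" "Cmat S' q \<in> carrier_mat p (sdim S')"
      using lss q unfolding is_lss_def by auto
    have "((Cmat S q)\<^sup>T *\<^sub>v c) \<bullet> x = ((Cmat S' q)\<^sup>T *\<^sub>v c) \<bullet> x'" if x: "(x,x') \<in> Z" for x x'
      using scalar_prod_mat_transpose[OF sys(1) _ c, of x] scalar_prod_mat_transpose[OF sys(2) _ c, of x']
        carr[OF x] out[OF x q] by simp
    then show ?thesis unfolding N using sys c by auto
  qed
  have add: "?N (l + k) (l' + k')" if "?N l l'" "?N k k'" for l l' k k'
    unfolding N
  proof (intro conjI allI impI)
    fix x x' assume x: "(x,x') \<in> Z"
    have "l \<bullet> x = l' \<bullet> x'" "k \<bullet> x = k' \<bullet> x'" using that x unfolding N by blast+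
    then show "(l + k) \<bullet> x = (l' + k') \<bullet> x'"
      using that carr[OF x] by (simp add: add_scalar_prod_distrib[where n="sdim S"] add_scalar_prod_distrib[where n="sdim S'"])
  qed (use that in auto)
  have smult: "?N (c \<cdot>\<^sub>v l) (c \<cdot>\<^sub>v l')" if "?N l l'" for c l l'
    unfolding N
  proof (intro conjI allI impI)
    fix x x' assume x: "(x,x') \<in> Z"
    have "l \<bullet> x = l' \<bullet> x'" using that x unfolding N by blast
    then show "(c \<cdot>\<^sub>v l) \<bullet> x = (c \<cdot>\<^sub>v l') \<bullet> x'" using that carr[OF x]
        smult_scalar_prod_distrib[of l "sdim S" x c] smult_scalar_prod_distrib[of l' "sdim S'" x' c] by simp
  qed (use that in auto)
  have zero': "?N (0\<^sub>v (sdim S)) (0\<^sub>v (sdim S'))" unfolding N using carr by auto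
  have carr': "l \<in> carrier_vec (sdim S) \<and> l' \<in> carrier_vec (sdim S')" if "?N l l'" for l l'
    using that unfolding N by blast
  show ?thesis by (rule dual_bisimulationI[of ?N, OF carr' zero' add smult A C])
qed

section \<open>Grammians of isomorphic systems\<close>

lemma transpose_congruence:
  fixes M F :: "real mat"
  assumes M: "M \<in> carrier_mat n n" "M\<^sup>T = M" and F: "F \<in> carrier_mat n k"
  shows "(F\<^sup>T * M * F)\<^sup>T = F\<^sup>T * M * F"
proof -
  have Ft: "F\<^sup>T \<in> carrier_mat k n" using F by simp
  have "(F\<^sup>T * M * F)\<^sup>T = F\<^sup>T * (F\<^sup>T * M)\<^sup>T" by (rule transpose_mult[OF mult_carrier_mat[OF Ft M(1)] F])
  also have "(F\<^sup>T * M)\<^sup>T = M * F" using transpose_mult[OF Ft M(1)] M(2) by simp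
  also have "F\<^sup>T * (M * F) = F\<^sup>T * M * F" using assoc_mult_mat[OF Ft M(1) F] by simp
  finally show ?thesis .
qed

lemma pos_definite_congruence:
  assumes M: "pos_definite n M" and F: "F \<in> carrier_mat n k"
    and inj: "\<And>v. v \<in> carrier_vec k \<Longrightarrow> v \<noteq> 0\<^sub>v k \<Longrightarrow> F *\<^sub>v v \<noteq> 0\<^sub>v n"
  shows "pos_definite k (F\<^sup>T * M * F)"
  unfolding pos_definite_def
proof (intro conjI ballI impI)
  have Mc: "M \<in> carrier_mat n n" "M\<^sup>T = M" using M unfolding pos_definite_def by auto
  show "F\<^sup>T * M * F \<in> carrier_mat k k" using F Mc by auto
  show "(F\<^sup>T * M * F)\<^sup>T = F\<^sup>T * M * F"
    by (rule transpose_congruence[OF Mc F])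
  fix v :: "real vec" assume v: "v \<in> carrier_vec k" "v \<noteq> 0\<^sub>v k"
  have Fv: "F *\<^sub>v v \<in> carrier_vec n" using F v by simp
  have "(F\<^sup>T * M * F) *\<^sub>v v = F\<^sup>T *\<^sub>v (M *\<^sub>v (F *\<^sub>v v))"
    using F Mc v assoc_mult_mat_vec[of "F\<^sup>T * M" k n F k v] assoc_mult_mat_vec[of "F\<^sup>T" k n M n "F *\<^sub>v v"] by simp
  then have "v \<bullet> ((F\<^sup>T * M * F) *\<^sub>v v) = (F *\<^sub>v v) \<bullet> (M *\<^sub>v (F *\<^sub>v v))"
    using scalar_prod_mat_transpose[of "F\<^sup>T" k n "M *\<^sub>v (F *\<^sub>v v)" v] F Mc Fv v by simp
  then show "0 < v \<bullet> ((F\<^sup>T * M * F) *\<^sub>v v)"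
    using M inj[OF v] Fv unfolding pos_definite_def by auto
qed

lemma neg_semidefinite_congruence:
  assumes M: "neg_semidefinite n M" and F: "F \<in> carrier_mat n k"
  shows "neg_semidefinite k (F\<^sup>T * M * F)"
  unfolding neg_semidefinite_def
proof (intro conjI ballI)
  have Mc: "M \<in> carrier_mat n n" "M\<^sup>T = M" using M unfolding neg_semidefinite_def by auto
  show "F\<^sup>T * M * F \<in> carrier_mat k k" using F Mc by auto
  show "(F\<^sup>T * M * F)\<^sup>T = F\<^sup>T * M * F"
    by (rule transpose_congruence[OF Mc F])
  fix v :: "real vec" assume v: "v \<in> carrier_vec k"
  have Fv: "F *\<^sub>v v \<in> carrier_vec n" using F v by simp
  have "(F\<^sup>T * M * F) *\<^sub>v v = F\<^sup>T *\<^sub>v (M *\<^sub>v (F *\<^sub>v v))"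
    using F Mc v assoc_mult_mat_vec[of "F\<^sup>T * M" k n F k v] assoc_mult_mat_vec[of "F\<^sup>T" k n M n "F *\<^sub>v v"] by simp
  then have "v \<bullet> ((F\<^sup>T * M * F) *\<^sub>v v) = (F *\<^sub>v v) \<bullet> (M *\<^sub>v (F *\<^sub>v v))"
    using scalar_prod_mat_transpose[of "F\<^sup>T" k n "M *\<^sub>v (F *\<^sub>v v)" v] F Mc Fv v by simp
  then show "v \<bullet> ((F\<^sup>T * M * F) *\<^sub>v v) \<le> 0"
    using M Fv unfolding neg_semidefinite_def by auto
qed

lemma congruence_distrib:
  fixes F :: "real mat"
  assumes "F \<in> carrier_mat n k" "X \<in> carrier_mat n n" "Y \<in> carrier_mat n n"
  shows "F\<^sup>T * (X + Y) * F = F\<^sup>T * X * F + F\<^sup>T * Y * F" "F\<^sup>T * (X - Y) * F = F\<^sup>T * X * F - F\<^sup>T * Y * F"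
proof -
  have Ft: "F\<^sup>T \<in> carrier_mat k n" using assms(1) by simp
  show "F\<^sup>T * (X + Y) * F = F\<^sup>T * X * F + F\<^sup>T * Y * F"
    using mult_add_distrib_mat[OF Ft assms(2,3)] add_mult_distrib_mat[of "F\<^sup>T * X" k n "F\<^sup>T * Y" F k] Ft assms by simp
  show "F\<^sup>T * (X - Y) * F = F\<^sup>T * X * F - F\<^sup>T * Y * F"
    using mult_minus_distrib_mat[OF Ft assms(2,3)] minus_mult_distrib_mat[of "F\<^sup>T * X" k n "F\<^sup>T * Y" F k] Ft assms by simp
qed

text \<open>
  Congruence by an intertwining matrix \<open>F\<close> commutes with forming the left-hand sides of the observability
  inequalities, because \<open>F\<close> can be moved past the system matrices.
\<close>

lemma lyapunov_congruence:
  fixes A A' G M F :: "real mat"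
  assumes A: "A \<in> carrier_mat n n" and A': "A' \<in> carrier_mat k k" and F: "F \<in> carrier_mat n k"
    and G: "G \<in> carrier_mat r n" and M: "M \<in> carrier_mat n n" and FA: "F * A' = A * F"
  shows "A'\<^sup>T * (F\<^sup>T * M * F) + (F\<^sup>T * M * F) * A' + (G * F)\<^sup>T * (G * F) = F\<^sup>T * (A\<^sup>T * M + M * A + G\<^sup>T * G) * F"
    and "A'\<^sup>T * (F\<^sup>T * M * F) * A' + (G * F)\<^sup>T * (G * F) - F\<^sup>T * M * F = F\<^sup>T * (A\<^sup>T * M * A + G\<^sup>T * G - M) * F"
proof -
  note Ts = F[THEN transpose_carrier_mat[THEN iffD2]] A[THEN transpose_carrier_mat[THEN iffD2]]
    A'[THEN transpose_carrier_mat[THEN iffD2]] G[THEN transpose_carrier_mat[THEN iffD2]]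
  have FA': "A'\<^sup>T * F\<^sup>T = F\<^sup>T * A\<^sup>T"
    using transpose_mult[OF F A'] transpose_mult[OF A F] FA by simp
  have MF: "M * F \<in> carrier_mat n k" and FM: "F\<^sup>T * M \<in> carrier_mat k n" and AF: "A * F \<in> carrier_mat n k"
    using M F Ts by auto
  have 1: "A'\<^sup>T * (F\<^sup>T * M * F) = F\<^sup>T * (A\<^sup>T * M) * F"
  proof -
    have "A'\<^sup>T * (F\<^sup>T * M * F) = (A'\<^sup>T * F\<^sup>T) * (M * F)"
      using assoc_mult_mat[OF Ts(1) M F] assoc_mult_mat[OF Ts(3,1) MF] by simp
    also have "\<dots> = F\<^sup>T * (A\<^sup>T * (M * F))" unfolding FA' using assoc_mult_mat[OF Ts(1,2) MF] .
    also have "\<dots> = F\<^sup>T * (A\<^sup>T * M * F)" using assoc_mult_mat[OF Ts(2) M F] by simp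
    also have "\<dots> = F\<^sup>T * (A\<^sup>T * M) * F" using assoc_mult_mat[OF Ts(1) mult_carrier_mat[OF Ts(2) M] F] by simp
    finally show ?thesis .
  qed
  have 2: "(F\<^sup>T * M * F) * A' = F\<^sup>T * (M * A) * F"
  proof -
    have "(F\<^sup>T * M * F) * A' = F\<^sup>T * M * (A * F)" using assoc_mult_mat[OF FM F A'] FA by simp
    also have "\<dots> = F\<^sup>T * M * A * F" using assoc_mult_mat[OF FM A F] by simp
    also have "\<dots> = F\<^sup>T * (M * A) * F" using assoc_mult_mat[OF Ts(1) M A] by simp
    finally show ?thesis .
  qed
  have 3: "(G * F)\<^sup>T * (G * F) = F\<^sup>T * (G\<^sup>T * G) * F"
  proof -
    have "(G * F)\<^sup>T * (G * F) = F\<^sup>T * G\<^sup>T * (G * F)" using transpose_mult[OF G F] by simp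
    also have "\<dots> = F\<^sup>T * G\<^sup>T * G * F" using assoc_mult_mat[OF mult_carrier_mat[OF Ts(1,4)] G F] by simp
    also have "\<dots> = F\<^sup>T * (G\<^sup>T * G) * F" using assoc_mult_mat[OF Ts(1,4) G] by simp
    finally show ?thesis .
  qed
  have 4: "A'\<^sup>T * (F\<^sup>T * M * F) * A' = F\<^sup>T * (A\<^sup>T * M * A) * F"
  proof -
    have AM: "A\<^sup>T * M \<in> carrier_mat n n" using Ts M by simp
    have "A'\<^sup>T * (F\<^sup>T * M * F) * A' = F\<^sup>T * (A\<^sup>T * M) * (A * F)"
      unfolding 1 using assoc_mult_mat[OF mult_carrier_mat[OF Ts(1) AM] F A'] FA by simp
    also have "\<dots> = F\<^sup>T * (A\<^sup>T * M) * A * F" using assoc_mult_mat[OF mult_carrier_mat[OF Ts(1) AM] A F] by simp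
    also have "\<dots> = F\<^sup>T * (A\<^sup>T * M * A) * F" using assoc_mult_mat[OF Ts(1) AM A] by simp
    finally show ?thesis .
  qed
  have c: "A\<^sup>T * M \<in> carrier_mat n n" "M * A \<in> carrier_mat n n" "G\<^sup>T * G \<in> carrier_mat n n"
    "A\<^sup>T * M * A \<in> carrier_mat n n" using Ts M A G by auto
  show "A'\<^sup>T * (F\<^sup>T * M * F) + (F\<^sup>T * M * F) * A' + (G * F)\<^sup>T * (G * F) = F\<^sup>T * (A\<^sup>T * M + M * A + G\<^sup>T * G) * F"
    unfolding 1 2 3 using congruence_distrib(1)[OF F, of "A\<^sup>T * M + M * A" "G\<^sup>T * G"] congruence_distrib(1)[OF F c(1,2)] c by simp
  show "A'\<^sup>T * (F\<^sup>T * M * F) * A' + (G * F)\<^sup>T * (G * F) - F\<^sup>T * M * F = F\<^sup>T * (A\<^sup>T * M * A + G\<^sup>T * G - M) * F"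
    unfolding 4 3 using congruence_distrib(2)[OF F, of "A\<^sup>T * M * A + G\<^sup>T * G" M] congruence_distrib(1)[OF F c(4,3)] c M by simp
qed

text \<open>
  Injectivity of \<open>L\<close> keeps the pulled back form definite, and the grammian inequalities of \<open>S'\<close> are
  congruences of those of \<open>S\<close>.
\<close>

lemma obs_grammian_transfer:
  assumes lss: "is_lss D m p S" "is_lss D m p S'" and L: "intertwines D S' S L"
    and inj: "\<And>v. v \<in> carrier_vec (sdim S') \<Longrightarrow> v \<noteq> 0\<^sub>v (sdim S') \<Longrightarrow> L *\<^sub>v v \<noteq> 0\<^sub>v (sdim S)"
  shows "ct_obs_grammian D S R \<Longrightarrow> ct_obs_grammian D S' (L\<^sup>T * R * L)"
    and "dt_obs_grammian D S R \<Longrightarrow> dt_obs_grammian D S' (L\<^sup>T * R * L)"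
proof -
  have Lc: "L \<in> carrier_mat (sdim S) (sdim S')" using L unfolding intertwines_def by blast
  have sys: "Amat S q \<in> carrier_mat (sdim S) (sdim S)" "Amat S' q \<in> carrier_mat (sdim S') (sdim S')"
    "Cmat S q \<in> carrier_mat p (sdim S)" "L * Amat S' q = Amat S q * L" "Cmat S' q = Cmat S q * L" if "q \<in> {1..D}" for q
    using lss L that unfolding is_lss_def intertwines_def by auto
  show "ct_obs_grammian D S' (L\<^sup>T * R * L)" if R: "ct_obs_grammian D S R"
    unfolding ct_obs_grammian_def
  proof (intro conjI ballI)
    have Rp: "pos_definite (sdim S) R" using R unfolding ct_obs_grammian_def by blast
    then have Rc: "R \<in> carrier_mat (sdim S) (sdim S)" unfolding pos_definite_def by blast
    show "pos_definite (sdim S') (L\<^sup>T * R * L)" by (rule pos_definite_congruence[OF Rp Lc inj])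
    fix q assume q: "q \<in> {1..D}"
    have "neg_semidefinite (sdim S) ((Amat S q)\<^sup>T * R + R * Amat S q + (Cmat S q)\<^sup>T * Cmat S q)"
      using R q unfolding ct_obs_grammian_def by blast
    from neg_semidefinite_congruence[OF this Lc]
    show "neg_semidefinite (sdim S') ((Amat S' q)\<^sup>T * (L\<^sup>T * R * L) + L\<^sup>T * R * L * Amat S' q + (Cmat S' q)\<^sup>T * Cmat S' q)"
      unfolding sys(5)[OF q] lyapunov_congruence(1)[OF sys(1,2)[OF q] Lc sys(3)[OF q] Rc sys(4)[OF q]] .
  qed
  show "dt_obs_grammian D S' (L\<^sup>T * R * L)" if R: "dt_obs_grammian D S R"
    unfolding dt_obs_grammian_def
  proof (intro conjI ballI)
    have Rp: "pos_definite (sdim S) R" using R unfolding dt_obs_grammian_def by blast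
    then have Rc: "R \<in> carrier_mat (sdim S) (sdim S)" unfolding pos_definite_def by blast
    show "pos_definite (sdim S') (L\<^sup>T * R * L)" by (rule pos_definite_congruence[OF Rp Lc inj])
    fix q assume q: "q \<in> {1..D}"
    have "neg_semidefinite (sdim S) ((Amat S q)\<^sup>T * R * Amat S q + (Cmat S q)\<^sup>T * Cmat S q - R)"
      using R q unfolding dt_obs_grammian_def by blast
    from neg_semidefinite_congruence[OF this Lc]
    show "neg_semidefinite (sdim S') ((Amat S' q)\<^sup>T * (L\<^sup>T * R * L) * Amat S' q + (Cmat S' q)\<^sup>T * Cmat S' q - L\<^sup>T * R * L)"
      unfolding sys(5)[OF q] lyapunov_congruence(2)[OF sys(1,2)[OF q] Lc sys(3)[OF q] Rc sys(4)[OF q]] .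
  qed
qed

text \<open>
  Transposition exchanges controllability and observability grammians, so that only one of the two
  transfer arguments has to be carried out.
\<close>

definition dual_lss :: "lss \<Rightarrow> lss" where
  "dual_lss S = \<lparr>sdim = sdim S, Amat = (\<lambda>q. (Amat S q)\<^sup>T), Bmat = (\<lambda>q. (Cmat S q)\<^sup>T), Cmat = (\<lambda>q. (Bmat S q)\<^sup>T)\<rparr>"

lemma sdim_dual_lss [simp]: "sdim (dual_lss S) = sdim S"
  unfolding dual_lss_def by simp

lemma is_lss_dual: "is_lss D m p S \<Longrightarrow> is_lss D p m (dual_lss S)"
  unfolding is_lss_def dual_lss_def by auto

lemma intertwines_dual:
  assumes lss: "is_lss D m p S" "is_lss D m p S'" and K: "intertwines D S S' K"
  shows "intertwines D (dual_lss S') (dual_lss S) K\<^sup>T"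
  unfolding intertwines_def
proof (intro conjI ballI)
  have Kc: "K \<in> carrier_mat (sdim S') (sdim S)" using K unfolding intertwines_def by blast
  then show "K\<^sup>T \<in> carrier_mat (sdim (dual_lss S)) (sdim (dual_lss S'))" by simp
  fix q assume q: "q \<in> {1..D}"
  have sys: "Amat S q \<in> carrier_mat (sdim S) (sdim S)" "Amat S' q \<in> carrier_mat (sdim S') (sdim S')"
    "Bmat S q \<in> carrier_mat (sdim S) m" "Cmat S' q \<in> carrier_mat p (sdim S')"
    "K * Amat S q = Amat S' q * K" "K * Bmat S q = Bmat S' q" "Cmat S q = Cmat S' q * K"
    using lss K q unfolding is_lss_def intertwines_def by auto
  show "K\<^sup>T * Amat (dual_lss S') q = Amat (dual_lss S) q * K\<^sup>T"
    using transpose_mult[OF sys(2) Kc] transpose_mult[OF Kc sys(1)] sys(5) by (simp add: dual_lss_def)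
  show "K\<^sup>T * Bmat (dual_lss S') q = Bmat (dual_lss S) q"
    using transpose_mult[OF sys(4) Kc] sys(7) by (simp add: dual_lss_def)
  show "Cmat (dual_lss S') q = Cmat (dual_lss S) q * K\<^sup>T"
    using transpose_mult[OF Kc sys(3)] sys(6) by (simp add: dual_lss_def)
qed

lemma ctrl_grammian_iff_dual_obs_grammian:
  "ct_ctrl_grammian D S P \<longleftrightarrow> ct_obs_grammian D (dual_lss S) P"
  "dt_ctrl_grammian D S P \<longleftrightarrow> dt_obs_grammian D (dual_lss S) P"
  unfolding ct_ctrl_grammian_def ct_obs_grammian_def dt_ctrl_grammian_def dt_obs_grammian_def dual_lss_def
  by simp_all

text \<open>
  A controllability grammian is an observability grammian of the dual system, and \<open>K\<^sup>T\<close> intertwines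
  the dual systems. In the product of the two transformed grammians \<open>K\<^sup>T L\<^sup>T\<close> cancels, leaving the conjugate
  \<open>K (P R) L\<close>, which has the characteristic polynomial of \<open>P R\<close>.
\<close>

theorem isomorphic_grammians:
  assumes lss: "is_lss D m p S" "is_lss D m p S'"
    and K: "intertwines D S S' K" and L: "intertwines D S' S L"
    and KL: "K * L = 1\<^sub>m (sdim S')" and LK: "L * K = 1\<^sub>m (sdim S)" and dim: "sdim S' = sdim S"
  shows "ct_obs_grammian D S R \<Longrightarrow> ct_obs_grammian D S' (L\<^sup>T * R * L)"
    and "dt_obs_grammian D S R \<Longrightarrow> dt_obs_grammian D S' (L\<^sup>T * R * L)"
    and "ct_ctrl_grammian D S P \<Longrightarrow> ct_ctrl_grammian D S' (K * P * K\<^sup>T)"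
    and "dt_ctrl_grammian D S P \<Longrightarrow> dt_ctrl_grammian D S' (K * P * K\<^sup>T)"
    and "pos_definite (sdim S) P \<Longrightarrow> pos_definite (sdim S) R \<Longrightarrow>
      singular_values (K * P * K\<^sup>T) (L\<^sup>T * R * L) = singular_values P R"
proof -
  let ?n = "sdim S"
  have Kc: "K \<in> carrier_mat ?n ?n" and Lc: "L \<in> carrier_mat ?n ?n"
    using K L dim unfolding intertwines_def by auto
  have KL: "K * L = 1\<^sub>m ?n" using KL dim by simp
  have KLt: "K\<^sup>T * L\<^sup>T = 1\<^sub>m ?n" "L\<^sup>T * K\<^sup>T = 1\<^sub>m ?n"
    using transpose_mult[OF Lc Kc, symmetric] transpose_mult[OF Kc Lc, symmetric] KL LK by (simp_all only: transpose_one)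
  have inj: "F *\<^sub>v v \<noteq> 0\<^sub>v ?n" if "G * F = 1\<^sub>m ?n" "F \<in> carrier_mat ?n ?n" "G \<in> carrier_mat ?n ?n" "v \<in> carrier_vec ?n" "v \<noteq> 0\<^sub>v ?n"
    for F G :: "real mat" and v
  proof
    assume "F *\<^sub>v v = 0\<^sub>v ?n"
    then have "(G * F) *\<^sub>v v = G *\<^sub>v 0\<^sub>v ?n" using assoc_mult_mat_vec[OF that(3,2,4)] by simp
    also have "\<dots> = 0\<^sub>v ?n" using that by (intro eq_vecI) (auto simp: scalar_prod_def)
    finally show False using that by simp
  qed
  show "ct_obs_grammian D S R \<Longrightarrow> ct_obs_grammian D S' (L\<^sup>T * R * L)"
    "dt_obs_grammian D S R \<Longrightarrow> dt_obs_grammian D S' (L\<^sup>T * R * L)"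
    using obs_grammian_transfer[OF lss L] inj[OF KL Lc Kc] dim by simp_all
  have Kt: "intertwines D (dual_lss S') (dual_lss S) K\<^sup>T" by (rule intertwines_dual[OF lss K])
  show "ct_ctrl_grammian D S P \<Longrightarrow> ct_ctrl_grammian D S' (K * P * K\<^sup>T)"
    "dt_ctrl_grammian D S P \<Longrightarrow> dt_ctrl_grammian D S' (K * P * K\<^sup>T)"
    unfolding ctrl_grammian_iff_dual_obs_grammian
    using obs_grammian_transfer[OF is_lss_dual[OF lss(1)] is_lss_dual[OF lss(2)] Kt, of P]
      inj[OF KLt(2)] Kc Lc dim by simp_all
  assume "pos_definite ?n P" "pos_definite ?n R"
  then have Pc: "P \<in> carrier_mat ?n ?n" and Rc: "R \<in> carrier_mat ?n ?n" unfolding pos_definite_def by auto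
  have Ts: "K\<^sup>T \<in> carrier_mat ?n ?n" "L\<^sup>T \<in> carrier_mat ?n ?n" using Kc Lc by auto
  have eq: "K * P * K\<^sup>T * (L\<^sup>T * R * L) = K * (P * R) * L"
  proof -
    have "K * P * K\<^sup>T * (L\<^sup>T * R * L) = K * P * (K\<^sup>T * (L\<^sup>T * (R * L)))"
      using assoc_mult_mat[OF Ts(2) Rc Lc] assoc_mult_mat[OF mult_carrier_mat[OF Kc Pc] Ts(1), of "L\<^sup>T * R * L" ?n] Ts Rc Lc by simp
    also have "K\<^sup>T * (L\<^sup>T * (R * L)) = R * L"
      using assoc_mult_mat[OF Ts(1,2), of "R * L" ?n] KLt(1) Rc Lc by simp
    also have "K * P * (R * L) = K * P * R * L"
      using assoc_mult_mat[OF mult_carrier_mat[OF Kc Pc] Rc Lc] by simp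
    also have "\<dots> = K * (P * R) * L" using assoc_mult_mat[OF Kc Pc Rc] by simp
    finally show ?thesis .
  qed
  have "similar_mat (K * (P * R) * L) (P * R)"
    by (rule similar_matI[of _ _ K L ?n]) (use Kc Lc Pc Rc KL LK in auto)
  from char_poly_similar[OF this]
  have "char_poly (K * P * K\<^sup>T * (L\<^sup>T * R * L)) = char_poly (P * R)" unfolding eq .
  moreover have "K * P * K\<^sup>T * (L\<^sup>T * R * L) \<in> carrier_mat ?n ?n" "P * R \<in> carrier_mat ?n ?n"
    using Ts Kc Lc Pc Rc by auto
  ultimately show "singular_values (K * P * K\<^sup>T) (L\<^sup>T * R * L) = singular_values P R"
    unfolding singular_values_def by (simp add: of_real_hom.char_poly_hom)
qed

section \<open>Discrete time\<close>

lemma dt_state_carrier: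
  assumes "is_lss D m p S" "u \<in> dt_inputs m" "q \<in> dt_switchings D"
  shows "dt_state S u q t \<in> carrier_vec (sdim S)"
proof (induction t)
  case (Suc t)
  have "q t \<in> {1..D}" "u t \<in> carrier_vec m" using assms unfolding dt_switchings_def dt_inputs_def by auto
  then show ?case using assms(1) Suc unfolding is_lss_def by (auto intro!: add_carrier_vec mult_mat_vec_carrier)
qed simp

lemma dt_state_intertwines:
  assumes lss: "is_lss D m p S" "is_lss D m p S'" and K: "intertwines D S S' K"
    and u: "u \<in> dt_inputs m" and q: "q \<in> dt_switchings D"
  shows "dt_state S' u q t = K *\<^sub>v dt_state S u q t"
proof (induction t)
  case 0
  have "K \<in> carrier_mat (sdim S') (sdim S)" using K unfolding intertwines_def by blast
  then show ?case by (intro eq_vecI) (auto simp: scalar_prod_def)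
next
  case (Suc t)
  have qt: "q t \<in> {1..D}" and ut: "u t \<in> carrier_vec m" using u q unfolding dt_switchings_def dt_inputs_def by auto
  have Kc: "K \<in> carrier_mat (sdim S') (sdim S)" and
    sys: "Amat S (q t) \<in> carrier_mat (sdim S) (sdim S)" "Amat S' (q t) \<in> carrier_mat (sdim S') (sdim S')"
      "Bmat S (q t) \<in> carrier_mat (sdim S) m" "K * Amat S (q t) = Amat S' (q t) * K" "K * Bmat S (q t) = Bmat S' (q t)"
    using lss K qt unfolding is_lss_def intertwines_def by auto
  let ?x = "dt_state S u q t"
  have x: "?x \<in> carrier_vec (sdim S)" by (rule dt_state_carrier[OF lss(1) u q])
  have "K *\<^sub>v dt_state S u q (Suc t) = K *\<^sub>v (Amat S (q t) *\<^sub>v ?x) + K *\<^sub>v (Bmat S (q t) *\<^sub>v u t)"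
    using mult_add_distrib_mat_vec[OF Kc mult_mat_vec_carrier[OF sys(1) x] mult_mat_vec_carrier[OF sys(3) ut]] by simp
  also have "\<dots> = (K * Amat S (q t)) *\<^sub>v ?x + (K * Bmat S (q t)) *\<^sub>v u t"
    using assoc_mult_mat_vec[OF Kc sys(1) x] assoc_mult_mat_vec[OF Kc sys(3) ut] by simp
  also have "\<dots> = Amat S' (q t) *\<^sub>v (K *\<^sub>v ?x) + Bmat S' (q t) *\<^sub>v u t"
    unfolding sys(4,5) using assoc_mult_mat_vec[OF sys(2) Kc x] by simp
  finally show ?case using Suc by simp
qed

lemma dt_equivalent_intertwines:
  assumes lss: "is_lss D m p S" "is_lss D m p S'" and K: "intertwines D S S' K"
  shows "dt_equivalent D m S S'" "dt_equivalent D m S' S"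
proof -
  have "dt_io_map S u q t = dt_io_map S' u q t" if u: "u \<in> dt_inputs m" and q: "q \<in> dt_switchings D" for u q t
  proof -
    have qt: "q t \<in> {1..D}" using q unfolding dt_switchings_def by auto
    have Kc: "K \<in> carrier_mat (sdim S') (sdim S)" "Cmat S' (q t) \<in> carrier_mat p (sdim S')" "Cmat S (q t) = Cmat S' (q t) * K"
      using lss K qt unfolding is_lss_def intertwines_def by auto
    show ?thesis unfolding dt_io_map_def dt_state_intertwines[OF lss K u q] Kc(3)
      using assoc_mult_mat_vec[OF Kc(2,1) dt_state_carrier[OF lss(1) u q]] by simp
  qed
  then show "dt_equivalent D m S S'" "dt_equivalent D m S' S" unfolding dt_equivalent_def by auto
qed

lemma dt_minimal_irreducible:
  assumes "dt_minimal D m p S"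
  shows "irreducible_lss D m p S"
  using assms dt_equivalent_intertwines unfolding dt_minimal_def irreducible_lss_def by blast

lemma dt_state_cong:
  assumes "\<And>s. s < t \<Longrightarrow> u s = u' s \<and> q s = q' s"
  shows "dt_state S u q t = dt_state S u' q' t"
  using assms by (induction t) auto

text \<open>
  A pair reached at time \<open>t\<close> does not depend on the signals at time \<open>t\<close> itself. Changing these to an arbitrary
  mode and input value yields the output condition at time \<open>t\<close> and the step condition at time \<open>t + 1\<close>.
\<close>

lemma dt_equivalent_dual_bisimulation:
  assumes lss: "is_lss D m p S" "is_lss D m p S'" and D: "D \<ge> 1" and eq: "dt_equivalent D m S S'"
  obtains N where "dual_bisimulation D p S S' N"
proof -
  let ?Z = "{(dt_state S u q t, dt_state S' u q t) | u q t. u \<in> dt_inputs m \<and> q \<in> dt_switchings D}"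
  have upd: "u(t := v) \<in> dt_inputs m \<and> q(t := c) \<in> dt_switchings D \<and>
      dt_state T (u(t := v)) (q(t := c)) t = dt_state T u q t"
    if "u \<in> dt_inputs m" "q \<in> dt_switchings D" "v \<in> carrier_vec m" "c \<in> {1..D}" for u q t T and v :: "real vec" and c
  proof (intro conjI)
    have "summable (\<lambda>s. ((u(t := v)) s $ i)\<^sup>2)" if "summable (\<lambda>s. (u s $ i)\<^sup>2)" for i
    proof -
      have "\<forall>\<^sub>F s in sequentially. (u s $ i)\<^sup>2 = ((u(t := v)) s $ i)\<^sup>2"
        by (intro eventually_sequentiallyI[of "Suc t"]) auto
      from summable_cong[OF this] show ?thesis using that by simp
    qed
    then show "u(t := v) \<in> dt_inputs m" using that unfolding dt_inputs_def by auto
    show "q(t := c) \<in> dt_switchings D" using that unfolding dt_switchings_def by auto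
    show "dt_state T (u(t := v)) (q(t := c)) t = dt_state T u q t" by (rule dt_state_cong) auto
  qed
  have "dual_bisimulation D p S S' (\<lambda>l l'. l \<in> carrier_vec (sdim S) \<and> l' \<in> carrier_vec (sdim S') \<and>
      (\<forall>(x,x')\<in>?Z. l \<bullet> x = l' \<bullet> x'))"
  proof (rule annihilator_dual_bisimulation[OF lss])
    fix x x' assume "(x,x') \<in> ?Z"
    then show "x \<in> carrier_vec (sdim S) \<and> x' \<in> carrier_vec (sdim S')"
      using dt_state_carrier lss by blast
  next
    have "(\<lambda>t. 0\<^sub>v m) \<in> dt_inputs m" "(\<lambda>t. 1) \<in> dt_switchings D"
      using D unfolding dt_inputs_def dt_switchings_def by auto
    moreover have "(0\<^sub>v (sdim S), 0\<^sub>v (sdim S')) = (dt_state S (\<lambda>t. 0\<^sub>v m) (\<lambda>t. 1) 0, dt_state S' (\<lambda>t. 0\<^sub>v m) (\<lambda>t. 1) 0)"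
      by simp
    ultimately show "(0\<^sub>v (sdim S), 0\<^sub>v (sdim S')) \<in> ?Z" by blast
  next
    fix x x' c assume "(x,x') \<in> ?Z" and c: "c \<in> {1..D}"
    then obtain u q t where x: "x = dt_state S u q t" "x' = dt_state S' u q t"
      and u: "u \<in> dt_inputs m" and q: "q \<in> dt_switchings D" by blast
    have up: "u(t := u t) \<in> dt_inputs m" "q(t := c) \<in> dt_switchings D"
      "dt_state T (u(t := u t)) (q(t := c)) t = dt_state T u q t" for T
      using upd[OF u q _ c, of "u t" t T] u unfolding dt_inputs_def by auto
    have "dt_io_map S (u(t := u t)) (q(t := c)) t = dt_io_map S' (u(t := u t)) (q(t := c)) t"
      using eq up(1,2) unfolding dt_equivalent_def by blast
    then show "Cmat S c *\<^sub>v x = Cmat S' c *\<^sub>v x'" unfolding dt_io_map_def up(3) x by simp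
  next
    fix l l' x x' c and v :: "real vec"
    assume Z: "\<And>y y'. (y,y') \<in> ?Z \<Longrightarrow> l \<bullet> y = l' \<bullet> y'" and "(x,x') \<in> ?Z" and c: "c \<in> {1..D}"
      and v: "v \<in> carrier_vec m"
    then obtain u q t where x: "x = dt_state S u q t" "x' = dt_state S' u q t"
      and u: "u \<in> dt_inputs m" and q: "q \<in> dt_switchings D" by blast
    have up: "u(t := v) \<in> dt_inputs m" "q(t := c) \<in> dt_switchings D"
      "dt_state T (u(t := v)) (q(t := c)) t = dt_state T u q t" for T
      using upd[OF u q v c, of t T] by auto
    have "l \<bullet> dt_state S (u(t := v)) (q(t := c)) (Suc t) = l' \<bullet> dt_state S' (u(t := v)) (q(t := c)) (Suc t)"
      by (rule Z) (use up in blast)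
    then show "l \<bullet> (Amat S c *\<^sub>v x + Bmat S c *\<^sub>v v) = l' \<bullet> (Amat S' c *\<^sub>v x' + Bmat S' c *\<^sub>v v)"
      unfolding dt_state.simps up(3) x by simp
  qed
  then show thesis using that by blast
qed

section \<open>Continuous time: existence and uniqueness of solutions\<close>

lemma AE_half_line_iff_negligible:
  "(AE t in lebesgue_on {0..}. P t) \<longleftrightarrow> (\<exists>N. negligible N \<and> (\<forall>t. t \<ge> 0 \<longrightarrow> t \<notin> N \<longrightarrow> P (t::real)))"
proof -
  have "(AE t in lebesgue_on {0..}. P t) \<longleftrightarrow> (AE t in lebesgue. t \<in> {0..} \<longrightarrow> P t)"
    by (rule AE_restrict_space_iff) auto
  also have "\<dots> \<longleftrightarrow> (\<exists>N\<in>null_sets lebesgue. {t\<in>space lebesgue. \<not> (t \<in> {0..} \<longrightarrow> P t)} \<subseteq> N)"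
    by (rule eventually_ae_filter)
  also have "\<dots> \<longleftrightarrow> (\<exists>N. negligible N \<and> (\<forall>t. t \<ge> 0 \<longrightarrow> t \<notin> N \<longrightarrow> P t))"
    unfolding negligible_iff_null_sets by auto
  finally show ?thesis .
qed

lemma ct_inputsD: "u \<in> ct_inputs m \<Longrightarrow> t \<ge> 0 \<Longrightarrow> u t \<in> carrier_vec m"
  unfolding ct_inputs_def by auto

lemma ct_switchingsD: "q \<in> ct_switchings D \<Longrightarrow> t \<ge> 0 \<Longrightarrow> q t \<in> {1..D}"
  unfolding ct_switchings_def by auto

text \<open>
  The absolute value extends the signal evenly to negative times, where a switching signal is arbitrary.
  The extension is continuous off the countable set of discontinuities and their mirror images.
\<close>

lemma ct_switchings_borel_measurable:
  fixes a :: "nat \<Rightarrow> real"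
  assumes q: "q \<in> ct_switchings D"
  shows "(\<lambda>s. a (q \<bar>s\<bar>)) \<in> borel_measurable borel"
proof -
  define X where "X = {t\<in>{0..}. \<not> continuous (at t within {0..}) q}"
  have "X \<subseteq> (\<Union>k::nat. {t\<in>{0..real k}. \<not> continuous (at t within {0..}) q})"
    unfolding X_def using real_arch_simple by auto
  moreover have "countable (\<Union>k::nat. {t\<in>{0..real k}. \<not> continuous (at t within {0..}) q})"
  proof (rule countable_UN)
    show "countable {t\<in>{0..real k}. \<not> continuous (at t within {0..}) q}" for k :: nat
      by (rule countable_finite) (use q in \<open>simp add: ct_switchings_def\<close>)
  qed simp
  ultimately have X: "countable X" using countable_subset by blast
  have cq: "continuous_on ({0..} - X) q"
    unfolding continuous_on_eq_continuous_within X_def by (auto intro: continuous_within_subset)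
  have im: "(\<lambda>s. \<bar>s\<bar>) ` (- (X \<union> uminus ` X)) \<subseteq> {0..} - X"
  proof (rule image_subsetI)
    fix s assume s: "s \<in> - (X \<union> uminus ` X)"
    have "s \<in> uminus ` X" if "- s \<in> X" using imageI[OF that, of uminus] by simp
    then show "\<bar>s\<bar> \<in> {0..} - X" using s by (auto simp: abs_if)
  qed
  have "continuous_on (- (X \<union> uminus ` X)) (\<lambda>s::real. \<bar>s\<bar>)" by (intro continuous_intros)
  from continuous_on_compose2[OF cq this im]
  have "continuous_on (- (X \<union> uminus ` X)) (\<lambda>s. q \<bar>s\<bar>)" .
  moreover have "countable (X \<union> uminus ` X)" using X by simp
  ultimately have "(\<lambda>s. q \<bar>s\<bar>) \<in> borel_measurable borel"
    by (intro borel_measurable_continuous_countable_exceptions)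
  moreover have "a \<in> borel_measurable borel"
    by (rule borel_measurable_continuous_onI) (simp add: continuous_on_open_vimage[OF open_UNIV] open_discrete)
  ultimately show ?thesis by (rule measurable_compose)
qed

text \<open>
  On bounded intervals square integrable inputs are integrable, because \<open>\<bar>u\<bar> \<le> 1 + u\<^sup>2\<close>.
\<close>

lemma ct_input_term_absolutely_integrable:
  assumes u: "u \<in> ct_inputs m" and q: "q \<in> ct_switchings D"
  shows "(\<lambda>s. \<Sum>j<m. M (q \<bar>s\<bar>) $$ (i,j) * u s $ j) absolutely_integrable_on {0..b}"
proof (rule absolutely_integrable_sum)
  fix j assume "j \<in> {..<m}"
  then have j: "j < m" by simp
  obtain K where K: "K \<ge> 0" "\<And>c i' j. c \<in> {1..D} \<Longrightarrow> i' < Suc i \<Longrightarrow> j < m \<Longrightarrow> \<bar>M c $$ (i',j)\<bar> \<le> K"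
    using matrix_family_entry_bound[of D "Suc i" m M] by metis
  have um: "(\<lambda>t. u t $ j) \<in> borel_measurable (lebesgue_on {0..})"
    and u2: "integrable (lebesgue_on {0..}) (\<lambda>t. (u t $ j)\<^sup>2)"
    using u j unfolding ct_inputs_def by auto
  have um': "(\<lambda>t. u t $ j) \<in> borel_measurable (lebesgue_on {0..b})"
    by (rule measurable_restrict_mono[OF um]) auto
  have "(\<lambda>t. (u t $ j)\<^sup>2) integrable_on {0..}"
    by (rule integrable_on_lebesgue_on[OF u2]) auto
  then have u2': "(\<lambda>t. (u t $ j)\<^sup>2) integrable_on {0..b}"
    by (rule integrable_on_subinterval) auto
  show "(\<lambda>s. M (q \<bar>s\<bar>) $$ (i,j) * u s $ j) absolutely_integrable_on {0..b}"
  proof (rule measurable_bounded_by_integrable_imp_absolutely_integrable)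
    have "(\<lambda>s. M (q \<bar>s\<bar>) $$ (i,j)) \<in> borel_measurable borel"
      by (rule ct_switchings_borel_measurable[OF q])
    then have "(\<lambda>s. M (q \<bar>s\<bar>) $$ (i,j)) \<in> borel_measurable (lebesgue_on {0..b})"
      by (metis borel_measurable_if_I measurable_completion measurable_lborel2 measurable_restrict_space1)
    then show "(\<lambda>s. M (q \<bar>s\<bar>) $$ (i,j) * u s $ j) \<in> borel_measurable (lebesgue_on {0..b})"
      using um' by measurable
    show "(\<lambda>s. K * (1 + (u s $ j)\<^sup>2)) integrable_on {0..b}"
      by (intro integrable_on_mult_right integrable_add u2') auto
    fix s assume s: "s \<in> {0..b}"
    have "\<bar>M (q \<bar>s\<bar>) $$ (i,j)\<bar> \<le> K" by (rule K(2)) (use ct_switchingsD[OF q, of s] s j in auto)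
    moreover have "\<bar>u s $ j\<bar> \<le> 1 + (u s $ j)\<^sup>2"
    proof -
      have "0 \<le> (\<bar>u s $ j\<bar> - 1)\<^sup>2" by simp
      then have "2 * \<bar>u s $ j\<bar> \<le> 1 + (u s $ j)\<^sup>2" by (simp add: power2_eq_square algebra_simps)
      then show ?thesis by linarith
    qed
    ultimately show "norm (M (q \<bar>s\<bar>) $$ (i,j) * u s $ j) \<le> K * (1 + (u s $ j)\<^sup>2)"
      unfolding real_norm_def abs_mult using K(1) by (intro mult_mono) auto
  qed auto
qed auto

text \<open>
  A solution \<open>y\<close> of the integral equation has continuous components, so the right-hand side \<open>h\<close> of the
  differential equation is locally integrable along it. The integral of \<open>h\<close> is absolutely continuous and
  differentiable almost everywhere with derivative \<open>h\<close>.
\<close>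

theorem ct_solution_exists:
  assumes lss: "is_lss D m p S" and u: "u \<in> ct_inputs m" and q: "q \<in> ct_switchings D"
  obtains x where "ct_solution S u q x"
proof -
  let ?n = "sdim S"
  define G where "G = (\<lambda>i j s. Amat S (q \<bar>s\<bar>) $$ (i,j))"
  define g where "g = (\<lambda>i s. \<Sum>j<m. Bmat S (q \<bar>s\<bar>) $$ (i,j) * u s $ j)"
  have gi: "g i absolutely_integrable_on {0..b}" for i b
    unfolding g_def by (rule ct_input_term_absolutely_integrable[OF u q])
  obtain K where K: "K \<ge> 0" "\<And>c i j. c \<in> {1..D} \<Longrightarrow> i < ?n \<Longrightarrow> j < ?n \<Longrightarrow> \<bar>Amat S c $$ (i,j)\<bar> \<le> K"
    using matrix_family_entry_bound[of D ?n ?n "Amat S"] by metis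
  have Gm: "G i j \<in> borel_measurable borel" for i j
    unfolding G_def by (rule ct_switchings_borel_measurable[OF q])
  have GK: "\<bar>G i j s\<bar> \<le> K" if "i < ?n" "j < ?n" "s \<ge> 0" for i j s
    unfolding G_def using K(2) that ct_switchingsD[OF q, of s] by auto
  have Vc: "continuous_on {0..} (\<lambda>t. integral {0..t} (g i))" for i
    by (rule continuous_on_half_line, rule indefinite_integral_continuous_1)
      (use gi in \<open>auto simp: absolutely_integrable_on_def\<close>)
  obtain y where yc: "\<And>i. i < ?n \<Longrightarrow> continuous_on {0..} (y i)"
    and y: "\<And>i t. i < ?n \<Longrightarrow> t \<ge> 0 \<Longrightarrow> y i t = integral {0..t} (g i) + integral {0..t} (\<lambda>s. \<Sum>j<?n. G i j s * y j s)"
    by (rule linear_integral_equation_solvable[of ?n "\<lambda>i t. integral {0..t} (g i)" G K, OF Vc Gm GK K(1)])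
      ((assumption | rule that)+)
  define h where "h = (\<lambda>i s. g i s + (\<Sum>j<?n. G i j s * y j s))"
  have Gyi: "(\<lambda>s. \<Sum>j<?n. G i j s * y j s) absolutely_integrable_on {0..b}" if "i < ?n" for i b
    by (rule absolutely_integrable_on_matrix_mult[OF Gm GK yc]) (use that in auto)
  have hi: "h i absolutely_integrable_on {0..b}" if "i < ?n" for i b
    unfolding h_def by (rule set_integral_add(1)[OF gi Gyi[OF that]])
  have hy: "integral {0..t} (h i) = y i t" if "i < ?n" "t \<ge> 0" for i t
    unfolding y[OF that] h_def
    by (rule Henstock_Kurzweil_Integration.integral_add) (use gi Gyi[OF that(1)] in \<open>auto simp: absolutely_integrable_on_def\<close>)
  \<comment> \<open>Same values as \<open>y\<close> for \<open>t \<ge> 0\<close>, but an indefinite integral for all \<open>t\<close>.\<close>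
  define X where "X = (\<lambda>t. vec ?n (\<lambda>i. integral {0..t} (h i)))"
  have Xi: "(\<lambda>t. X t $ i) = (\<lambda>t. integral {0..t} (h i))" if "i < ?n" for i
    unfolding X_def using that by auto
  have hX: "h i t = (Amat S (q t) *\<^sub>v X t + Bmat S (q t) *\<^sub>v u t) $ i" if i: "i < ?n" and t: "t \<ge> 0" for i t
  proof -
    note sys = is_lssD[OF lss ct_switchingsD[OF q t]]
    have "(Amat S (q t) *\<^sub>v X t) $ i = (\<Sum>j<?n. Amat S (q t) $$ (i,j) * X t $ j)"
      by (rule mat_mult_vec_sum[OF sys(1) _ i]) (simp add: X_def)
    also have "\<dots> = (\<Sum>j<?n. G i j t * y j t)"
      by (rule sum.cong) (use t hy in \<open>auto simp: G_def X_def\<close>)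
    finally have 1: "(Amat S (q t) *\<^sub>v X t) $ i = (\<Sum>j<?n. G i j t * y j t)" .
    have 2: "(Bmat S (q t) *\<^sub>v u t) $ i = g i t"
      unfolding g_def using mat_mult_vec_sum[OF sys(2) ct_inputsD[OF u t] i] t by simp
    show ?thesis unfolding h_def using 1 2 i sys by (simp add: X_def)
  qed
  define Z where "Z = (\<Union>i<?n. \<Union>k::nat. {t\<in>{0..real k}. \<not> ((\<lambda>t. integral {0..t} (h i)) has_real_derivative h i t) (at t within {0..real k})})"
  have "negligible Z" unfolding Z_def
  proof (intro negligible_Union negligible_countable_Union)
    fix T assume "T \<in> (\<lambda>i. \<Union>k::nat. {t\<in>{0..real k}. \<not> ((\<lambda>t. integral {0..t} (h i)) has_real_derivative h i t) (at t within {0..real k})}) ` {..<?n}"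
    then obtain i where i: "i < ?n" "T = (\<Union>k::nat. {t\<in>{0..real k}. \<not> ((\<lambda>t. integral {0..t} (h i)) has_real_derivative h i t) (at t within {0..real k})})" by auto
    show "negligible T" unfolding i(2)
    proof (rule negligible_countable_Union)
      fix T' assume "T' \<in> range (\<lambda>k::nat. {t\<in>{0..real k}. \<not> ((\<lambda>t. integral {0..t} (h i)) has_real_derivative h i t) (at t within {0..real k})})"
      then obtain k :: nat where k: "T' = {t\<in>{0..real k}. \<not> ((\<lambda>t. integral {0..t} (h i)) has_real_derivative h i t) (at t within {0..real k})}" by auto
      show "negligible T'" unfolding k
        by (rule indefinite_integral_has_real_derivative_ae) (use hi[OF i(1)] in \<open>auto simp: absolutely_integrable_on_def\<close>)
    qed auto
  qed auto
  moreover have "((\<lambda>s. X s $ i) has_real_derivative (Amat S (q t) *\<^sub>v X t + Bmat S (q t) *\<^sub>v u t) $ i) (at t within {0..})"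
    if t: "t \<ge> 0" "t \<notin> Z" and i: "i < ?n" for t i
  proof -
    obtain k :: nat where k: "t < real k" using reals_Archimedean2 by blast
    then have "((\<lambda>t. integral {0..t} (h i)) has_real_derivative h i t) (at t within {0..real k})"
      using t i unfolding Z_def by auto
    moreover have "at t within {0..real k} = at t within {0..}"
      by (rule at_within_nhd[of _ "{..<real k}"]) (use k in auto)
    ultimately show ?thesis unfolding Xi[OF i] hX[OF i t(1)] by simp
  qed
  ultimately have "AE t in lebesgue_on {0..}. \<forall>i<?n. ((\<lambda>s. X s $ i) has_real_derivative
        (Amat S (q t) *\<^sub>v X t + Bmat S (q t) *\<^sub>v u t) $ i) (at t within {0..})"
    unfolding AE_half_line_iff_negligible by blast
  moreover have "abs_continuous_on {0..b} (\<lambda>t. X t $ i)" if "i < ?n" for i b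
    unfolding Xi[OF that] by (rule abs_continuous_on_integral[OF hi[OF that]])
  moreover have "X 0 = 0\<^sub>v ?n" unfolding X_def by (intro eq_vecI) auto
  ultimately have "ct_solution S u q X" unfolding ct_solution_def by (auto simp: X_def)
  then show thesis by (rule that)
qed

text \<open>
  As long as the signals agree, the difference of the solutions solves the homogeneous equation, to which
  the Gronwall argument applies. Admitting signals that differ later on makes it possible to change an
  experiment from some time on without affecting its past.
\<close>

lemma ct_solution_unique:
  assumes lss: "is_lss D m p S" and u: "u \<in> ct_inputs m" and q: "q \<in> ct_switchings D"
    and x: "ct_solution S u q x" and y: "ct_solution S u' q' y"
    and eq: "\<And>s. 0 \<le> s \<Longrightarrow> s < b \<Longrightarrow> u' s = u s \<and> q' s = q s" and t: "t \<in> {0..b}"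
  shows "x t = y t"
proof -
  let ?n = "sdim S"
  obtain Nx where Nx: "negligible Nx" "\<And>t i. t \<ge> 0 \<Longrightarrow> t \<notin> Nx \<Longrightarrow> i < ?n \<Longrightarrow> ((\<lambda>s. x s $ i) has_real_derivative
        (Amat S (q t) *\<^sub>v x t + Bmat S (q t) *\<^sub>v u t) $ i) (at t within {0..})"
    using x unfolding ct_solution_def AE_half_line_iff_negligible by blast
  obtain Ny where Ny: "negligible Ny" "\<And>t i. t \<ge> 0 \<Longrightarrow> t \<notin> Ny \<Longrightarrow> i < ?n \<Longrightarrow> ((\<lambda>s. y s $ i) has_real_derivative
        (Amat S (q' t) *\<^sub>v y t + Bmat S (q' t) *\<^sub>v u' t) $ i) (at t within {0..})"
    using y unfolding ct_solution_def AE_half_line_iff_negligible by blast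
  have xc: "x t \<in> carrier_vec ?n" and yc: "y t \<in> carrier_vec ?n" if "t \<ge> 0" for t
    using x y that unfolding ct_solution_def by auto
  obtain K where K: "K \<ge> 0" "\<And>c i j. c \<in> {1..D} \<Longrightarrow> i < ?n \<Longrightarrow> j < ?n \<Longrightarrow> \<bar>Amat S c $$ (i,j)\<bar> \<le> K"
    using matrix_family_entry_bound[of D ?n ?n "Amat S"] by metis
  have "x t $ i + (-1) * y t $ i = 0" if i: "i < ?n" for i
  proof (rule gronwall_zero[where f="\<lambda>i t. x t $ i + (-1) * y t $ i" and N="insert b (Nx \<union> Ny)", OF _ _ _ K(1) _ t i])
    \<comment> \<open>The signals may differ at \<open>b\<close> itself, which is therefore exceptional as well.\<close>
    show "negligible (insert b (Nx \<union> Ny))" using Nx(1) Ny(1) by auto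
    fix i assume i: "i < ?n"
    show "abs_continuous_on {0..b} (\<lambda>t. x t $ i + (-1) * y t $ i)"
      by (intro abs_continuous_on_add abs_continuous_on_cmult) (use x y t i in \<open>auto simp: ct_solution_def\<close>)
    show "x 0 $ i + (-1) * y 0 $ i = 0" using x y i unfolding ct_solution_def by auto
    fix t assume t: "t \<in> {0..b} - insert b (Nx \<union> Ny)"
    then have t': "t \<ge> 0" "t < b" "t \<notin> Nx" "t \<notin> Ny" by auto
    note sys = is_lssD[OF lss ct_switchingsD[OF q t'(1)]]
    have ut: "u t \<in> carrier_vec m" by (rule ct_inputsD[OF u t'(1)])
    let ?d = "(Amat S (q t) *\<^sub>v x t + Bmat S (q t) *\<^sub>v u t) $ i + (-1) * (Amat S (q t) *\<^sub>v y t + Bmat S (q t) *\<^sub>v u t) $ i"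
    have "((\<lambda>s. x s $ i + (-1) * y s $ i) has_real_derivative ?d) (at t within {0..})"
      using Nx(2)[OF t'(1,3) i] Ny(2)[OF t'(1,4) i] eq[OF t'(1,2)] by (intro DERIV_add DERIV_cmult) auto
    then have "((\<lambda>s. x s $ i + (-1) * y s $ i) has_real_derivative ?d) (at t within {0..b})"
      by (rule has_field_derivative_subset) auto
    moreover have "\<bar>?d\<bar> \<le> K * (\<Sum>j<?n. \<bar>x t $ j + (-1) * y t $ j\<bar>)"
    proof -
      have "?d = (Amat S (q t) *\<^sub>v x t) $ i - (Amat S (q t) *\<^sub>v y t) $ i"
        using sys ut i by simp
      also have "\<dots> = (\<Sum>j<?n. Amat S (q t) $$ (i,j) * (x t $ j + (-1) * y t $ j))"
        unfolding mat_mult_vec_sum[OF sys(1) xc[OF t'(1)] i] mat_mult_vec_sum[OF sys(1) yc[OF t'(1)] i]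
        by (simp add: sum_subtractf[symmetric] algebra_simps)
      finally have d: "?d = (\<Sum>j<?n. Amat S (q t) $$ (i,j) * (x t $ j + (-1) * y t $ j))" .
      have "\<bar>?d\<bar> \<le> (\<Sum>j<?n. \<bar>Amat S (q t) $$ (i,j) * (x t $ j + (-1) * y t $ j)\<bar>)"
        unfolding d by (rule sum_abs)
      also have "\<dots> \<le> (\<Sum>j<?n. K * \<bar>x t $ j + (-1) * y t $ j\<bar>)"
        unfolding abs_mult by (intro sum_mono mult_right_mono K(2)) (use ct_switchingsD[OF q t'(1)] i in auto)
      finally show ?thesis by (simp add: sum_distrib_left)
    qed
    ultimately show "\<exists>d. ((\<lambda>s. x s $ i + (-1) * y s $ i) has_real_derivative d) (at t within {0..b}) \<and>
        \<bar>d\<bar> \<le> K * (\<Sum>j<?n. \<bar>x t $ j + (-1) * y t $ j\<bar>)" by blast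
  qed
  then show ?thesis using xc[of t] yc[of t] t by (intro eq_vecI) auto
qed

text \<open>
  By uniqueness the choice in the definition of the input-output map is immaterial.
\<close>

lemma ct_io_map_eq:
  assumes lss: "is_lss D m p S" and u: "u \<in> ct_inputs m" and q: "q \<in> ct_switchings D"
    and x: "ct_solution S u q x" and t: "t \<ge> 0"
  shows "ct_io_map S u q t = Cmat S (q t) *\<^sub>v x t"
proof -
  have "ct_solution S u q (SOME x. ct_solution S u q x)" 
    using someI[of "ct_solution S u q", OF x] .
  from ct_solution_unique[OF lss u q this x, of t t] t show ?thesis unfolding ct_io_map_def by simp
qed

section \<open>Continuous time: minimality and equivalence\<close>

lemma ct_solution_intertwines:
  assumes lss: "is_lss D m p S" "is_lss D m p S'" and K: "intertwines D S S' K"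
    and u: "u \<in> ct_inputs m" and q: "q \<in> ct_switchings D" and x: "ct_solution S u q x"
  shows "ct_solution S' u q (\<lambda>t. K *\<^sub>v x t)"
proof -
  let ?n = "sdim S" and ?n' = "sdim S'"
  have Kc: "K \<in> carrier_mat ?n' ?n" using K unfolding intertwines_def by blast
  have xc: "x t \<in> carrier_vec ?n" if "t \<ge> 0" for t using x that unfolding ct_solution_def by auto
  have Kx: "(K *\<^sub>v x t) $ i = (\<Sum>j<?n. K $$ (i,j) * x t $ j)" if "t \<ge> 0" "i < ?n'" for t i
    using mat_mult_vec_sum[OF Kc xc that(2)] that by simp
  obtain N where N: "negligible N" "\<And>t i. t \<ge> 0 \<Longrightarrow> t \<notin> N \<Longrightarrow> i < ?n \<Longrightarrow> ((\<lambda>s. x s $ i) has_real_derivative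
        (Amat S (q t) *\<^sub>v x t + Bmat S (q t) *\<^sub>v u t) $ i) (at t within {0..})"
    using x unfolding ct_solution_def AE_half_line_iff_negligible by blast
  have der: "((\<lambda>s. (K *\<^sub>v x s) $ i) has_real_derivative
        (Amat S' (q t) *\<^sub>v (K *\<^sub>v x t) + Bmat S' (q t) *\<^sub>v u t) $ i) (at t within {0..})"
    if t: "t \<ge> 0" "t \<notin> N" and i: "i < ?n'" for t i
  proof -
    note qt = ct_switchingsD[OF q t(1)]
    note sys = is_lssD[OF lss(1) qt] and sys' = is_lssD[OF lss(2) qt]
    have int: "K * Amat S (q t) = Amat S' (q t) * K" "K * Bmat S (q t) = Bmat S' (q t)"
      using K qt unfolding intertwines_def by auto
    have ut: "u t \<in> carrier_vec m" by (rule ct_inputsD[OF u t(1)])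
    let ?w = "Amat S (q t) *\<^sub>v x t + Bmat S (q t) *\<^sub>v u t"
    have w: "?w \<in> carrier_vec ?n" using sys xc[OF t(1)] ut by auto
    have "K *\<^sub>v ?w = K *\<^sub>v (Amat S (q t) *\<^sub>v x t) + K *\<^sub>v (Bmat S (q t) *\<^sub>v u t)"
      by (rule mult_add_distrib_mat_vec[OF Kc]) (use sys xc[OF t(1)] ut in auto)
    also have "\<dots> = Amat S' (q t) *\<^sub>v (K *\<^sub>v x t) + Bmat S' (q t) *\<^sub>v u t"
      using assoc_mult_mat_vec[OF Kc sys(1) xc[OF t(1)]] assoc_mult_mat_vec[OF Kc sys(2) ut]
        assoc_mult_mat_vec[OF sys'(1) Kc xc[OF t(1)]] int by simp
    finally have eq: "K *\<^sub>v ?w = Amat S' (q t) *\<^sub>v (K *\<^sub>v x t) + Bmat S' (q t) *\<^sub>v u t" .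
    have "((\<lambda>s. \<Sum>j<?n. K $$ (i,j) * x s $ j) has_real_derivative (\<Sum>j<?n. K $$ (i,j) * ?w $ j)) (at t within {0..})"
      by (intro DERIV_sum DERIV_cmult) (use N(2)[OF t] in auto)
    then have "((\<lambda>s. \<Sum>j<?n. K $$ (i,j) * x s $ j) has_real_derivative (K *\<^sub>v ?w) $ i) (at t within {0..})"
      using mat_mult_vec_sum[OF Kc w i] by simp
    then show ?thesis unfolding eq
      unfolding has_field_derivative_def
      by (rule has_derivative_transform[rotated 2]) (use t Kx i in auto)
  qed
  show ?thesis
    unfolding ct_solution_def
  proof (intro conjI allI impI)
    show "K *\<^sub>v x t \<in> carrier_vec ?n'" if "t \<ge> 0" for t using Kc xc[OF that] by simp
    have "x 0 = 0\<^sub>v ?n" using x unfolding ct_solution_def by blast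
    then show "K *\<^sub>v x 0 = 0\<^sub>v ?n'" using Kc by (intro eq_vecI) (auto simp: scalar_prod_def)
    show "AE t in lebesgue_on {0..}. \<forall>i<?n'. ((\<lambda>s. (K *\<^sub>v x s) $ i) has_real_derivative
        (Amat S' (q t) *\<^sub>v (K *\<^sub>v x t) + Bmat S' (q t) *\<^sub>v u t) $ i) (at t within {0..})"
      unfolding AE_half_line_iff_negligible using N(1) der by blast
    fix i and b :: real assume i: "i < ?n'" and b: "b \<ge> 0"
    have "abs_continuous_on {0..b} (\<lambda>t. \<Sum>j<?n. K $$ (i,j) * x t $ j)"
      by (intro abs_continuous_on_sum abs_continuous_on_cmult) (use x b in \<open>auto simp: ct_solution_def\<close>)
    then show "abs_continuous_on {0..b} (\<lambda>t. (K *\<^sub>v x t) $ i)"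
      by (subst abs_continuous_on_cong[of _ _ "\<lambda>t. \<Sum>j<?n. K $$ (i,j) * x t $ j"]) (use Kx i in auto)
  qed
qed

lemma ct_equivalent_intertwines:
  assumes lss: "is_lss D m p S" "is_lss D m p S'" and K: "intertwines D S S' K"
  shows "ct_equivalent D m S S'" "ct_equivalent D m S' S"
proof -
  have "ct_io_map S u q t = ct_io_map S' u q t"
    if u: "u \<in> ct_inputs m" and q: "q \<in> ct_switchings D" and t: "t \<ge> 0" for u q t
  proof -
    obtain x where x: "ct_solution S u q x" using ct_solution_exists[OF lss(1) u q] .
    have xc: "x t \<in> carrier_vec (sdim S)" using x t unfolding ct_solution_def by auto
    have Kc: "K \<in> carrier_mat (sdim S') (sdim S)" "Cmat S (q t) = Cmat S' (q t) * K"
      using K ct_switchingsD[OF q t] unfolding intertwines_def by auto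
    have "ct_io_map S' u q t = Cmat S' (q t) *\<^sub>v (K *\<^sub>v x t)"
      by (rule ct_io_map_eq[OF lss(2) u q ct_solution_intertwines[OF lss K u q x] t])
    also have "\<dots> = Cmat S (q t) *\<^sub>v x t"
      using assoc_mult_mat_vec[OF is_lssD(3)[OF lss(2) ct_switchingsD[OF q t]] Kc(1) xc] Kc(2) by simp
    finally show ?thesis using ct_io_map_eq[OF lss(1) u q x t] by simp
  qed
  then show "ct_equivalent D m S S'" "ct_equivalent D m S' S" unfolding ct_equivalent_def by auto
qed

lemma ct_minimal_irreducible:
  assumes "ct_minimal D m p S"
  shows "irreducible_lss D m p S"
  using assms ct_equivalent_intertwines unfolding ct_minimal_def irreducible_lss_def by blast

lemma ct_inputs_append_const:
  assumes u: "u \<in> ct_inputs m" and v: "v \<in> carrier_vec m"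
  shows "(\<lambda>s. if s < t0 then u s else if s < t0 + 1 then v else 0\<^sub>v m) \<in> ct_inputs m" (is "?w \<in> _")
proof -
  have "(\<lambda>s. ?w s $ i) \<in> borel_measurable (lebesgue_on {0..}) \<and> integrable (lebesgue_on {0..}) (\<lambda>s. (?w s $ i)\<^sup>2)"
    if i: "i < m" for i
  proof
    have um: "(\<lambda>s. u s $ i) \<in> borel_measurable (lebesgue_on {0..})"
      and u2: "integrable (lebesgue_on {0..}) (\<lambda>s. (u s $ i)\<^sup>2)" using u i unfolding ct_inputs_def by auto
    have id: "(\<lambda>s::real. s) \<in> borel_measurable (lebesgue_on {0..})"
      by (rule continuous_imp_measurable_on_sets_lebesgue) (auto intro: continuous_intros)
    have w: "(\<lambda>s. ?w s $ i) = (\<lambda>s. if s < t0 then u s $ i else if s < t0 + 1 then v $ i else 0)"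
      using i by auto
    show wm: "(\<lambda>s. ?w s $ i) \<in> borel_measurable (lebesgue_on {0..})"
      unfolding w using um id by measurable
    let ?J = "{t0..t0+1} \<inter> {0..}"
    show "integrable (lebesgue_on {0..}) (\<lambda>s. (?w s $ i)\<^sup>2)"
    proof (rule Bochner_Integration.integrable_bound)
      have "integrable (lebesgue_on {0..}) (indicator ?J :: real \<Rightarrow> real)"
      proof (rule integrable_real_indicator)
        show "?J \<in> sets (lebesgue_on {0..})" by (auto simp: sets_restrict_space)
        have "emeasure (lebesgue_on {0..}) ?J = emeasure lebesgue ?J"
          by (rule emeasure_restrict_space) auto
        also have "\<dots> \<le> emeasure lebesgue {t0..t0+1}" by (rule emeasure_mono) auto
        also have "\<dots> < \<infinity>" by (simp add: emeasure_lborel_Icc_eq)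
        finally show "emeasure (lebesgue_on {0..}) ?J < \<infinity>" .
      qed
      then show "integrable (lebesgue_on {0..}) (\<lambda>s. (u s $ i)\<^sup>2 + (v $ i)\<^sup>2 * indicator ?J s)"
        using u2 by (intro Bochner_Integration.integrable_add integrable_mult_right) auto
      show "(\<lambda>s. (?w s $ i)\<^sup>2) \<in> borel_measurable (lebesgue_on {0..})" using wm by measurable
      show "AE s in lebesgue_on {0..}. norm ((?w s $ i)\<^sup>2) \<le> norm ((u s $ i)\<^sup>2 + (v $ i)\<^sup>2 * indicator ?J s)"
        using i by (intro AE_I2) (auto simp: indicator_def space_restrict_space)
    qed
  qed
  then show ?thesis using u v unfolding ct_inputs_def by auto
qed

lemma eventually_at_within_of_nhds:
  "\<forall>\<^sub>F s in nhds t. P s \<Longrightarrow> \<forall>\<^sub>F s in at t within A. P s"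
  unfolding eventually_at_filter by (erule eventually_mono) blast

lemma ct_switchings_append_const:
  assumes q: "q \<in> ct_switchings D" and c: "c \<in> {1..D}"
  shows "(\<lambda>s. if s < t0 then q s else c) \<in> ct_switchings D" (is "?r \<in> _")
  unfolding ct_switchings_def
proof (intro CollectI conjI allI impI)
  fix t :: real
  show "?r t \<in> {1..D}" if "t \<ge> 0" using ct_switchingsD[OF q that] c by auto
  have left: "\<forall>\<^sub>F s in nhds t. ?r s = q s" if "t < t0"
    using that by (auto simp: eventually_nhds intro!: exI[of _ "{..<t0}"])
  have right: "\<forall>\<^sub>F s in nhds t. ?r s = c" if "t > t0"
    using that by (auto simp: eventually_nhds intro!: exI[of _ "{t0<..}"])
  show "\<exists>l. (?r \<longlongrightarrow> l) (at_right t)" if t: "t \<ge> 0"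
  proof (cases "t < t0")
    case True
    obtain l where l: "(q \<longlongrightarrow> l) (at_right t)" using q t unfolding ct_switchings_def by blast
    have "\<forall>\<^sub>F s in at_right t. ?r s = q s" by (rule eventually_at_within_of_nhds[OF left[OF True]])
    from tendsto_cong[OF this] l show ?thesis by blast
  next
    case False
    then have "\<forall>\<^sub>F s in at_right t. ?r s = c" unfolding eventually_at_filter by (intro always_eventually) auto
    from tendsto_eventually[OF this] show ?thesis by blast
  qed
  show "\<exists>l. (?r \<longlongrightarrow> l) (at_left t)" if t: "t > 0"
  proof (cases "t > t0")
    case True
    from tendsto_eventually[OF eventually_at_within_of_nhds[OF right[OF True]]] show ?thesis by blast
  next
    case False
    obtain l where l: "(q \<longlongrightarrow> l) (at_left t)" using q t unfolding ct_switchings_def by blast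
    have "\<forall>\<^sub>F s in at_left t. ?r s = q s" unfolding eventually_at_filter by (rule always_eventually) (use False in auto)
    from tendsto_cong[OF this] l show ?thesis by blast
  qed
next
  fix b :: real assume b: "b \<ge> 0"
  have "continuous (at t within {0..}) ?r" if t: "t \<noteq> t0" and qc: "continuous (at t within {0..}) q" for t
  proof (cases "t < t0")
    case True
    then have "\<forall>\<^sub>F s in at t within {0..}. ?r s = q s"
      by (intro eventually_at_within_of_nhds) (auto simp: eventually_nhds intro!: exI[of _ "{..<t0}"])
    from tendsto_cong[OF this] show ?thesis using qc True unfolding continuous_within by simp
  next
    case False
    then have "t > t0" using t by simp
    then have "\<forall>\<^sub>F s in at t within {0..}. ?r s = c"
      by (intro eventually_at_within_of_nhds) (auto simp: eventually_nhds intro!: exI[of _ "{t0<..}"])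
    from tendsto_eventually[OF this] show ?thesis using False unfolding continuous_within by simp
  qed
  then have "{t\<in>{0..b}. \<not> continuous (at t within {0..}) ?r} \<subseteq> insert t0 {t\<in>{0..b}. \<not> continuous (at t within {0..}) q}"
    by blast
  moreover have "finite (insert t0 {t\<in>{0..b}. \<not> continuous (at t within {0..}) q})"
    using q b unfolding ct_switchings_def by simp
  ultimately show "finite {t\<in>{0..b}. \<not> continuous (at t within {0..}) ?r}" by (rule finite_subset)
qed

lemma ct_solution_right_derivative:
  assumes lss: "is_lss D m p S" and x: "ct_solution S u q x" and t0: "t0 \<ge> 0"
    and c: "c \<in> {1..D}" and v: "v \<in> carrier_vec m"
    and const: "\<And>s. t0 \<le> s \<Longrightarrow> s < t0 + 1 \<Longrightarrow> u s = v \<and> q s = c" and i: "i < sdim S"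
  shows "((\<lambda>s. x s $ i) has_real_derivative (Amat S c *\<^sub>v x t0 + Bmat S c *\<^sub>v v) $ i) (at t0 within {t0..t0+1})"
proof -
  let ?n = "sdim S"
  note sys = is_lssD[OF lss c]
  obtain N where N: "negligible N" "\<And>t i. t \<ge> 0 \<Longrightarrow> t \<notin> N \<Longrightarrow> i < ?n \<Longrightarrow> ((\<lambda>s. x s $ i) has_real_derivative
        (Amat S (q t) *\<^sub>v x t + Bmat S (q t) *\<^sub>v u t) $ i) (at t within {0..})"
    using x unfolding ct_solution_def AE_half_line_iff_negligible by blast
  have xc: "x t \<in> carrier_vec ?n" if "t \<ge> 0" for t using x that unfolding ct_solution_def by auto
  have ac: "abs_continuous_on {0..t0+1} (\<lambda>s. x s $ j)" if "j < ?n" for j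
    using x t0 that unfolding ct_solution_def by simp
  show ?thesis
  proof (rule abs_continuous_on_right_derivative[OF _ _ N(1), of t0 "t0 + 1" "\<lambda>s. x s $ i" "\<lambda>t. (Amat S c *\<^sub>v x t + Bmat S c *\<^sub>v v) $ i"])
    show "abs_continuous_on {t0..t0+1} (\<lambda>s. x s $ i)"
      by (rule abs_continuous_on_subset[OF ac[OF i]]) (use t0 in auto)
    fix t assume t: "t \<in> {t0..<t0+1} - N"
    then have "((\<lambda>s. x s $ i) has_real_derivative (Amat S c *\<^sub>v x t + Bmat S c *\<^sub>v v) $ i) (at t within {0..})"
      using N(2)[of t i] const[of t] i t0 by auto
    then show "((\<lambda>s. x s $ i) has_real_derivative (Amat S c *\<^sub>v x t + Bmat S c *\<^sub>v v) $ i) (at t within {t0..t0+1})"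
      by (rule has_field_derivative_subset) (use t0 in auto)
  next
    have "continuous_on {t0..<t0+1} (\<lambda>t. (\<Sum>j<?n. Amat S c $$ (i,j) * x t $ j) + (Bmat S c *\<^sub>v v) $ i)"
      by (intro continuous_intros continuous_on_subset[OF abs_continuous_on_imp_continuous_on[OF ac]]) (use t0 in auto)
    moreover have "(Amat S c *\<^sub>v x t + Bmat S c *\<^sub>v v) $ i = (\<Sum>j<?n. Amat S c $$ (i,j) * x t $ j) + (Bmat S c *\<^sub>v v) $ i"
      if "t \<in> {t0..<t0+1}" for t
    proof -
      have "t \<ge> 0" using that t0 by auto
      from mat_mult_vec_sum[OF sys(1) xc[OF this] i] show ?thesis using sys v i by simp
    qed
    ultimately show "continuous_on {t0..<t0+1} (\<lambda>t. (Amat S c *\<^sub>v x t + Bmat S c *\<^sub>v v) $ i)"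
      by (subst continuous_on_cong[OF refl]) auto
  qed auto
qed

text \<open>
  This is how the step condition for functionals enters in continuous time: the velocity at the start
  \<open>t0\<close> of a phase with constant mode and input plays the role of the successor state.
\<close>

lemma ct_solution_functional_right_derivative:
  assumes lss: "is_lss D m p S" and x: "ct_solution S u q x" and t0: "t0 \<ge> 0"
    and c: "c \<in> {1..D}" and v: "v \<in> carrier_vec m"
    and const: "\<And>s. t0 \<le> s \<Longrightarrow> s < t0 + 1 \<Longrightarrow> u s = v \<and> q s = c" and l: "l \<in> carrier_vec (sdim S)"
  shows "((\<lambda>s. l \<bullet> x s) has_real_derivative l \<bullet> (Amat S c *\<^sub>v x t0 + Bmat S c *\<^sub>v v)) (at t0 within {t0..t0+1})"
proof -
  let ?n = "sdim S"
  note sys = is_lssD[OF lss c]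
  have xc: "x t \<in> carrier_vec ?n" if "t \<ge> 0" for t using x that unfolding ct_solution_def by auto
  have lsum: "l \<bullet> w = (\<Sum>i<?n. l $ i * w $ i)" if "w \<in> carrier_vec ?n" for w
    using that by (simp add: scalar_prod_def atLeast0LessThan)
  have w: "Amat S c *\<^sub>v x t0 + Bmat S c *\<^sub>v v \<in> carrier_vec ?n" using sys xc[OF t0] v by auto
  have "((\<lambda>s. \<Sum>i<?n. l $ i * x s $ i) has_real_derivative (\<Sum>i<?n. l $ i * (Amat S c *\<^sub>v x t0 + Bmat S c *\<^sub>v v) $ i))
      (at t0 within {t0..t0+1})"
    by (intro DERIV_sum DERIV_cmult ct_solution_right_derivative[OF lss x t0 c v const]) auto
  then have "((\<lambda>s. \<Sum>i<?n. l $ i * x s $ i) has_real_derivative l \<bullet> (Amat S c *\<^sub>v x t0 + Bmat S c *\<^sub>v v))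
      (at t0 within {t0..t0+1})"
    unfolding lsum[OF w] .
  then show ?thesis
    unfolding has_field_derivative_def
    by (rule has_derivative_transform[rotated 2]) (use t0 lsum xc in auto)
qed

text \<open>
  Any experiment can be cut at time \<open>t\<close> and continued with an arbitrary mode and constant input for one
  time unit, reaching the same states at \<open>t\<close>. The output at \<open>t\<close> then gives the output condition. The
  functionals agree along the whole continuation, so their right derivatives at \<open>t\<close> coincide, which is the
  step condition.
\<close>

lemma ct_equivalent_dual_bisimulation:
  assumes lss: "is_lss D m p S" "is_lss D m p S'" and D: "D \<ge> 1" and eq: "ct_equivalent D m S S'"
  obtains N where "dual_bisimulation D p S S' N"
proof -
  let ?Z = "{(x t, x' t) | x x' t u q. u \<in> ct_inputs m \<and> q \<in> ct_switchings D \<and> t \<ge> 0 \<and>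
      ct_solution S u q x \<and> ct_solution S' u q x'}"
  have ext: "\<exists>w r y y'. w \<in> ct_inputs m \<and> r \<in> ct_switchings D \<and> ct_solution S w r y \<and> ct_solution S' w r y' \<and>
      y t = x t \<and> y' t = x' t \<and> (\<forall>s. t \<le> s \<longrightarrow> s < t + 1 \<longrightarrow> w s = v \<and> r s = c)"
    if u: "u \<in> ct_inputs m" and q: "q \<in> ct_switchings D" and t: "t \<ge> 0"
      and x: "ct_solution S u q x" and x': "ct_solution S' u q x'" and v: "v \<in> carrier_vec m" and c: "c \<in> {1..D}"
    for u q t x x' c and v :: "real vec"
  proof -
    \<comment> \<open>After time \<open>t + 1\<close> the input vanishes to remain square integrable.\<close>
    let ?w = "\<lambda>s. if s < t then u s else if s < t + 1 then v else 0\<^sub>v m"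
    let ?r = "\<lambda>s. if s < t then q s else c"
    have w: "?w \<in> ct_inputs m" and r: "?r \<in> ct_switchings D"
      using ct_inputs_append_const[OF u v] ct_switchings_append_const[OF q c] by auto
    obtain y where y: "ct_solution S ?w ?r y" using ct_solution_exists[OF lss(1) w r] .
    obtain y' where y': "ct_solution S' ?w ?r y'" using ct_solution_exists[OF lss(2) w r] .
    have "x t = y t" by (rule ct_solution_unique[OF lss(1) u q x y, of t]) (use t in auto)
    moreover have "x' t = y' t" by (rule ct_solution_unique[OF lss(2) u q x' y', of t]) (use t in auto)
    ultimately show ?thesis using w r y y' by (intro exI[of _ ?w] exI[of _ ?r] exI[of _ y] exI[of _ y']) auto
  qed
  have "dual_bisimulation D p S S' (\<lambda>l l'. l \<in> carrier_vec (sdim S) \<and> l' \<in> carrier_vec (sdim S') \<and>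
      (\<forall>(x,x')\<in>?Z. l \<bullet> x = l' \<bullet> x'))"
  proof (rule annihilator_dual_bisimulation[OF lss])
    fix x x' assume "(x,x') \<in> ?Z"
    then show "x \<in> carrier_vec (sdim S) \<and> x' \<in> carrier_vec (sdim S')"
      unfolding ct_solution_def by blast
  next
    have u: "(\<lambda>t. 0\<^sub>v m) \<in> ct_inputs m" and q: "(\<lambda>t. 1) \<in> ct_switchings D"
      using D unfolding ct_inputs_def ct_switchings_def by auto
    obtain x where x: "ct_solution S (\<lambda>t. 0\<^sub>v m) (\<lambda>t. 1) x" using ct_solution_exists[OF lss(1) u q] .
    obtain x' where x': "ct_solution S' (\<lambda>t. 0\<^sub>v m) (\<lambda>t. 1) x'" using ct_solution_exists[OF lss(2) u q] .
    have "(0\<^sub>v (sdim S), 0\<^sub>v (sdim S')) = (x 0, x' 0)" using x x' unfolding ct_solution_def by simp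
    then show "(0\<^sub>v (sdim S), 0\<^sub>v (sdim S')) \<in> ?Z" using u q x x' by (intro CollectI exI[of _ x] exI[of _ x'] exI[of _ "0::real"] exI conjI) auto
  next
    fix z z' c assume "(z,z') \<in> ?Z" and c: "c \<in> {1..D}"
    then obtain x x' t u q where z: "z = x t" "z' = x' t" and u: "u \<in> ct_inputs m" and q: "q \<in> ct_switchings D"
      and t: "t \<ge> 0" and x: "ct_solution S u q x" and x': "ct_solution S' u q x'" by blast
    obtain w r y y' where w: "w \<in> ct_inputs m" "r \<in> ct_switchings D" and y: "ct_solution S w r y" "ct_solution S' w r y'"
      and yt: "y t = x t" "y' t = x' t" and const: "\<And>s. t \<le> s \<Longrightarrow> s < t + 1 \<Longrightarrow> w s = 0\<^sub>v m \<and> r s = c"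
      using ext[OF u q t x x' zero_carrier_vec c] by blast
    have "r t = c" using const[of t] by simp
    moreover have "ct_io_map S w r t = ct_io_map S' w r t" using eq w t unfolding ct_equivalent_def by blast
    ultimately show "Cmat S c *\<^sub>v z = Cmat S' c *\<^sub>v z'"
      using ct_io_map_eq[OF lss(1) w y(1) t] ct_io_map_eq[OF lss(2) w y(2) t] yt z by simp
  next
    fix l l' z z' c and v :: "real vec"
    assume l: "l \<in> carrier_vec (sdim S)" "l' \<in> carrier_vec (sdim S')"
      and Z: "\<And>y y'. (y,y') \<in> ?Z \<Longrightarrow> l \<bullet> y = l' \<bullet> y'" and "(z,z') \<in> ?Z" and c: "c \<in> {1..D}"
      and v: "v \<in> carrier_vec m"
    then obtain x x' t u q where z: "z = x t" "z' = x' t" and u: "u \<in> ct_inputs m" and q: "q \<in> ct_switchings D"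
      and t: "t \<ge> 0" and x: "ct_solution S u q x" and x': "ct_solution S' u q x'" by blast
    obtain w r y y' where w: "w \<in> ct_inputs m" "r \<in> ct_switchings D" and y: "ct_solution S w r y" "ct_solution S' w r y'"
      and yt: "y t = x t" "y' t = x' t" and const: "\<And>s. t \<le> s \<Longrightarrow> s < t + 1 \<Longrightarrow> w s = v \<and> r s = c"
      using ext[OF u q t x x' v c] by blast
    have eqs: "l \<bullet> y s = l' \<bullet> y' s" if "s \<ge> 0" for s
      by (rule Z) (use w y that in blast)
    have d: "((\<lambda>s. l \<bullet> y s) has_real_derivative l \<bullet> (Amat S c *\<^sub>v y t + Bmat S c *\<^sub>v v)) (at t within {t..t+1})"
      by (rule ct_solution_functional_right_derivative[OF lss(1) y(1) t c v const l(1)])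
    have "((\<lambda>s. l' \<bullet> y' s) has_real_derivative l' \<bullet> (Amat S' c *\<^sub>v y' t + Bmat S' c *\<^sub>v v)) (at t within {t..t+1})"
      by (rule ct_solution_functional_right_derivative[OF lss(2) y(2) t c v const l(2)])
    then have d': "((\<lambda>s. l \<bullet> y s) has_real_derivative l' \<bullet> (Amat S' c *\<^sub>v y' t + Bmat S' c *\<^sub>v v)) (at t within {t..t+1})"
      unfolding has_field_derivative_def
      by (rule has_derivative_transform[rotated 2]) (use eqs t in auto)
    have "l \<bullet> (Amat S c *\<^sub>v y t + Bmat S c *\<^sub>v v) = l' \<bullet> (Amat S' c *\<^sub>v y' t + Bmat S' c *\<^sub>v v)"
      by (rule vector_derivative_unique_within_closed_interval[of t "t + 1" t "\<lambda>s. l \<bullet> y s"])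
        (use d d' in \<open>auto simp: has_real_derivative_iff_has_vector_derivative\<close>)
    then show "l \<bullet> (Amat S c *\<^sub>v z + Bmat S c *\<^sub>v v) = l' \<bullet> (Amat S' c *\<^sub>v z' + Bmat S' c *\<^sub>v v)"
      unfolding z yt .
  qed
  then show thesis using that by blast
qed

section \<open>Singular values of equivalent minimal systems\<close>

theorem corollary1:
  fixes D m p :: nat
    and \<Sigma>\<^sub>1 \<Sigma>\<^sub>2 :: lss
    and P\<^sub>1 R\<^sub>1 :: "real mat"
  assumes "D \<ge> 1"
  shows
    "(ct_minimal D m p \<Sigma>\<^sub>1 \<and> ct_ctrl_grammian D \<Sigma>\<^sub>1 P\<^sub>1 \<and> ct_obs_grammian D \<Sigma>\<^sub>1 R\<^sub>1 \<and>
      ct_minimal D m p \<Sigma>\<^sub>2 \<and> ct_equivalent D m \<Sigma>\<^sub>2 \<Sigma>\<^sub>1 \<longrightarrow>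
        (\<exists>P\<^sub>2 R\<^sub>2. ct_ctrl_grammian D \<Sigma>\<^sub>2 P\<^sub>2 \<and> ct_obs_grammian D \<Sigma>\<^sub>2 R\<^sub>2 \<and>
           singular_values P\<^sub>2 R\<^sub>2 = singular_values P\<^sub>1 R\<^sub>1)) \<and>
     (dt_minimal D m p \<Sigma>\<^sub>1 \<and> dt_ctrl_grammian D \<Sigma>\<^sub>1 P\<^sub>1 \<and> dt_obs_grammian D \<Sigma>\<^sub>1 R\<^sub>1 \<and>
      dt_minimal D m p \<Sigma>\<^sub>2 \<and> dt_equivalent D m \<Sigma>\<^sub>2 \<Sigma>\<^sub>1 \<longrightarrow>
        (\<exists>P\<^sub>2 R\<^sub>2. dt_ctrl_grammian D \<Sigma>\<^sub>2 P\<^sub>2 \<and> dt_obs_grammian D \<Sigma>\<^sub>2 R\<^sub>2 \<and>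
           singular_values P\<^sub>2 R\<^sub>2 = singular_values P\<^sub>1 R\<^sub>1))"
proof (intro conjI impI)
  assume *: "ct_minimal D m p \<Sigma>\<^sub>1 \<and> ct_ctrl_grammian D \<Sigma>\<^sub>1 P\<^sub>1 \<and> ct_obs_grammian D \<Sigma>\<^sub>1 R\<^sub>1 \<and>
      ct_minimal D m p \<Sigma>\<^sub>2 \<and> ct_equivalent D m \<Sigma>\<^sub>2 \<Sigma>\<^sub>1"
  have lss: "is_lss D m p \<Sigma>\<^sub>1" "is_lss D m p \<Sigma>\<^sub>2" using * unfolding ct_minimal_def by blast+
  have irr: "irreducible_lss D m p \<Sigma>\<^sub>1" "irreducible_lss D m p \<Sigma>\<^sub>2" using * ct_minimal_irreducible by blast+
  have "ct_equivalent D m \<Sigma>\<^sub>1 \<Sigma>\<^sub>2" using * unfolding ct_equivalent_def by simp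
  then obtain N where N: "dual_bisimulation D p \<Sigma>\<^sub>1 \<Sigma>\<^sub>2 N"
    using ct_equivalent_dual_bisimulation[OF lss assms] by blast
  obtain K L where KL: "intertwines D \<Sigma>\<^sub>1 \<Sigma>\<^sub>2 K" "intertwines D \<Sigma>\<^sub>2 \<Sigma>\<^sub>1 L" "K * L = 1\<^sub>m (sdim \<Sigma>\<^sub>2)"
    "L * K = 1\<^sub>m (sdim \<Sigma>\<^sub>1)" "sdim \<Sigma>\<^sub>2 = sdim \<Sigma>\<^sub>1"
    using irreducible_isomorphic[OF irr N] by blast
  have pd: "pos_definite (sdim \<Sigma>\<^sub>1) P\<^sub>1" "pos_definite (sdim \<Sigma>\<^sub>1) R\<^sub>1"
    using * unfolding ct_ctrl_grammian_def ct_obs_grammian_def by blast+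
  show "\<exists>P\<^sub>2 R\<^sub>2. ct_ctrl_grammian D \<Sigma>\<^sub>2 P\<^sub>2 \<and> ct_obs_grammian D \<Sigma>\<^sub>2 R\<^sub>2 \<and>
      singular_values P\<^sub>2 R\<^sub>2 = singular_values P\<^sub>1 R\<^sub>1"
    using isomorphic_grammians(1,3)[OF lss KL] isomorphic_grammians(5)[OF lss KL pd] * by blast
next
  assume *: "dt_minimal D m p \<Sigma>\<^sub>1 \<and> dt_ctrl_grammian D \<Sigma>\<^sub>1 P\<^sub>1 \<and> dt_obs_grammian D \<Sigma>\<^sub>1 R\<^sub>1 \<and>
      dt_minimal D m p \<Sigma>\<^sub>2 \<and> dt_equivalent D m \<Sigma>\<^sub>2 \<Sigma>\<^sub>1"
  have lss: "is_lss D m p \<Sigma>\<^sub>1" "is_lss D m p \<Sigma>\<^sub>2" using * unfolding dt_minimal_def by blast+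
  have irr: "irreducible_lss D m p \<Sigma>\<^sub>1" "irreducible_lss D m p \<Sigma>\<^sub>2" using * dt_minimal_irreducible by blast+
  have "dt_equivalent D m \<Sigma>\<^sub>1 \<Sigma>\<^sub>2" using * unfolding dt_equivalent_def by simp
  then obtain N where N: "dual_bisimulation D p \<Sigma>\<^sub>1 \<Sigma>\<^sub>2 N"
    using dt_equivalent_dual_bisimulation[OF lss assms] by blast
  obtain K L where KL: "intertwines D \<Sigma>\<^sub>1 \<Sigma>\<^sub>2 K" "intertwines D \<Sigma>\<^sub>2 \<Sigma>\<^sub>1 L" "K * L = 1\<^sub>m (sdim \<Sigma>\<^sub>2)"
    "L * K = 1\<^sub>m (sdim \<Sigma>\<^sub>1)" "sdim \<Sigma>\<^sub>2 = sdim \<Sigma>\<^sub>1"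
    using irreducible_isomorphic[OF irr N] by blast
  have pd: "pos_definite (sdim \<Sigma>\<^sub>1) P\<^sub>1" "pos_definite (sdim \<Sigma>\<^sub>1) R\<^sub>1"
    using * unfolding dt_ctrl_grammian_def dt_obs_grammian_def by blast+
  show "\<exists>P\<^sub>2 R\<^sub>2. dt_ctrl_grammian D \<Sigma>\<^sub>2 P\<^sub>2 \<and> dt_obs_grammian D \<Sigma>\<^sub>2 R\<^sub>2 \<and>
      singular_values P\<^sub>2 R\<^sub>2 = singular_values P\<^sub>1 R\<^sub>1"
    using isomorphic_grammians(2,4)[OF lss KL] isomorphic_grammians(5)[OF lss KL pd] * by blast
qed

end
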